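(* A given structure $(M,[\lambda,\mu])$ of an oriented congruence with vanishing twist, $a\equiv 0$, and nonvanishing shear, $s\neq0$, uniquely defines a 4-dimensional manifold $P$, 1-forms $\omega,\omega_1,\bar\omega_1,\Omega$ and functions $T_0,K_0$ (real), $T_1,K_1$ (complex) on $P$ such that: - $\omega,\omega_1,\bar\omega_1,\Omega$ are of the form $$\omega=e^{i\epsilon\pi}|s|\lambda,\qquad \omega_1=\rho\, e^{-\frac i2(\psi-\epsilon\pi)}\mu,\qquad \bar\omega_1=\rho\, e^{\frac i2(\psi-\epsilon\pi)}\bar\mu,$$ $$\Omega=d\log\rho+\tfrac{i\psi_\mu-2\bar p}{2\rho}e^{\frac i2(\psi-\epsilon\pi)}\omega_1+\tfrac{-i\psi_{\bar\mu}-2p}{2\rho}e^{-\frac i2(\psi-\epsilon\pi)}\bar\omega_1+\Big(1-e^{i\epsilon\pi}\tfrac{q+\bar q}{2|s|}\Big)\omega;$$ - $\omega\wedge\omega_1\wedge\bar\omega_1\wedge\Omega\neq0$ at each point of $P$; - the forms and functions $T_0,T_1,K_0,K_1$ are uniquely determined by the requirement that on $P$ they satisfy the equations $$d\omega=T_1\,\omega_1\wedge\omega+\bar T_1\,\bar\omega_1\wedge\omega,$$ $$d\omega_1=\Omega\wedge\omega_1+(\omega_1+\bar\omega_1)\wedge\omega+iT_0\,\omega_1\wedge\omega,$$ $$d\bar\omega_1=\Omega\wedge\bar\omega_1+(\omega_1+\bar\omega_1)\wedge\omega-iT_0\,\bar\omega_1\wedge\omega,$$ $$d\Omega=iK_0\,\omega_1\wedge\bar\omega_1+K_1\,\omega_1\wedge\omega+\bar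 K_1\,\bar\omega_1\wedge\omega.$$ In particular $T_0$ is an invariant of the structure on $M$; the identical vanishing, or not, of either of the functions $t_1$, $k_0$ or $k_1$ (given explicitly in the context) is an invariant condition on $M$.
   Context: All objects are smooth. A structure of an oriented congruence $(M,[\lambda,\mu])$ on a 3-manifold $M$ is an equivalence class of pairs of 1-forms $(\lambda,\mu)$, $\lambda$ real, $\mu$ complex, with $\lambda\wedge\mu\wedge\bar\mu\neq 0$ at each point, where $(\lambda,\mu)\sim(\lambda',\mu')$ iff $\lambda'=f\lambda$, $\mu'=h\mu$ for nonvanishing functions $f$ (real), $h$ (complex). For a representative write $d\lambda=ia\,\mu\wedge\bar\mu+b\,\mu\wedge\lambda+\bar b\,\bar\mu\wedge\lambda$, $d\mu=p\,\mu\wedge\bar\mu+q\,\mu\wedge\lambda+s\,\bar\mu\wedge\lambda$, with $a$ real and $b,p,q,s$ complex; $a$ is the twist, $s$ the shear, and $s=|s|e^{i\psi}$. For a function $u$, $du=u_\lambda\lambda+u_\mu\mu+u_{\bar\mu}\bar\mu$, iterated subscripts being applied left to right. The manifold $P$ is locally $M\times\mathbb{R}_+$, fibred over $M$, with positive fibre coordinate $\rho$. The parameter $\epsilon\in\{0,1\}$ arises because the normalization $d\omega_1\wedge\omega_1=\omega_1\wedge\bar\omega_1\wedge\omega$ determines $f$ in $\omega=f\lambda$ modulo sign, $f=e^{i\epsilon\pi}|s|$. The functions $T_0,T_1,K_0,K_1$ are defined modulo the parameter $\epsilon$; two structures which differ only by the value of $\epsilon$ are equivalent. Explicitly, $T_0=\frac{\psi_\lambda+i(\bar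 q-q)}{2|s|}e^{i\epsilon\pi}$ (constant along the fibres, so it projects to $M$), $T_1=\frac{t_1}{\rho}$, $K_0=\frac{k_0}{2\rho^2}$, $K_1=\frac{k_1}{2\rho}$, where $$t_1=(b|s|+|s|_\mu)\frac{e^{\frac i2(\psi-\epsilon\pi)}}{|s|},$$ $$k_0=-\psi_{\mu\bar\mu}-\psi_{\bar\mu\mu}+p\psi_\mu+\bar p\psi_{\bar\mu}+2i(p_\mu-\bar p_{\bar\mu}),$$ $$k_1=2(t_1-\bar t_1)+e^{\frac i2\epsilon\pi}\big[(b\bar q-bq-q_\mu+\bar q_\mu+iq\psi_\mu-i\psi_{\mu\lambda})e^{\frac i2\psi}+i\psi_{\bar\mu}|s|e^{-\frac i2\psi}\big]|s|^{-1}.$$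
   Formalization: Invariance of k1≡0 and exact equality of T0 are stated for choices of ε giving the same ω (T0 otherwise up to sign), as (λ,μ)→(−λ,μ) swaps ε and can change whether k1 vanishes; uniqueness is up to ε and the branch of ψ, over connected open sets. *)

theory Defs
  imports "HOL-Analysis.Analysis"
begin

section \<open>Smooth manifolds, functions and maps\<close>

(* C^k on an open set S, for maps between normed spaces: all iterated directional derivatives up
   to order k exist as (Frechet) derivatives and are continuous. Only used for open S. *)
primrec Ck_on :: "nat \<Rightarrow> 'a::real_normed_vector set \<Rightarrow> ('a \<Rightarrow> 'b::real_normed_vector) \<Rightarrow> bool" where
  "Ck_on 0 S f \<longleftrightarrow> continuous_on S f"
| "Ck_on (Suc k) S f \<longleftrightarrow> (\<forall>x\<in>S. f differentiable (at x)) \<and>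
     (\<forall>v. Ck_on k S (\<lambda>x. frechet_derivative f (at x) v))"

definition smooth_on :: "'a::real_normed_vector set \<Rightarrow> ('a \<Rightarrow> 'b::real_normed_vector) \<Rightarrow> bool" where
  "smooth_on S f \<longleftrightarrow> (\<forall>k. Ck_on k S f)"

(* A chart is a pair (domain, coordinate map); values of the map outside its domain are irrelevant.
   A manifold is given by an atlas; the underlying point set is the union of the chart domains, an
   open subset of a Hausdorff, second countable type. *)
type_synonym ('m, 'e) chart = "'m set \<times> ('m \<Rightarrow> 'e)"

definition inv_chart :: "('m, 'e) chart \<Rightarrow> 'e \<Rightarrow> 'm" where
  "inv_chart c = inv_into (fst c) (snd c)"

definition carrier :: "('m, 'e) chart set \<Rightarrow> 'm set" where
  "carrier A = (\<Union>c\<in>A. fst c)"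

definition smooth_manifold ::
  "('m::{t2_space,second_countable_topology}, 'e::euclidean_space) chart set \<Rightarrow> bool" where
  "smooth_manifold A \<longleftrightarrow>
     (\<forall>c\<in>A. open (fst c) \<and> open (snd c ` fst c) \<and>
             homeomorphism (fst c) (snd c ` fst c) (snd c) (inv_chart c)) \<and>
     (\<forall>c\<in>A. \<forall>c'\<in>A. smooth_on (snd c ` (fst c \<inter> fst c')) (snd c' \<circ> inv_chart c))"

definition chart_at :: "('m, 'e) chart set \<Rightarrow> 'm \<Rightarrow> ('m, 'e) chart" where
  "chart_at A x = (SOME c. c \<in> A \<and> x \<in> fst c)"

definition smooth_fun ::
  "('m, 'e::euclidean_space) chart set \<Rightarrow> ('m \<Rightarrow> 'f::real_normed_vector) \<Rightarrow> bool" where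
  "smooth_fun A u \<longleftrightarrow> (\<forall>c\<in>A. smooth_on (snd c ` fst c) (u \<circ> inv_chart c))"

definition smooth_map ::
  "('m::topological_space, 'e::euclidean_space) chart set \<Rightarrow>
   ('n::topological_space, 'f::euclidean_space) chart set \<Rightarrow> ('m \<Rightarrow> 'n) \<Rightarrow> bool" where
  "smooth_map A B F \<longleftrightarrow> F ` carrier A \<subseteq> carrier B \<and> continuous_on (carrier A) F \<and>
     (\<forall>c\<in>A. \<forall>c'\<in>B. smooth_on (snd c ` (fst c \<inter> F -` fst c')) (snd c' \<circ> F \<circ> inv_chart c))"

definition diffeomorphism ::
  "('m::topological_space, 'e::euclidean_space) chart set \<Rightarrow>
   ('n::topological_space, 'f::euclidean_space) chart set \<Rightarrow> ('m \<Rightarrow> 'n) \<Rightarrow> bool" where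
  "diffeomorphism A B F \<longleftrightarrow> bij_betw F (carrier A) (carrier B) \<and> smooth_map A B F \<and>
     smooth_map B A (inv_into (carrier A) F)"

section \<open>Differential forms\<close>

(* The tangent space at x is identified with the model space 'e by means of the chart
   chart_at A x. Hence a complex-valued 1-form is a function from points to real-linear functionals
   on 'e, and the differential of a map is the derivative of its expression in the charts chosen at
   x and at F x. *)
type_synonym ('m, 'e) form1 = "'m \<Rightarrow> 'e \<Rightarrow> complex"

definition mderiv ::
  "('m, 'e::euclidean_space) chart set \<Rightarrow> ('n, 'f::euclidean_space) chart set \<Rightarrow>
   ('m \<Rightarrow> 'n) \<Rightarrow> 'm \<Rightarrow> 'e \<Rightarrow> 'f" where
  "mderiv A B F x =
     frechet_derivative (snd (chart_at B (F x)) \<circ> F \<circ> inv_chart (chart_at A x))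
       (at (snd (chart_at A x) x))"

definition pullback ::
  "('m, 'e::euclidean_space) chart set \<Rightarrow> ('n, 'f::euclidean_space) chart set \<Rightarrow>
   ('m \<Rightarrow> 'n) \<Rightarrow> ('n, 'f) form1 \<Rightarrow> ('m, 'e) form1" where
  "pullback A B F \<alpha> = (\<lambda>x v. \<alpha> (F x) (mderiv A B F x v))"

definition d_fun :: "('m, 'e::euclidean_space) chart set \<Rightarrow> ('m \<Rightarrow> complex) \<Rightarrow> ('m, 'e) form1" where
  "d_fun A u = (\<lambda>x. frechet_derivative (u \<circ> inv_chart (chart_at A x)) (at (snd (chart_at A x) x)))"

(* The expression of a 1-form in the coordinates y of a chart c: its value at the point with
   coordinates y on the tangent vector having components v in the chart c. *)
definition local_expr ::
  "('m, 'e::euclidean_space) chart set \<Rightarrow> ('m, 'e) chart \<Rightarrow> ('m, 'e) form1 \<Rightarrow> 'e \<Rightarrow> 'e \<Rightarrow> complex" where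
  "local_expr A c \<alpha> y v =
     \<alpha> (inv_chart c y)
       (frechet_derivative (snd (chart_at A (inv_chart c y)) \<circ> inv_chart c) (at y) v)"

definition smooth_form1 :: "('m, 'e::euclidean_space) chart set \<Rightarrow> ('m, 'e) form1 \<Rightarrow> bool" where
  "smooth_form1 A \<alpha> \<longleftrightarrow> (\<forall>x\<in>carrier A. linear (\<alpha> x)) \<and>
     (\<forall>c\<in>A. \<forall>v. smooth_on (snd c ` fst c) (\<lambda>y. local_expr A c \<alpha> y v))"

definition real_form1 :: "('m, 'e) chart set \<Rightarrow> ('m, 'e) form1 \<Rightarrow> bool" where
  "real_form1 A \<alpha> \<longleftrightarrow> (\<forall>x\<in>carrier A. \<forall>v. \<alpha> x v \<in> \<real>)"

definition cnj_form :: "('m, 'e) form1 \<Rightarrow> ('m, 'e) form1" where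
  "cnj_form \<alpha> = (\<lambda>x v. cnj (\<alpha> x v))"

(* Exterior derivative of a 1-form in coordinates, d alpha (u,v) = d_u (alpha v) - d_v (alpha u). *)
definition ext_d ::
  "('m, 'e::euclidean_space) chart set \<Rightarrow> ('m, 'e) form1 \<Rightarrow> 'm \<Rightarrow> 'e \<Rightarrow> 'e \<Rightarrow> complex" where
  "ext_d A \<alpha> x u v =
     (let c = chart_at A x; y = snd c x in
        frechet_derivative (\<lambda>y. local_expr A c \<alpha> y v) (at y) u
      - frechet_derivative (\<lambda>y. local_expr A c \<alpha> y u) (at y) v)"

definition wedge :: "('e \<Rightarrow> complex) \<Rightarrow> ('e \<Rightarrow> complex) \<Rightarrow> 'e \<Rightarrow> 'e \<Rightarrow> complex" (infixl "\<and>\<^sub>1" 75) where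
  "(\<alpha> \<and>\<^sub>1 \<beta>) u v = \<alpha> u * \<beta> v - \<alpha> v * \<beta> u"

(* Exterior products of three and four covectors: determinants, expanded along the first factor. *)
definition wedge3 ::
  "('e \<Rightarrow> complex) \<Rightarrow> ('e \<Rightarrow> complex) \<Rightarrow> ('e \<Rightarrow> complex) \<Rightarrow> 'e \<Rightarrow> 'e \<Rightarrow> 'e \<Rightarrow> complex" where
  "wedge3 \<alpha> \<beta> \<gamma> u v w =
     \<alpha> u * (\<beta> \<and>\<^sub>1 \<gamma>) v w - \<alpha> v * (\<beta> \<and>\<^sub>1 \<gamma>) u w + \<alpha> w * (\<beta> \<and>\<^sub>1 \<gamma>) u v"

definition wedge4 ::
  "('e \<Rightarrow> complex) \<Rightarrow> ('e \<Rightarrow> complex) \<Rightarrow> ('e \<Rightarrow> complex) \<Rightarrow> ('e \<Rightarrow> complex) \<Rightarrow>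
   'e \<Rightarrow> 'e \<Rightarrow> 'e \<Rightarrow> 'e \<Rightarrow> complex" where
  "wedge4 \<alpha> \<beta> \<gamma> \<delta> u v w z =
     \<alpha> u * wedge3 \<beta> \<gamma> \<delta> v w z - \<alpha> v * wedge3 \<beta> \<gamma> \<delta> u w z
   + \<alpha> w * wedge3 \<beta> \<gamma> \<delta> u v z - \<alpha> z * wedge3 \<beta> \<gamma> \<delta> u v w"

section \<open>Oriented congruences\<close>

type_synonym 'm atlas3 = "('m, real^3) chart set"
type_synonym 'm form3 = "('m, real^3) form1"

definition coframe :: "'m atlas3 \<Rightarrow> 'm form3 \<times> 'm form3 \<Rightarrow> bool" where
  "coframe A = (\<lambda>(l, m). smooth_form1 A l \<and> real_form1 A l \<and> smooth_form1 A m \<and>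
     (\<forall>x\<in>carrier A. \<exists>u v w. wedge3 (l x) (m x) (cnj_form m x) u v w \<noteq> 0))"

definition congruence_rel :: "'m atlas3 \<Rightarrow> (('m form3 \<times> 'm form3) \<times> ('m form3 \<times> 'm form3)) set" where
  "congruence_rel A = {((l, m), (l', m')). coframe A (l, m) \<and> coframe A (l', m') \<and>
     (\<exists>(f :: 'm \<Rightarrow> real) (h :: 'm \<Rightarrow> complex). smooth_fun A f \<and> smooth_fun A h \<and>
        (\<forall>x\<in>carrier A. f x \<noteq> 0 \<and> h x \<noteq> 0 \<and>
           (\<forall>v. l' x v = of_real (f x) * l x v \<and> m' x v = h x * m x v)))}"

definition oriented_congruence :: "'m atlas3 \<Rightarrow> ('m form3 \<times> 'm form3) set \<Rightarrow> bool" where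
  "oriented_congruence A S \<longleftrightarrow> S \<in> Collect (coframe A) // congruence_rel A"

(* A representative (lam, mu) = (lambda, mu) together with the coefficient functions of d lambda
   and d mu: tw, cb, cp, cq, sh are the functions a (twist), b, p, q, s (shear). *)
record 'm rep =
  lam :: "'m form3"
  mu :: "'m form3"
  tw :: "'m \<Rightarrow> real"
  cb :: "'m \<Rightarrow> complex"
  cp :: "'m \<Rightarrow> complex"
  cq :: "'m \<Rightarrow> complex"
  sh :: "'m \<Rightarrow> complex"

definition structure_functions :: "'m atlas3 \<Rightarrow> 'm rep \<Rightarrow> bool" where
  "structure_functions A R \<longleftrightarrow>
     smooth_fun A (tw R) \<and> smooth_fun A (cb R) \<and> smooth_fun A (cp R) \<and> smooth_fun A (cq R) \<and>
     smooth_fun A (sh R) \<and>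
     (\<forall>x\<in>carrier A. \<forall>u v. let l = lam R x; m = mu R x; mb = cnj_form (mu R) x in
        ext_d A (lam R) x u v =
          \<i> * of_real (tw R x) * (m \<and>\<^sub>1 mb) u v + cb R x * (m \<and>\<^sub>1 l) u v
          + cnj (cb R x) * (mb \<and>\<^sub>1 l) u v \<and>
        ext_d A (mu R) x u v =
          cp R x * (m \<and>\<^sub>1 mb) u v + cq R x * (m \<and>\<^sub>1 l) u v + sh R x * (mb \<and>\<^sub>1 l) u v)"

(* The components (u_lambda, u_mu, u_mubar) of du = u_lambda lambda + u_mu mu + u_mubar mubar. *)
definition frame_coeffs :: "'m atlas3 \<Rightarrow> 'm rep \<Rightarrow> ('m \<Rightarrow> complex) \<Rightarrow> 'm \<Rightarrow> complex \<times> complex \<times> complex" where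
  "frame_coeffs A R u x =
     (THE (k1, k2, k3). \<forall>v. d_fun A u x v = k1 * lam R x v + k2 * mu R x v + k3 * cnj (mu R x v))"

definition D_lam :: "'m atlas3 \<Rightarrow> 'm rep \<Rightarrow> ('m \<Rightarrow> complex) \<Rightarrow> 'm \<Rightarrow> complex" where
  "D_lam A R u x = fst (frame_coeffs A R u x)"
definition D_mu :: "'m atlas3 \<Rightarrow> 'm rep \<Rightarrow> ('m \<Rightarrow> complex) \<Rightarrow> 'm \<Rightarrow> complex" where
  "D_mu A R u x = fst (snd (frame_coeffs A R u x))"
definition D_mub :: "'m atlas3 \<Rightarrow> 'm rep \<Rightarrow> ('m \<Rightarrow> complex) \<Rightarrow> 'm \<Rightarrow> complex" where
  "D_mub A R u x = snd (snd (frame_coeffs A R u x))"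

definition restrict_atlas :: "'m set \<Rightarrow> ('m, 'e) chart set \<Rightarrow> ('m, 'e) chart set" where
  "restrict_atlas U A = (\<lambda>c. (fst c \<inter> U, snd c)) ` A"

(* psi is a smooth branch over U of the argument of s. *)
definition arg_branch :: "'m atlas3 \<Rightarrow> 'm set \<Rightarrow> ('m \<Rightarrow> complex) \<Rightarrow> ('m \<Rightarrow> real) \<Rightarrow> bool" where
  "arg_branch A U s \<psi> \<longleftrightarrow> smooth_fun (restrict_atlas U A) \<psi> \<and>
     (\<forall>x\<in>U. s x = of_real (cmod (s x)) * cis (\<psi> x))"

abbreviation sh_abs :: "'m rep \<Rightarrow> 'm \<Rightarrow> complex" where
  "sh_abs R \<equiv> (\<lambda>x. complex_of_real (cmod (sh R x)))"
abbreviation cpx :: "('m \<Rightarrow> real) \<Rightarrow> 'm \<Rightarrow> complex" where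
  "cpx \<psi> \<equiv> (\<lambda>x. complex_of_real (\<psi> x))"

definition T0 :: "'m atlas3 \<Rightarrow> 'm rep \<Rightarrow> ('m \<Rightarrow> real) \<Rightarrow> nat \<Rightarrow> 'm \<Rightarrow> complex" where
  "T0 A R \<psi> \<epsilon> x =
     (D_lam A R (cpx \<psi>) x + \<i> * (cnj (cq R x) - cq R x)) / (2 * sh_abs R x) * cis (real \<epsilon> * pi)"

definition t1 :: "'m atlas3 \<Rightarrow> 'm rep \<Rightarrow> ('m \<Rightarrow> real) \<Rightarrow> nat \<Rightarrow> 'm \<Rightarrow> complex" where
  "t1 A R \<psi> \<epsilon> x =
     (cb R x * sh_abs R x + D_mu A R (sh_abs R) x) * cis ((\<psi> x - real \<epsilon> * pi) / 2) / sh_abs R x"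

definition k0 :: "'m atlas3 \<Rightarrow> 'm rep \<Rightarrow> ('m \<Rightarrow> real) \<Rightarrow> 'm \<Rightarrow> complex" where
  "k0 A R \<psi> x =
     - D_mub A R (D_mu A R (cpx \<psi>)) x - D_mu A R (D_mub A R (cpx \<psi>)) x
     + cp R x * D_mu A R (cpx \<psi>) x + cnj (cp R x) * D_mub A R (cpx \<psi>) x
     + 2 * \<i> * (D_mu A R (cp R) x - D_mub A R (\<lambda>y. cnj (cp R y)) x)"

definition k1 :: "'m atlas3 \<Rightarrow> 'm rep \<Rightarrow> ('m \<Rightarrow> real) \<Rightarrow> nat \<Rightarrow> 'm \<Rightarrow> complex" where
  "k1 A R \<psi> \<epsilon> x =
     2 * (t1 A R \<psi> \<epsilon> x - cnj (t1 A R \<psi> \<epsilon> x))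
     + cis (real \<epsilon> * pi / 2) *
       ((cb R x * cnj (cq R x) - cb R x * cq R x - D_mu A R (cq R) x
         + D_mu A R (\<lambda>y. cnj (cq R y)) x
         + \<i> * cq R x * D_mu A R (cpx \<psi>) x - \<i> * D_lam A R (D_mu A R (cpx \<psi>)) x) * cis (\<psi> x / 2)
        + \<i> * D_mub A R (cpx \<psi>) x * sh_abs R x * cis (- \<psi> x / 2)) / sh_abs R x"

section \<open>The four-dimensional manifold\<close>

type_synonym 'm atlas4 = "('m \<times> real, (real^3) \<times> real) chart set"
type_synonym 'm form4 = "('m \<times> real, (real^3) \<times> real) form1"

(* The product manifold P = U x R_+, modelled on the 4-dimensional space R^3 x R; the projection to
   U is fst and the fibre coordinate rho is snd. *)
definition P_atlas :: "'m atlas3 \<Rightarrow> 'm set \<Rightarrow> 'm atlas4" where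
  "P_atlas A U = (\<lambda>c. (fst c \<times> {0<..}, \<lambda>(x, r). (snd c x, r))) ` restrict_atlas U A"

definition form_omega :: "'m atlas3 \<Rightarrow> 'm set \<Rightarrow> 'm rep \<Rightarrow> nat \<Rightarrow> 'm form4" where
  "form_omega A U R \<epsilon> = (\<lambda>z v.
     cis (real \<epsilon> * pi) * sh_abs R (fst z) * pullback (P_atlas A U) A fst (lam R) z v)"

definition form_omega1 :: "'m atlas3 \<Rightarrow> 'm set \<Rightarrow> 'm rep \<Rightarrow> ('m \<Rightarrow> real) \<Rightarrow> nat \<Rightarrow> 'm form4" where
  "form_omega1 A U R \<psi> \<epsilon> = (\<lambda>z v.
     of_real (snd z) * cis (- (\<psi> (fst z) - real \<epsilon> * pi) / 2) * pullback (P_atlas A U) A fst (mu R) z v)"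

definition form_Omega :: "'m atlas3 \<Rightarrow> 'm set \<Rightarrow> 'm rep \<Rightarrow> ('m \<Rightarrow> real) \<Rightarrow> nat \<Rightarrow> 'm form4" where
  "form_Omega A U R \<psi> \<epsilon> = (\<lambda>z v. let x = fst z; \<rho> = complex_of_real (snd z) in
     d_fun (P_atlas A U) (\<lambda>z. of_real (ln (snd z))) z v
     + (\<i> * D_mu A R (cpx \<psi>) x - 2 * cnj (cp R x)) / (2 * \<rho>)
         * cis ((\<psi> x - real \<epsilon> * pi) / 2) * form_omega1 A U R \<psi> \<epsilon> z v
     + (- \<i> * D_mub A R (cpx \<psi>) x - 2 * cp R x) / (2 * \<rho>)
         * cis (- (\<psi> x - real \<epsilon> * pi) / 2) * cnj_form (form_omega1 A U R \<psi> \<epsilon>) z v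
     + (1 - cis (real \<epsilon> * pi) * (cq R x + cnj (cq R x)) / (2 * sh_abs R x)) * form_omega A U R \<epsilon> z v)"

definition P_T0 :: "'m atlas3 \<Rightarrow> 'm rep \<Rightarrow> ('m \<Rightarrow> real) \<Rightarrow> nat \<Rightarrow> 'm \<times> real \<Rightarrow> complex" where
  "P_T0 A R \<psi> \<epsilon> z = T0 A R \<psi> \<epsilon> (fst z)"
definition P_T1 :: "'m atlas3 \<Rightarrow> 'm rep \<Rightarrow> ('m \<Rightarrow> real) \<Rightarrow> nat \<Rightarrow> 'm \<times> real \<Rightarrow> complex" where
  "P_T1 A R \<psi> \<epsilon> z = t1 A R \<psi> \<epsilon> (fst z) / of_real (snd z)"
definition P_K0 :: "'m atlas3 \<Rightarrow> 'm rep \<Rightarrow> ('m \<Rightarrow> real) \<Rightarrow> 'm \<times> real \<Rightarrow> complex" where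
  "P_K0 A R \<psi> z = k0 A R \<psi> (fst z) / (2 * of_real (snd z) ^ 2)"
definition P_K1 :: "'m atlas3 \<Rightarrow> 'm rep \<Rightarrow> ('m \<Rightarrow> real) \<Rightarrow> nat \<Rightarrow> 'm \<times> real \<Rightarrow> complex" where
  "P_K1 A R \<psi> \<epsilon> z = k1 A R \<psi> \<epsilon> (fst z) / (2 * of_real (snd z))"

definition structure_equations ::
  "('p, 'e::euclidean_space) chart set \<Rightarrow> ('p, 'e) form1 \<Rightarrow> ('p, 'e) form1 \<Rightarrow> ('p, 'e) form1 \<Rightarrow>
   ('p \<Rightarrow> complex) \<Rightarrow> ('p \<Rightarrow> complex) \<Rightarrow> ('p \<Rightarrow> complex) \<Rightarrow> ('p \<Rightarrow> complex) \<Rightarrow> bool" where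
  "structure_equations P \<omega> \<omega>1 \<Omega> F0 F1 G0 G1 \<longleftrightarrow>
     (\<forall>z\<in>carrier P. F0 z \<in> \<real> \<and> G0 z \<in> \<real>) \<and>
     (\<forall>z\<in>carrier P. \<forall>u v. let w = \<omega> z; w1 = \<omega>1 z; w1b = cnj_form \<omega>1 z; W = \<Omega> z in
        ext_d P \<omega> z u v = F1 z * (w1 \<and>\<^sub>1 w) u v + cnj (F1 z) * (w1b \<and>\<^sub>1 w) u v \<and>
        ext_d P \<omega>1 z u v =
          (W \<and>\<^sub>1 w1) u v + ((\<lambda>v. w1 v + w1b v) \<and>\<^sub>1 w) u v + \<i> * F0 z * (w1 \<and>\<^sub>1 w) u v \<and>
        ext_d P (cnj_form \<omega>1) z u v =
          (W \<and>\<^sub>1 w1b) u v + ((\<lambda>v. w1 v + w1b v) \<and>\<^sub>1 w) u v - \<i> * F0 z * (w1b \<and>\<^sub>1 w) u v \<and>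
        ext_d P \<Omega> z u v =
          \<i> * G0 z * (w1 \<and>\<^sub>1 w1b) u v + G1 z * (w1 \<and>\<^sub>1 w) u v + cnj (G1 z) * (w1b \<and>\<^sub>1 w) u v)"

end

theory Submission
  imports Defs
begin

text \<open>Everything happens on \<open>M\<close>. Rescaling \<open>\<mu>\<close> by half the phase of the shear and \<open>\<lambda>\<close> by its
  modulus gives forms \<open>\<nu>\<close> and \<open>\<omega>\<close> on \<open>M\<close> with \<open>d \<nu> = \<theta> \<and> \<nu> + (\<nu> + \<nu>bar) \<and> \<omega> + i T0 \<nu> \<and> \<omega>\<close> for a
  real 1-form \<open>\<theta>\<close>, and the forms on \<open>P\<close> are \<open>\<omega>\<close>, \<open>\<rho> \<nu>\<close> and \<open>d log \<rho> + \<theta>\<close>; so the equations on \<open>P\<close>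
  are pulled back from \<open>M\<close>.

  Uniqueness: the \<open>\<mu>bar \<and> \<lambda>\<close> component of the second equation says that \<open>\<omega> = f \<lambda>\<close>, \<open>\<omega>\<^sub>1 = g \<mu>\<close>
  satisfy \<open>g s = cnj g f\<close>, which fixes \<open>f\<close> and \<open>g\<close> up to sign. Two solutions \<open>\<Omega>\<close> differ by an \<open>X\<close>
  with \<open>X \<and> \<omega>\<^sub>1 = i t \<omega> \<and> \<omega>\<^sub>1\<close> and \<open>X \<and> \<omega>\<^sub>1bar = - i t \<omega> \<and> \<omega>\<^sub>1bar\<close>, where \<open>t\<close> is the difference of
  the two functions \<open>T0\<close>, and this forces \<open>X = 0\<close> and \<open>t = 0\<close>.

  Invariance follows from uniqueness: if \<open>\<mu>' = h \<mu>\<close> and the forms \<open>\<omega>\<close> agree, the fibre scaling \<open>\<rho>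
  \<mapsto> \<rho> / |h|\<close> pulls the forms of the second representative back to those of the first, up to a
  locally constant sign of \<open>\<omega>\<^sub>1\<close>.\<close>

section \<open>Calculus of smooth maps between normed spaces\<close>

text \<open>Half the phase is needed because \<nu> = c \<mu> produces the term c s \<mu>bar \<and>
  \<lambda> in d\<nu>, which has to equal \<nu>bar \<and> \<omega>; with \<omega> = \<plusminus>|s|
  \<lambda> this says c^2 = \<plusminus>exp(-i \<psi>). Hence a branch \<psi> over an open U, and c
  is determined only up to a sign, which passes to \<open>omega1\<close>, \<open>T1\<close> and
  \<open>K1\<close> but not to \<Omega>, \<open>T0\<close> and \<open>K0\<close>. The sign of
  \<omega>, recorded by \<epsilon>, is a separate ambiguity. Since solutions are compared instead of
  formulas, only the twist and the shear have to be transformed under a change of representative;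
  transformation laws for b, p, q are never computed. The formal obstacle is that the tangent space
  at x is read in the chart \<open>chart_at A x\<close>, which varies arbitrarily with x. A form can
  therefore be differentiated only through its expression \<open>local_expr\<close> in one fixed
  chart, and the independence of \<open>ext_d\<close> from the chart, its naturality under maps and
  d d = 0 all rest on the symmetry of second derivatives.\<close>

lemma has_derivative_frechet:
  "f differentiable at x \<Longrightarrow> (f has_derivative frechet_derivative f (at x)) (at x)"
  by (simp add: frechet_derivative_works)

lemma frechet_derivativeI: "(f has_derivative D) (at x) \<Longrightarrow> frechet_derivative f (at x) = D"
  by (metis frechet_derivative_at)

lemma has_derivative_cong_open:
  assumes "open S" "x \<in> S" "\<And>y. y \<in> S \<Longrightarrow> f y = g y"
  shows "(f has_derivative D) (at x) \<longleftrightarrow> (g has_derivative D) (at x)"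
  using has_derivative_transform_within_open[of f D x UNIV S g]
    has_derivative_transform_within_open[of g D x UNIV S f] assms by auto

lemma frechet_derivative_cong_open:
  assumes "open S" "x \<in> S" "\<And>y. y \<in> S \<Longrightarrow> f y = g y"
  shows "frechet_derivative f (at x) = frechet_derivative g (at x)"
  using has_derivative_cong_open[OF assms] by (simp add: frechet_derivative_def)

lemma differentiable_cong_open:
  assumes "open S" "x \<in> S" "\<And>y. y \<in> S \<Longrightarrow> f y = g y"
  shows "f differentiable at x \<longleftrightarrow> g differentiable at x"
  using has_derivative_cong_open[OF assms] by (simp add: differentiable_def)

text \<open>Openness of S matters: the Frechet derivative at a point of S sees f on a full
  neighbourhood, which S must contain.\<close>

lemma Ck_on_cong:
  assumes "open S" "\<And>y. y \<in> S \<Longrightarrow> f y = g y"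
  shows "Ck_on k S f \<longleftrightarrow> Ck_on k S g"
  using assms(2)
proof (induction k arbitrary: f g)
  case 0
  then show ?case by (auto cong: continuous_on_cong)
next
  case (Suc k)
  have "f differentiable at x \<longleftrightarrow> g differentiable at x" if "x \<in> S" for x
    using differentiable_cong_open[OF assms(1) that] Suc.prems by blast
  moreover have "Ck_on k S (\<lambda>x. frechet_derivative f (at x) v)
      \<longleftrightarrow> Ck_on k S (\<lambda>x. frechet_derivative g (at x) v)" for v
    by (rule Suc.IH) (metis frechet_derivative_cong_open[OF assms(1)] Suc.prems)
  ultimately show ?case by auto
qed

lemma Ck_on_subset: "Ck_on k S f \<Longrightarrow> T \<subseteq> S \<Longrightarrow> Ck_on k T f"
  by (induction k arbitrary: f) (auto intro: continuous_on_subset)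

lemma Ck_on_SucD: "Ck_on (Suc k) S f \<Longrightarrow> Ck_on k S f"
proof (induction k arbitrary: f)
  case 0
  then show ?case
    by (auto intro!: continuous_at_imp_continuous_on differentiable_imp_continuous_within)
next
  case (Suc k)
  then have "Ck_on k S (\<lambda>x. frechet_derivative f (at x) v)" for v
    by (metis Ck_on.simps(2))
  with Suc.prems show ?case by simp
qed

lemma Ck_on_Suc_frechet: "Ck_on (Suc k) S f \<Longrightarrow> Ck_on k S (\<lambda>x. frechet_derivative f (at x) v)"
  by simp

lemma Ck_on_const: "Ck_on k S (\<lambda>x. c)"
  by (induction k arbitrary: c) auto

text \<open>The closure properties that follow are inductions through this rule: exhibit the
  derivative, then prove that each of its directional values is C^k.\<close>

lemma Ck_on_SucI:
  assumes "open S" "\<And>x. x \<in> S \<Longrightarrow> (f has_derivative D x) (at x)"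
    and "\<And>v. Ck_on k S (\<lambda>x. D x v)"
  shows "Ck_on (Suc k) S f"
proof -
  have "Ck_on k S (\<lambda>x. frechet_derivative f (at x) v)" for v
    by (subst Ck_on_cong[OF assms(1), of _ "\<lambda>x. D x v"])
      (use assms(2,3) frechet_derivativeI in \<open>metis+\<close>)
  with assms(2) show ?thesis by (auto simp: differentiable_def)
qed

lemma Ck_on_add:
  assumes "open S" "Ck_on k S f" "Ck_on k S g"
  shows "Ck_on k S (\<lambda>x. f x + g x)"
  using assms(2,3)
proof (induction k arbitrary: f g)
  case 0
  then show ?case by (auto intro: continuous_intros)
next
  case (Suc k)
  show ?case
  proof (rule Ck_on_SucI[OF assms(1)])
    fix x assume "x \<in> S"
    then show "((\<lambda>x. f x + g x) has_derivative
        (\<lambda>v. frechet_derivative f (at x) v + frechet_derivative g (at x) v)) (at x)"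
      using Suc.prems by (auto intro!: has_derivative_add has_derivative_frechet)
  qed (use Suc in auto)
qed

lemma Ck_on_linear:
  assumes "bounded_linear L" "open S" "Ck_on k S f"
  shows "Ck_on k S (\<lambda>x. L (f x))"
  using assms(3)
proof (induction k arbitrary: f)
  case 0
  then show ?case
    by (auto intro: linear_continuous_on[OF assms(1)] continuous_on_compose2)
next
  case (Suc k)
  show ?case
    by (rule Ck_on_SucI[OF assms(2), where D = "\<lambda>x v. L (frechet_derivative f (at x) v)"])
      (use Suc in \<open>auto intro!: bounded_linear.has_derivative[OF assms(1)] has_derivative_frechet\<close>)
qed

text \<open>The product rule leaves one factor undifferentiated, so the induction hypothesis applies
  to it only after its order has been lowered by \<open>Ck_on_SucD\<close>.\<close>

lemma Ck_on_bilinear: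
  assumes "bounded_bilinear B" "open S" "Ck_on k S f" "Ck_on k S g"
  shows "Ck_on k S (\<lambda>x. B (f x) (g x))"
  using assms(3,4)
proof (induction k arbitrary: f g)
  case 0
  then show ?case by (auto intro: bounded_bilinear.continuous_on[OF assms(1)])
next
  case (Suc k)
  show ?case
  proof (rule Ck_on_SucI[OF assms(2)])
    fix x assume "x \<in> S"
    then show "((\<lambda>x. B (f x) (g x)) has_derivative
        (\<lambda>v. B (f x) (frechet_derivative g (at x) v) + B (frechet_derivative f (at x) v) (g x)))
        (at x)"
      using Suc.prems by (auto intro!: bounded_bilinear.FDERIV[OF assms(1)] has_derivative_frechet)
  next
    fix v
    show "Ck_on k S (\<lambda>x. B (f x) (frechet_derivative g (at x) v)
        + B (frechet_derivative f (at x) v) (g x))"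
      by (intro Ck_on_add[OF assms(2)] Suc.IH Suc.prems Ck_on_Suc_frechet Ck_on_SucD)
  qed
qed

lemma Ck_on_sum:
  assumes "open S" "\<And>i. i \<in> I \<Longrightarrow> Ck_on k S (f i)"
  shows "Ck_on k S (\<lambda>x. \<Sum>i\<in>I. f i x)"
  using assms(2)
  by (induction I rule: infinite_finite_induct) (auto intro!: Ck_on_const Ck_on_add[OF assms(1)])

lemma linear_euclidean_sum:
  fixes L :: "'a::euclidean_space \<Rightarrow> 'b::real_vector"
  assumes "linear L"
  shows "L v = (\<Sum>i\<in>Basis. (v \<bullet> i) *\<^sub>R L i)"
proof -
  have "L v = L (\<Sum>i\<in>Basis. (v \<bullet> i) *\<^sub>R i)" by (simp add: euclidean_representation)
  also have "\<dots> = (\<Sum>i\<in>Basis. (v \<bullet> i) *\<^sub>R L i)"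
    using assms by (simp add: linear_sum linear_cmul)
  finally show ?thesis .
qed

text \<open>\<open>Ck_on\<close> differentiates in fixed directions, whereas the chain rule
  evaluates the derivative of f in the moving direction g' v. Expanding that direction in
  \<open>Basis\<close> leaves finitely many fixed directions, which is why the middle space is
  Euclidean.\<close>

lemma Ck_on_compose:
  fixes g :: "'a::real_normed_vector \<Rightarrow> 'b::euclidean_space"
  assumes "open S" "open T" "g ` S \<subseteq> T" "Ck_on k T f" "Ck_on k S g"
  shows "Ck_on k S (\<lambda>x. f (g x))"
  using assms(4,5)
proof (induction k arbitrary: f)
  case 0
  then show ?case using assms(3) by (auto intro: continuous_on_compose2)
next
  case (Suc k)
  define D where "D x v = (\<Sum>i\<in>Basis. (frechet_derivative g (at x) v \<bullet> i) *\<^sub>R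
    frechet_derivative f (at (g x)) i)" for x v
  show ?case
  proof (rule Ck_on_SucI[OF assms(1)])
    fix x assume "x \<in> S"
    then have "g x \<in> T" using assms(3) by auto
    then have f: "f differentiable at (g x)" and g: "g differentiable at x"
      using Suc.prems \<open>x \<in> S\<close> by auto
    have "((\<lambda>x. f (g x)) has_derivative
        (\<lambda>v. frechet_derivative f (at (g x)) (frechet_derivative g (at x) v))) (at x)"
      using has_derivative_compose[OF has_derivative_frechet[OF g] has_derivative_frechet[OF f]] .
    also have "(\<lambda>v. frechet_derivative f (at (g x)) (frechet_derivative g (at x) v)) = D x"
      unfolding D_def using linear_euclidean_sum[OF linear_frechet_derivative[OF f]] by blast
    finally show "((\<lambda>x. f (g x)) has_derivative D x) (at x)" .
  next
    fix v
    show "Ck_on k S (\<lambda>x. D x v)"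
      unfolding D_def
    proof (intro Ck_on_sum Ck_on_bilinear[OF bounded_bilinear_scaleR] assms(1))
      fix i :: 'b
      show "Ck_on k S (\<lambda>x. frechet_derivative g (at x) v \<bullet> i)"
        using Suc.prems(2) by (auto intro: Ck_on_linear[OF bounded_linear_inner_left assms(1)])
      show "Ck_on k S (\<lambda>x. frechet_derivative f (at (g x)) i)"
        by (intro Suc.IH Suc.prems Ck_on_Suc_frechet Ck_on_SucD)
    qed
  qed
qed

lemma smooth_on_cong:
  "open S \<Longrightarrow> (\<And>y. y \<in> S \<Longrightarrow> f y = g y) \<Longrightarrow> smooth_on S f \<longleftrightarrow> smooth_on S g"
  unfolding smooth_on_def using Ck_on_cong by blast

lemma smooth_on_subset: "smooth_on S f \<Longrightarrow> T \<subseteq> S \<Longrightarrow> smooth_on T f"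
  unfolding smooth_on_def using Ck_on_subset by blast

lemma smooth_on_differentiable: "smooth_on S f \<Longrightarrow> x \<in> S \<Longrightarrow> f differentiable at x"
  unfolding smooth_on_def by (metis Ck_on.simps(2))

lemma smooth_on_continuous: "smooth_on S f \<Longrightarrow> continuous_on S f"
  unfolding smooth_on_def by (metis Ck_on.simps(1))

lemma smooth_on_has_derivative:
  "smooth_on S f \<Longrightarrow> x \<in> S \<Longrightarrow> (f has_derivative frechet_derivative f (at x)) (at x)"
  using smooth_on_differentiable has_derivative_frechet by blast

lemma smooth_on_frechet: "smooth_on S f \<Longrightarrow> smooth_on S (\<lambda>x. frechet_derivative f (at x) v)"
  unfolding smooth_on_def by (metis Ck_on.simps(2))

lemma smooth_on_const: "smooth_on S (\<lambda>x. c)"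
  unfolding smooth_on_def using Ck_on_const by blast

lemma smooth_on_add:
  "open S \<Longrightarrow> smooth_on S f \<Longrightarrow> smooth_on S g \<Longrightarrow> smooth_on S (\<lambda>x. f x + g x)"
  unfolding smooth_on_def using Ck_on_add by blast

lemma smooth_on_linear:
  "bounded_linear L \<Longrightarrow> open S \<Longrightarrow> smooth_on S f \<Longrightarrow> smooth_on S (\<lambda>x. L (f x))"
  unfolding smooth_on_def using Ck_on_linear by blast

lemma smooth_on_bilinear:
  "bounded_bilinear B \<Longrightarrow> open S \<Longrightarrow> smooth_on S f \<Longrightarrow> smooth_on S g
    \<Longrightarrow> smooth_on S (\<lambda>x. B (f x) (g x))"
  unfolding smooth_on_def using Ck_on_bilinear by blast

lemma smooth_on_sum:
  "open S \<Longrightarrow> (\<And>i. i \<in> I \<Longrightarrow> smooth_on S (f i)) \<Longrightarrow> smooth_on S (\<lambda>x. \<Sum>i\<in>I. f i x)"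
  by (simp add: smooth_on_def Ck_on_sum)

lemma smooth_on_compose:
  fixes g :: "'a::real_normed_vector \<Rightarrow> 'b::euclidean_space"
  assumes "open S" "open T" "g ` S \<subseteq> T" "smooth_on T f" "smooth_on S g"
  shows "smooth_on S (\<lambda>x. f (g x))"
  using Ck_on_compose[OF assms(1-3)] assms(4,5) unfolding smooth_on_def by blast

lemma smooth_on_id: "open S \<Longrightarrow> smooth_on S (\<lambda>x. x)"
  unfolding smooth_on_def
proof
  fix k assume "open S"
  then show "Ck_on k S (\<lambda>x. x)"
    by (cases k) (auto intro!: Ck_on_const)
qed

lemma smooth_on_bounded_linear: "bounded_linear L \<Longrightarrow> open S \<Longrightarrow> smooth_on S L"
  using smooth_on_linear[OF _ _ smooth_on_id] .

lemma smooth_on_mult: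
  fixes f g :: "'a::real_normed_vector \<Rightarrow> 'b::real_normed_algebra"
  shows "open S \<Longrightarrow> smooth_on S f \<Longrightarrow> smooth_on S g \<Longrightarrow> smooth_on S (\<lambda>x. f x * g x)"
  by (rule smooth_on_bilinear[OF bounded_bilinear_mult])

lemma smooth_on_scaleR:
  "open S \<Longrightarrow> smooth_on S f \<Longrightarrow> smooth_on S g \<Longrightarrow> smooth_on S (\<lambda>x. f x *\<^sub>R g x)"
  by (rule smooth_on_bilinear[OF bounded_bilinear_scaleR])

lemma smooth_on_minus: "open S \<Longrightarrow> smooth_on S f \<Longrightarrow> smooth_on S (\<lambda>x. - f x)"
  by (rule smooth_on_linear[OF bounded_linear_minus[OF bounded_linear_ident]])

lemma smooth_on_diff:
  "open S \<Longrightarrow> smooth_on S f \<Longrightarrow> smooth_on S g \<Longrightarrow> smooth_on S (\<lambda>x. f x - g x)"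
  using smooth_on_add[OF _ _ smooth_on_minus, of S f g] by simp

lemma smooth_on_Pair:
  fixes f :: "'a::real_normed_vector \<Rightarrow> 'b::euclidean_space" and g :: "'a \<Rightarrow> 'c::euclidean_space"
  assumes "open S" "smooth_on S f" "smooth_on S g"
  shows "smooth_on S (\<lambda>x. (f x, g x))"
proof -
  have "bounded_linear (\<lambda>y::'b. (y, 0::'c))" "bounded_linear (\<lambda>y::'c. (0::'b, y))"
    by (auto intro: bounded_linear_Pair bounded_linear_ident bounded_linear_zero)
  from this[THEN smooth_on_linear] assms
  have "smooth_on S (\<lambda>x. (f x, 0::'c))" "smooth_on S (\<lambda>x. (0::'b, g x))" by blast+
  from smooth_on_add[OF assms(1) this] show ?thesis by simp
qed

text \<open>The derivative is again built from \<open>inverse\<close> and constants, so the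
  induction on the order closes on itself.\<close>

lemma smooth_on_inverse_id:
  "smooth_on (- {0}) (inverse :: 'a::{real_normed_field} \<Rightarrow> 'a)"
  unfolding smooth_on_def
proof
  fix k show "Ck_on k (- {0}) (inverse :: 'a \<Rightarrow> 'a)"
  proof (induction k)
    case 0
    then show ?case by (auto intro: continuous_intros)
  next
    case (Suc k)
    show ?case
    proof (rule Ck_on_SucI)
      fix x :: 'a assume "x \<in> - {0}"
      then show "(inverse has_derivative (\<lambda>v. - (inverse x * v * inverse x))) (at x)"
        by (auto intro: has_derivative_inverse')
    next
      fix v :: 'a
      have "Ck_on k (- {0::'a}) (\<lambda>x. - (inverse x * v * inverse x))"
        by (intro Ck_on_linear[OF bounded_linear_minus[OF bounded_linear_ident]]
            Ck_on_bilinear[OF bounded_bilinear_mult] Suc Ck_on_const) auto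
      then show "Ck_on k (- {0}) (\<lambda>x. - (inverse x * v * inverse x))" .
    qed auto
  qed
qed

lemma smooth_on_inverse:
  fixes f :: "'a::real_normed_vector \<Rightarrow> 'b::{euclidean_space, real_normed_field}"
  assumes "open S" "smooth_on S f" "\<And>x. x \<in> S \<Longrightarrow> f x \<noteq> 0"
  shows "smooth_on S (\<lambda>x. inverse (f x))"
  by (rule smooth_on_compose[OF assms(1) _ _ smooth_on_inverse_id assms(2)]) (use assms in auto)

lemma smooth_on_divide:
  fixes f :: "'a::real_normed_vector \<Rightarrow> 'b::{euclidean_space, real_normed_field}"
  assumes "open S" "smooth_on S f" "smooth_on S g" "\<And>x. x \<in> S \<Longrightarrow> g x \<noteq> 0"
  shows "smooth_on S (\<lambda>x. f x / g x)"
  using smooth_on_mult[OF assms(1,2) smooth_on_inverse[OF assms(1,3)]] assms(4)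
  by (auto simp: divide_inverse)

lemma smooth_on_exp:
  fixes f :: "'a::real_normed_vector \<Rightarrow> 'b::{euclidean_space, real_normed_field, banach}"
  assumes "open S" "smooth_on S f"
  shows "smooth_on S (\<lambda>x. exp (f x))"
proof (rule smooth_on_compose[OF assms(1) open_UNIV _ _ assms(2)])
  show "smooth_on UNIV (exp :: 'b \<Rightarrow> 'b)"
    unfolding smooth_on_def
  proof
    fix k show "Ck_on k UNIV (exp :: 'b \<Rightarrow> 'b)"
    proof (induction k)
      case 0
      then show ?case by (auto intro: continuous_intros)
    next
      case (Suc k)
      show ?case
        by (rule Ck_on_SucI[where D = "\<lambda>x v. exp x * v"])
          (auto intro!: Ck_on_bilinear[OF bounded_bilinear_mult] Suc Ck_on_const
            DERIV_exp[THEN has_field_derivative_imp_has_derivative])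
    qed
  qed
qed auto

lemma smooth_on_ln:
  fixes f :: "'a::real_normed_vector \<Rightarrow> real"
  assumes "open S" "smooth_on S f" "\<And>x. x \<in> S \<Longrightarrow> f x > 0"
  shows "smooth_on S (\<lambda>x. ln (f x))"
proof (rule smooth_on_compose[OF assms(1) _ _ _ assms(2)])
  show "smooth_on {0<..} (ln :: real \<Rightarrow> real)"
    unfolding smooth_on_def
  proof
    fix k show "Ck_on k {0<..} (ln :: real \<Rightarrow> real)"
    proof (cases k)
      case 0
      then show ?thesis by (auto intro!: continuous_intros)
    next
      case (Suc m)
      have "Ck_on (Suc m) {0<..} (ln :: real \<Rightarrow> real)"
      proof (rule Ck_on_SucI[where D = "\<lambda>x v. inverse x * v"])
        fix v :: real
        have "Ck_on m {0<..} (inverse :: real \<Rightarrow> real)"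
          using smooth_on_inverse_id[where 'a = real] unfolding smooth_on_def
          by (auto intro: Ck_on_subset)
        then show "Ck_on m {0<..} (\<lambda>x. inverse x * v)"
          by (intro Ck_on_bilinear[OF bounded_bilinear_mult] Ck_on_const) auto
      qed (auto intro: DERIV_ln[THEN has_field_derivative_imp_has_derivative])
      with Suc show ?thesis by simp
    qed
  qed
qed (use assms(3) in auto)

text \<open>Stated on the right half plane because \<open>branch_exists\<close> divides a function
  by its nonzero value at a point, which brings the values near that point into it.\<close>

lemma smooth_on_Ln:
  fixes f :: "'a::real_normed_vector \<Rightarrow> complex"
  assumes "open S" "smooth_on S f" "\<And>x. x \<in> S \<Longrightarrow> 0 < Re (f x)"
  shows "smooth_on S (\<lambda>x. Ln (f x))"
proof (rule smooth_on_compose[OF assms(1) _ _ _ assms(2)])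
  let ?T = "{z. 0 < Re z}"
  show "open ?T" by (simp add: open_halfspace_Re_gt)
  then show "smooth_on ?T Ln"
    unfolding smooth_on_def
  proof (intro allI)
    fix k assume o: "open ?T"
    have n: "z \<notin> \<real>\<^sub>\<le>\<^sub>0" if "0 < Re z" for z using that by (auto simp: complex_nonpos_Reals_iff)
    show "Ck_on k ?T Ln"
    proof (cases k)
      case 0
      then show ?thesis using n by (auto intro!: continuous_on_Ln)
    next
      case (Suc m)
      have "Ck_on (Suc m) ?T Ln"
      proof (rule Ck_on_SucI[OF o, where D = "\<lambda>x v. inverse x * v"])
        fix v :: complex
        have "Ck_on m ?T (inverse :: complex \<Rightarrow> complex)"
          using smooth_on_inverse_id[where 'a = complex] unfolding smooth_on_def
          by (auto intro: Ck_on_subset)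
        then show "Ck_on m ?T (\<lambda>x. inverse x * v)"
          by (intro Ck_on_bilinear[OF bounded_bilinear_mult] Ck_on_const o)
      qed (use n in \<open>auto intro: has_field_derivative_Ln[THEN has_field_derivative_imp_has_derivative]\<close>)
      with Suc show ?thesis by simp
    qed
  qed
qed (use assms(3) in auto)

lemma smooth_on_of_real:
  "open S \<Longrightarrow> smooth_on S f \<Longrightarrow> smooth_on S (\<lambda>x. complex_of_real (f x))"
  by (rule smooth_on_linear[OF bounded_linear_of_real])

lemma smooth_on_cnj: "open S \<Longrightarrow> smooth_on S f \<Longrightarrow> smooth_on S (\<lambda>x. cnj (f x))"
  by (rule smooth_on_linear[OF bounded_linear_cnj])

lemma smooth_on_Re: "open S \<Longrightarrow> smooth_on S f \<Longrightarrow> smooth_on S (\<lambda>x. Re (f x))"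
  by (rule smooth_on_linear[OF bounded_linear_Re])

lemma smooth_on_Im: "open S \<Longrightarrow> smooth_on S f \<Longrightarrow> smooth_on S (\<lambda>x. Im (f x))"
  by (rule smooth_on_linear[OF bounded_linear_Im])

lemma smooth_on_cis: "open S \<Longrightarrow> smooth_on S f \<Longrightarrow> smooth_on S (\<lambda>x. cis (f x))"
  using smooth_on_exp[OF _ smooth_on_mult[OF _ smooth_on_const smooth_on_of_real], of S f \<i>]
  by (simp add: cis_conv_exp)

text \<open>Away from 0 this exhibits the modulus as a composite of smooth maps, avoiding the square
  root.\<close>

lemma cmod_eq_exp_ln: "z \<noteq> 0 \<Longrightarrow> cmod z = exp (ln (Re (z * cnj z)) / 2)"
  by (simp add: complex_mult_cnj flip: cmod_power2 del: times_complex.simps)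
    (simp add: ln_realpow)

lemma smooth_on_cmod:
  assumes "open S" "smooth_on S f" "\<And>x. x \<in> S \<Longrightarrow> f x \<noteq> 0"
  shows "smooth_on S (\<lambda>x. cmod (f x))"
proof -
  have "0 < Re (f x * cnj (f x))" if "x \<in> S" for x
    using assms(3)[OF that] by (simp add: complex_mult_cnj flip: cmod_power2 del: times_complex.simps)
  then have "smooth_on S (\<lambda>x. exp (ln (Re (f x * cnj (f x))) * (1/2)))"
    using assms by (intro smooth_on_exp smooth_on_mult smooth_on_ln smooth_on_Re smooth_on_cnj
        smooth_on_const)
  then show ?thesis
    by (rule iffD1[OF smooth_on_cong[OF assms(1)], rotated]) (use assms(3) cmod_eq_exp_ln in auto)
qed

section \<open>Symmetry of second derivatives\<close>

lemma mixed_difference: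
  fixes f :: "'a::real_normed_vector \<Rightarrow> real"
  assumes f: "smooth_on (ball x r) f" and h: "0 < h" "h * (norm u + norm v) < r"
  obtains a b where "0 < a" "a < h" "0 < b" "b < h"
    "f (x + h *\<^sub>R u + h *\<^sub>R v) - f (x + h *\<^sub>R u) - f (x + h *\<^sub>R v) + f x
     = h * h * frechet_derivative (\<lambda>y. frechet_derivative f (at y) u) (at (x + a *\<^sub>R u + b *\<^sub>R v)) v"
proof -
  have mem: "x + a *\<^sub>R u + b *\<^sub>R v \<in> ball x r" if "0 \<le> a" "a \<le> h" "0 \<le> b" "b \<le> h" for a b
  proof -
    have "norm (a *\<^sub>R u + b *\<^sub>R v) \<le> a * norm u + b * norm v"
      using norm_triangle_ineq[of "a *\<^sub>R u" "b *\<^sub>R v"] that by simp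
    also have "\<dots> \<le> h * (norm u + norm v)"
      using that by (simp add: distrib_left add_mono mult_right_mono)
    also have "\<dots> < r" by fact
    finally show ?thesis
      using norm_minus_cancel[of "a *\<^sub>R u + b *\<^sub>R v"] by (simp add: dist_norm)
  qed
  let ?Du = "\<lambda>y. frechet_derivative f (at y) u"
  have line: "((\<lambda>t. g (p + t *\<^sub>R w)) has_field_derivative frechet_derivative g (at (p
      + t *\<^sub>R w)) w) (at t)"
    if "smooth_on (ball x r) g" "p + t *\<^sub>R w \<in> ball x r" for g :: "'a \<Rightarrow> real" and p w t
  proof -
    have D: "(g has_derivative frechet_derivative g (at (p + t *\<^sub>R w))) (at (p + t *\<^sub>R w))"
      using smooth_on_has_derivative that by blast
    have "((\<lambda>t. p + t *\<^sub>R w) has_derivative (\<lambda>s. s *\<^sub>R w)) (at t)"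
      by (auto intro!: derivative_eq_intros)
    from has_derivative_compose[OF this D]
    show ?thesis
      using linear_cmul[OF has_derivative_linear[OF D]]
      by (auto simp: has_field_derivative_def mult.commute elim!: has_derivative_eq_rhs)
  qed
  \<comment> \<open>Mean value theorem for t \<mapsto> f (x + h v + t u) - f (x + t u) on [0, h]:
    the difference in direction u becomes a derivative.\<close>
  have "\<exists>z>0. z < h \<and> (f (x + h *\<^sub>R v + h *\<^sub>R u) - f (x + h *\<^sub>R u)) - (f (x + h *\<^sub>R v + 0 *\<^sub>R u)
      - f (x + 0 *\<^sub>R u))
      = (h - 0) * (?Du (x + h *\<^sub>R v + z *\<^sub>R u) - ?Du (x + z *\<^sub>R u))"
  proof (rule MVT2[OF h(1)], rule DERIV_diff)
    fix t assume "0 \<le> t" "t \<le> h"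
    with mem[of t h] mem[of t 0] h
    have "x + h *\<^sub>R v + t *\<^sub>R u \<in> ball x r" "x + t *\<^sub>R u \<in> ball x r"
      by (simp_all add: add_ac)
    then show "((\<lambda>t. f (x + h *\<^sub>R v + t *\<^sub>R u)) has_real_derivative ?Du (x + h *\<^sub>R v + t *\<^sub>R u)) (at t)"
      "((\<lambda>t. f (x + t *\<^sub>R u)) has_real_derivative ?Du (x + t *\<^sub>R u)) (at t)"
      using line[OF f] by blast+
  qed
  then obtain a where a: "0 < a" "a < h"
    "f (x + h *\<^sub>R v + h *\<^sub>R u) - f (x + h *\<^sub>R u) - f (x + h *\<^sub>R v) + f x
      = h * (?Du (x + h *\<^sub>R v + a *\<^sub>R u) - ?Du (x + a *\<^sub>R u))" by auto
  \<comment> \<open>The remaining difference is in direction v and concerns the derivative already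
    taken, at the fixed offset a u.\<close>
  have "\<exists>z>0. z < h \<and> ?Du (x + a *\<^sub>R u + h *\<^sub>R v) - ?Du (x + a *\<^sub>R u + 0 *\<^sub>R v)
      = (h - 0) * frechet_derivative ?Du (at (x + a *\<^sub>R u + z *\<^sub>R v)) v"
    by (rule MVT2[OF h(1)]) (rule line[OF smooth_on_frechet[OF f]], use mem a in auto)
  then obtain b where b: "0 < b" "b < h" "?Du (x + a *\<^sub>R u + h *\<^sub>R v) - ?Du (x + a *\<^sub>R u)
      = h * frechet_derivative ?Du (at (x + a *\<^sub>R u + b *\<^sub>R v)) v" by auto
  have "x + h *\<^sub>R v + a *\<^sub>R u = x + a *\<^sub>R u + h *\<^sub>R v" "x + h *\<^sub>R v + h *\<^sub>R u = x + h *\<^sub>R u + h *\<^sub>R v"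
    by (simp_all add: algebra_simps)
  with a b show ?thesis by (intro that[OF a(1,2) b(1,2)]) simp
qed

text \<open>The mixed difference is symmetric in u and v, yet equals h^2 times either mixed
  derivative at some nearby point. For small h, continuity brings both within e of their values at
  x, where e is half of the supposed gap.\<close>

lemma second_derivative_symmetric_real:
  fixes f :: "'a::real_normed_vector \<Rightarrow> real"
  assumes "open S" "x \<in> S" "smooth_on S f"
  shows "frechet_derivative (\<lambda>y. frechet_derivative f (at y) u) (at x) v
       = frechet_derivative (\<lambda>y. frechet_derivative f (at y) v) (at x) u"
proof (rule ccontr)
  define F where "F u v y = frechet_derivative (\<lambda>y. frechet_derivative f (at y) u) (at y) v" for u v y
  assume "\<not> ?thesis"
  then have ne: "F u v x \<noteq> F v u x" by (simp add: F_def)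
  define e where "e = \<bar>F u v x - F v u x\<bar> / 2"
  have e: "e > 0" using ne by (simp add: e_def)
  obtain r where r: "r > 0" "ball x r \<subseteq> S" using assms openE by blast
  have sm: "smooth_on (ball x r) f" using smooth_on_subset assms r by blast
  have c: "continuous_on (ball x r) (F u v)" for u v
    unfolding F_def by (intro smooth_on_continuous smooth_on_frechet sm)
  have cx: "isCont (F u v) x" for u v
    using c[of u v] r by (simp add: continuous_on_eq_continuous_at)
  obtain d1 where d1: "d1 > 0" "\<And>y. dist y x < d1 \<Longrightarrow> dist (F u v y) (F u v x) < e"
    using cx[of u v] e unfolding continuous_at_eps_delta by blast
  obtain d2 where d2: "d2 > 0" "\<And>y. dist y x < d2 \<Longrightarrow> dist (F v u y) (F v u x) < e"
    using cx[of v u] e unfolding continuous_at_eps_delta by blast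
  define d where "d = min r (min d1 d2)"
  \<comment> \<open>The summand 1 keeps the denominator positive when u = v = 0 and makes h (|u| +
    |v|) < d strict.\<close>
  define h where "h = d / (2 * (norm u + norm v + 1))"
  have d: "d > 0" using r d1 d2 by (simp add: d_def)
  have np: "norm u + norm v + 1 > 0" by (simp add: add_nonneg_pos)
  have h: "h > 0" using d np by (simp add: h_def)
  have "h * (norm u + norm v) < h * (2 * (norm u + norm v + 1))"
    using h np by (intro mult_strict_left_mono) auto
  also have "\<dots> = d" using np by (simp add: h_def)
  finally have hd: "h * (norm u + norm v) < d" .
  then have hr: "h * (norm u + norm v) < r" "h * (norm v + norm u) < r"
    by (simp_all add: d_def add.commute)
  have near: "dist (x + a *\<^sub>R p + b *\<^sub>R q) x < d"
    if "0 < a" "a < h" "0 < b" "b < h" "norm p + norm q = norm u + norm v" for a b p q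
  proof -
    have "dist (x + a *\<^sub>R p + b *\<^sub>R q) x = norm (a *\<^sub>R p + b *\<^sub>R q)"
      by (simp add: dist_norm algebra_simps)
    also have "\<dots> \<le> a * norm p + b * norm q"
      using norm_triangle_ineq[of "a *\<^sub>R p" "b *\<^sub>R q"] that by simp
    also have "\<dots> \<le> h * norm p + h * norm q" using that by (intro add_mono mult_right_mono) auto
    also have "\<dots> = h * (norm u + norm v)" using that by (metis distrib_left)
    finally show ?thesis using hd by simp
  qed
  let ?\<Delta> = "f (x + h *\<^sub>R u + h *\<^sub>R v) - f (x + h *\<^sub>R u) - f (x + h *\<^sub>R v) + f x"
  obtain a b where 1: "0 < a" "a < h" "0 < b" "b < h" "?\<Delta> = h * h * F u v (x + a *\<^sub>R u + b *\<^sub>R v)"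
    using mixed_difference[OF sm h hr(1)] unfolding F_def by metis
  obtain a' b' where 2: "0 < a'" "a' < h" "0 < b'" "b' < h"
    "f (x + h *\<^sub>R v + h *\<^sub>R u) - f (x + h *\<^sub>R v) - f (x + h *\<^sub>R u) + f x = h * h * F v u (x
        + a' *\<^sub>R v + b' *\<^sub>R u)"
    using mixed_difference[OF sm h hr(2)] unfolding F_def by metis
  have "x + h *\<^sub>R v + h *\<^sub>R u = x + h *\<^sub>R u + h *\<^sub>R v" by (simp add: algebra_simps)
  with 1(5) 2(5) h have "F u v (x + a *\<^sub>R u + b *\<^sub>R v) = F v u (x + a' *\<^sub>R v + b' *\<^sub>R u)"
    by (simp add: algebra_simps)
  moreover have "dist (F u v (x + a *\<^sub>R u + b *\<^sub>R v)) (F u v x) < e"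
    using near[OF 1(1-4), of u v] by (intro d1) (simp add: d_def)
  moreover have "dist (F v u (x + a' *\<^sub>R v + b' *\<^sub>R u)) (F v u x) < e"
    using near[OF 2(1-4), of v u] by (intro d2) (simp add: d_def add.commute)
  ultimately have "dist (F u v x) (F v u x) < 2 * e"
    using dist_triangle_half_r[of "F u v (x + a *\<^sub>R u + b *\<^sub>R v)" "F u v x" "2 * e" "F v u x"]
    by simp
  then show False by (simp add: dist_real_def e_def)
qed

lemma second_derivative_symmetric:
  fixes f :: "'a::real_normed_vector \<Rightarrow> 'b::euclidean_space"
  assumes "open S" "x \<in> S" "smooth_on S f"
  shows "frechet_derivative (\<lambda>y. frechet_derivative f (at y) u) (at x) v
       = frechet_derivative (\<lambda>y. frechet_derivative f (at y) v) (at x) u"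
proof (rule euclidean_eqI)
  fix b :: 'b assume "b \<in> Basis"
  have sw: "frechet_derivative (\<lambda>y. g y \<bullet> b) (at y) w = frechet_derivative g (at y) w \<bullet> b"
    if "smooth_on S g" "y \<in> S" for g :: "'a \<Rightarrow> 'b" and y w
    using frechet_derivativeI[OF bounded_linear.has_derivative[OF bounded_linear_inner_left
          smooth_on_has_derivative[OF that]]] by metis
  have *: "frechet_derivative (\<lambda>y. frechet_derivative f (at y) u) (at x) v \<bullet> b
      = frechet_derivative (\<lambda>y. frechet_derivative (\<lambda>y. f y \<bullet> b) (at y) u) (at x) v" for u v
    unfolding sw[OF smooth_on_frechet[OF assms(3)] assms(2), symmetric]
    by (rule fun_cong[OF frechet_derivative_cong_open[OF assms(1,2)]]) (simp add: sw assms)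
  have "smooth_on S (\<lambda>y. f y \<bullet> b)"
    by (rule smooth_on_linear[OF bounded_linear_inner_left assms(1,3)])
  from second_derivative_symmetric_real[OF assms(1,2) this]
  show "frechet_derivative (\<lambda>y. frechet_derivative f (at y) u) (at x) v \<bullet> b
      = frechet_derivative (\<lambda>y. frechet_derivative f (at y) v) (at x) u \<bullet> b"
    unfolding * .
qed

section \<open>Differential calculus on manifolds\<close>

text \<open>A smooth map may carry one chart domain into many: smoothness in a source chart is
  checked near each point, with a target chart chosen for that point.\<close>

lemma Ck_on_local:
  assumes "\<And>x. x \<in> S \<Longrightarrow> \<exists>T. open T \<and> x \<in> T \<and> Ck_on k T f"
  shows "Ck_on k S f"
  using assms
proof (induction k arbitrary: f)
  case 0
  have "continuous (at x) f" if "x \<in> S" for x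
    using 0[OF that] by (auto simp: continuous_on_eq_continuous_at)
  then show ?case by (auto intro: continuous_at_imp_continuous_on)
next
  case (Suc k)
  have "f differentiable at x" if "x \<in> S" for x
    using Suc.prems[OF that] by auto
  moreover have "Ck_on k S (\<lambda>x. frechet_derivative f (at x) v)" for v
    by (rule Suc.IH) (metis Suc.prems Ck_on_Suc_frechet)
  ultimately show ?case by simp
qed

lemma smooth_on_local:
  assumes "\<And>x. x \<in> S \<Longrightarrow> \<exists>T. open T \<and> x \<in> T \<and> smooth_on T f"
  shows "smooth_on S f"
  unfolding smooth_on_def by (intro allI Ck_on_local) (metis assms smooth_on_def)

lemma frechet_derivative_add:
  "f differentiable at y \<Longrightarrow> g differentiable at y \<Longrightarrow>
    frechet_derivative (\<lambda>y. f y + g y) (at y) u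
      = frechet_derivative f (at y) u + frechet_derivative g (at y) u"
  by (subst frechet_derivativeI[OF
      has_derivative_add[OF has_derivative_frechet has_derivative_frechet]]) auto

lemma frechet_derivative_diff:
  "f differentiable at y \<Longrightarrow> g differentiable at y \<Longrightarrow>
    frechet_derivative (\<lambda>y. f y - g y) (at y) u
      = frechet_derivative f (at y) u - frechet_derivative g (at y) u"
  by (subst frechet_derivativeI[OF
      has_derivative_diff[OF has_derivative_frechet has_derivative_frechet]]) auto

lemma frechet_derivative_mult:
  fixes f g :: "'a::real_normed_vector \<Rightarrow> 'b::real_normed_algebra"
  shows "f differentiable at y \<Longrightarrow> g differentiable at y \<Longrightarrow>
    frechet_derivative (\<lambda>y. f y * g y) (at y) u
      = f y * frechet_derivative g (at y) u + frechet_derivative f (at y) u * g y"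
  by (subst frechet_derivativeI[OF
      has_derivative_mult[OF has_derivative_frechet has_derivative_frechet]]) auto

lemma frechet_derivative_linear:
  "bounded_linear L \<Longrightarrow> f differentiable at y \<Longrightarrow>
    frechet_derivative (\<lambda>y. L (f y)) (at y) u = L (frechet_derivative f (at y) u)"
  by (subst frechet_derivativeI[OF bounded_linear.has_derivative[OF _ has_derivative_frechet]]) auto

lemma frechet_derivative_sum_scaleR:
  assumes "\<And>i. i \<in> I \<Longrightarrow> f i differentiable at y" "\<And>i. i \<in> I \<Longrightarrow> g i differentiable at y"
  shows "frechet_derivative (\<lambda>y. \<Sum>i\<in>I. f i y *\<^sub>R g i y) (at y) u
    = (\<Sum>i\<in>I. f i y *\<^sub>R frechet_derivative (g i) (at y) u + frechet_derivative (f i) (at y) u *\<^sub>R g i y)"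
proof -
  have "((\<lambda>y. \<Sum>i\<in>I. f i y *\<^sub>R g i y) has_derivative (\<lambda>u. \<Sum>i\<in>I. f i y *\<^sub>R frechet_derivative (g i)
      (at y) u
      + frechet_derivative (f i) (at y) u *\<^sub>R g i y)) (at y)"
    by (intro has_derivative_sum has_derivative_scaleR has_derivative_frechet assms)
  from frechet_derivativeI[OF this] show ?thesis by metis
qed

text \<open>The exterior derivatives of a 1-form (here) and of a 2-form (\<open>cyclic_d\<close> below) in
  coordinates.\<close>

definition dloc :: "('e::euclidean_space \<Rightarrow> 'e \<Rightarrow> complex) \<Rightarrow> 'e \<Rightarrow> 'e \<Rightarrow> 'e \<Rightarrow> complex" where
  "dloc a y u v = frechet_derivative (\<lambda>y. a y v) (at y) u - frechet_derivative (\<lambda>y. a y u) (at y) v"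

lemma dloc_cong:
  assumes "open S" "y \<in> S" "\<And>y v. y \<in> S \<Longrightarrow> a y v = b y v"
  shows "dloc a y u v = dloc b y u v"
proof -
  have "frechet_derivative (\<lambda>y. a y w) (at y) = frechet_derivative (\<lambda>y. b y w) (at y)" for w
    by (rule frechet_derivative_cong_open[OF assms(1,2)]) (use assms(3) in auto)
  then show ?thesis by (simp add: dloc_def)
qed

text \<open>Naturality of d in coordinates. Differentiating b (\<tau> y) (D\<tau> v) produces a term
  with the second derivative of \<tau> in u and v; it is symmetric in u and v and drops out of the
  antisymmetrized expression. Change of chart and pullback of forms are both instances.\<close>

lemma dloc_pullback:
  fixes \<tau> :: "'e::euclidean_space \<Rightarrow> 'f::euclidean_space"
  assumes S: "open S" "y \<in> S" and \<tau>: "smooth_on S \<tau>" "\<tau> ` S \<subseteq> S'"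
    and b: "open S'" "\<And>z. z \<in> S' \<Longrightarrow> linear (b z)" "\<And>w. smooth_on S' (\<lambda>z. b z w)"
    and a: "\<And>y v. y \<in> S \<Longrightarrow> a y v = b (\<tau> y) (frechet_derivative \<tau> (at y) v)"
  shows "dloc a y u v
    = dloc b (\<tau> y) (frechet_derivative \<tau> (at y) u) (frechet_derivative \<tau> (at y) v)"
proof -
  let ?D = "\<lambda>y. frechet_derivative \<tau> (at y)"
  let ?D2 = "\<lambda>v u. frechet_derivative (\<lambda>y. ?D y v) (at y) u"
  have y': "\<tau> y \<in> S'" using \<tau> S by auto
  have \<tau>d: "\<tau> differentiable at y" "(\<lambda>y. ?D y v) differentiable at y" for v
    using smooth_on_differentiable[OF _ S(2)] \<tau>(1) smooth_on_frechet[OF \<tau>(1)] by blast+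
  have bd: "(\<lambda>z. b z w) differentiable at (\<tau> y)" for w
    using smooth_on_differentiable[OF b(3) y'] .
  have bc: "((\<lambda>y. b (\<tau> y) w) has_derivative (\<lambda>u. frechet_derivative (\<lambda>z. b z w) (at (\<tau> y)) (?D y
      u))) (at y)" for w
    using has_derivative_compose[OF has_derivative_frechet[OF \<tau>d(1)] has_derivative_frechet[OF bd]] .
  \<comment> \<open>Smoothness of b is known in fixed directions only; linearity in w extends the
    derivative in z to the moving direction D\<tau> v.\<close>
  have Db: "frechet_derivative (\<lambda>z. b z w) (at (\<tau> y)) u
      = (\<Sum>i\<in>Basis. (w \<bullet> i) *\<^sub>R frechet_derivative (\<lambda>z. b z i) (at (\<tau> y)) u)" for w u
  proof -
    have "frechet_derivative (\<lambda>z. b z w) (at (\<tau> y)) u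
      = frechet_derivative (\<lambda>z. \<Sum>i\<in>Basis. (w \<bullet> i) *\<^sub>R b z i) (at (\<tau> y)) u"
      by (rule fun_cong[OF frechet_derivative_cong_open[OF b(1) y']])
        (rule linear_euclidean_sum[OF b(2)])
    also have "\<dots> = (\<Sum>i\<in>Basis. (w \<bullet> i) *\<^sub>R frechet_derivative (\<lambda>z. b z i) (at (\<tau> y)) u)"
      by (subst frechet_derivative_sum_scaleR) (auto simp: bd)
    finally show ?thesis .
  qed
  have L: "frechet_derivative (\<lambda>y. a y v) (at y) u
      = (\<Sum>i\<in>Basis. (?D2 v u \<bullet> i) *\<^sub>R b (\<tau> y) i)
        + frechet_derivative (\<lambda>z. b z (?D y v)) (at (\<tau> y)) (?D y u)" for u v
  proof -
    have "frechet_derivative (\<lambda>y. a y v) (at y) u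
        = frechet_derivative (\<lambda>y. \<Sum>i\<in>Basis. (?D y v \<bullet> i) *\<^sub>R b (\<tau> y) i) (at y) u"
    proof (rule fun_cong[OF frechet_derivative_cong_open[OF S]])
      fix y assume "y \<in> S"
      then show "a y v = (\<Sum>i\<in>Basis. (?D y v \<bullet> i) *\<^sub>R b (\<tau> y) i)"
        using a linear_euclidean_sum[OF b(2)] \<tau>(2) by (metis image_subset_iff)
    qed
    also have "\<dots> = (\<Sum>i\<in>Basis. (?D y v \<bullet> i) *\<^sub>R frechet_derivative (\<lambda>y. b (\<tau> y) i) (at y) u
        + frechet_derivative (\<lambda>y. ?D y v \<bullet> i) (at y) u *\<^sub>R b (\<tau> y) i)"
    proof (rule frechet_derivative_sum_scaleR)
      show "(\<lambda>y. ?D y v \<bullet> i) differentiable at y" for i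
        using bounded_linear.has_derivative[OF bounded_linear_inner_left
            has_derivative_frechet[OF \<tau>d(2)]]
        unfolding differentiable_def by blast
      show "(\<lambda>y. b (\<tau> y) i) differentiable at y" for i
        using bc unfolding differentiable_def by blast
    qed
    also have "\<dots> = (\<Sum>i\<in>Basis. (?D y v \<bullet> i) *\<^sub>R frechet_derivative (\<lambda>z. b z i) (at (\<tau> y)) (?D y u)
        + (?D2 v u \<bullet> i) *\<^sub>R b (\<tau> y) i)"
      by (intro sum.cong refl) (simp add: frechet_derivativeI[OF bc]
          frechet_derivative_linear[OF bounded_linear_inner_left \<tau>d(2)])
    finally show ?thesis by (simp add: Db[of "?D y v"] sum.distrib)
  qed
  have "?D2 v u = ?D2 u v" by (rule second_derivative_symmetric[OF S \<tau>(1)])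
  then show ?thesis by (simp add: dloc_def L)
qed

section \<open>Functions and forms over an open subset of a manifold\<close>

definition smooth_in :: "('m, 'e::euclidean_space) chart set \<Rightarrow> 'm set \<Rightarrow> ('m \<Rightarrow>
    'f::real_normed_vector) \<Rightarrow> bool" where
  "smooth_in A U u \<longleftrightarrow> (\<forall>c\<in>A. smooth_on (snd c ` (fst c \<inter> U)) (u \<circ> inv_chart c))"

definition form_in :: "('m, 'e::euclidean_space) chart set \<Rightarrow> 'm set \<Rightarrow> ('m, 'e) form1 \<Rightarrow> bool" where
  "form_in A U \<alpha> \<longleftrightarrow> (\<forall>x\<in>U. linear (\<alpha> x)) \<and>
     (\<forall>c\<in>A. \<forall>v. smooth_on (snd c ` (fst c \<inter> U)) (\<lambda>y. local_expr A c \<alpha> y v))"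

text \<open>Turns components with respect to the chart \<open>c\<close> into components with respect to \<open>chart_at A
  x\<close>, by which the tangent space at \<open>x\<close> is identified with the model space.\<close>

definition chart_frame :: "('m, 'e::euclidean_space) chart set \<Rightarrow> ('m, 'e) chart \<Rightarrow> 'm \<Rightarrow> 'e \<Rightarrow> 'e" where
  "chart_frame A c x = frechet_derivative (snd (chart_at A x) \<circ> inv_chart c) (at (snd c x))"

text \<open>U is kept separate from the atlas: cutting the charts down to U could alter
  \<open>chart_at\<close>, and with it the identification of the tangent spaces, whereas here forms
  on M restrict to U unchanged.\<close>

locale open_submanifold =
  fixes A :: "('m::{t2_space,second_countable_topology}, 'e::euclidean_space) chart set"
    and U :: "'m set"
  assumes mfd: "smooth_manifold A" and open_U: "open U" and U_sub: "U \<subseteq> carrier A"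
begin

lemma chart_inv [simp]: "c \<in> A \<Longrightarrow> x \<in> fst c \<Longrightarrow> inv_chart c (snd c x) = x"
  using mfd by (auto simp: smooth_manifold_def homeomorphism_def)

lemma chart_inv_pair [simp]: "(S, h) \<in> A \<Longrightarrow> x \<in> S \<Longrightarrow> inv_chart (S, h) (h x) = x"
  using chart_inv[of "(S, h)"] by simp

lemma chart_snd [simp]: "c \<in> A \<Longrightarrow> y \<in> snd c ` fst c \<Longrightarrow> snd c (inv_chart c y) = y"
  by auto

lemma chart_open: "c \<in> A \<Longrightarrow> open (fst c)"
  using mfd by (auto simp: smooth_manifold_def)

lemma chart_image_open:
  assumes "c \<in> A" "open V"
  shows "open (snd c ` (fst c \<inter> V))"
proof -
  have h: "homeomorphism (fst c) (snd c ` fst c) (snd c) (inv_chart c)" "open (snd c ` fst c)"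
    using mfd assms by (auto simp: smooth_manifold_def)
  have "open (inv_chart c -` V \<inter> snd c ` fst c)"
    using h assms(2) continuous_on_open_vimage[of "snd c ` fst c" "inv_chart c"]
    by (auto simp: homeomorphism_def)
  also have "inv_chart c -` V \<inter> snd c ` fst c = snd c ` (fst c \<inter> V)"
    using assms(1) by auto
  finally show ?thesis .
qed

lemma chart_at_carrier: "x \<in> carrier A \<Longrightarrow> chart_at A x \<in> A \<and> x \<in> fst (chart_at A x)"
  unfolding chart_at_def carrier_def by (rule someI_ex) auto

lemma chart_at_in: "x \<in> U \<Longrightarrow> chart_at A x \<in> A" "x \<in> U \<Longrightarrow> x \<in> fst (chart_at A x)"
  using chart_at_carrier U_sub by auto

lemma transition_smooth:
  "c \<in> A \<Longrightarrow> c' \<in> A \<Longrightarrow> smooth_on (snd c ` (fst c \<inter> fst c')) (snd c' \<circ> inv_chart c)"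
  using mfd by (auto simp: smooth_manifold_def)

lemma chart_change:
  assumes c: "c \<in> A" "c' \<in> A" "x \<in> fst c" "x \<in> fst c'"
    and g: "g \<circ> inv_chart c' differentiable at (snd c' x)"
  shows "(g \<circ> inv_chart c has_derivative (\<lambda>v. frechet_derivative (g \<circ> inv_chart c') (at (snd c' x))
      (frechet_derivative (snd c' \<circ> inv_chart c) (at (snd c x)) v))) (at (snd c x))"
    and "frechet_derivative (g \<circ> inv_chart c) (at (snd c x)) v
      = frechet_derivative (g \<circ> inv_chart c') (at (snd c' x))
          (frechet_derivative (snd c' \<circ> inv_chart c) (at (snd c x)) v)"
proof -
  let ?S = "snd c ` (fst c \<inter> fst c')"
  have S: "open ?S" "snd c x \<in> ?S" using chart_image_open chart_open c by auto
  have e: "(snd c' \<circ> inv_chart c) (snd c x) = snd c' x" using c by simp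
  have "((\<lambda>y. (g \<circ> inv_chart c') ((snd c' \<circ> inv_chart c) y)) has_derivative
    (\<lambda>v. frechet_derivative (g \<circ> inv_chart c') (at (snd c' x))
      (frechet_derivative (snd c' \<circ> inv_chart c) (at (snd c x)) v))) (at (snd c x))"
    using has_derivative_compose[OF smooth_on_has_derivative[OF transition_smooth[OF c(1,2)] S(2)]]
      has_derivative_frechet[OF g] e by metis
  moreover have "(g \<circ> inv_chart c) y = (g \<circ> inv_chart c') ((snd c' \<circ> inv_chart c) y)" if "y \<in> ?S" for y
    using that c by auto
  ultimately show *: "(g \<circ> inv_chart c has_derivative (\<lambda>v. frechet_derivative (g \<circ> inv_chart c') (at
      (snd c' x))
      (frechet_derivative (snd c' \<circ> inv_chart c) (at (snd c x)) v))) (at (snd c x))"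
    by (subst has_derivative_cong_open[OF S]) auto
  show "frechet_derivative (g \<circ> inv_chart c) (at (snd c x)) v
      = frechet_derivative (g \<circ> inv_chart c') (at (snd c' x))
          (frechet_derivative (snd c' \<circ> inv_chart c) (at (snd c x)) v)"
    by (rule fun_cong[OF frechet_derivativeI[OF *]])
qed

lemma transition_differentiable:
  assumes "c \<in> A" "c' \<in> A" "x \<in> fst c" "x \<in> fst c'"
  shows "snd c' \<circ> inv_chart c differentiable at (snd c x)"
  using smooth_on_differentiable[OF transition_smooth[OF assms(1,2)]] assms by auto

lemma chart_frame_linear:
  "c \<in> A \<Longrightarrow> x \<in> fst c \<Longrightarrow> linear (chart_frame A c x)"
  unfolding chart_frame_def
  using chart_at_carrier[of x]
  by (auto simp: carrier_def intro!: linear_frechet_derivative transition_differentiable)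

lemma transition_self:
  assumes "c \<in> A" "x \<in> fst c"
  shows "frechet_derivative (snd c \<circ> inv_chart c) (at (snd c x)) = (\<lambda>v. v)"
proof -
  have "open (snd c ` fst c)" using chart_image_open[OF assms(1) open_UNIV] by simp
  then have "frechet_derivative (snd c \<circ> inv_chart c) (at (snd c x))
      = frechet_derivative (\<lambda>y. y) (at (snd c x))"
    by (rule frechet_derivative_cong_open) (use assms in auto)
  then show ?thesis by simp
qed

lemma chart_frame_self: "x \<in> carrier A \<Longrightarrow> chart_frame A (chart_at A x) x v = v"
  unfolding chart_frame_def using transition_self chart_at_carrier by metis

lemma chart_frame_change:
  assumes "c \<in> A" "c' \<in> A" "x \<in> fst c" "x \<in> fst c'"
  shows "chart_frame A c x v
    = chart_frame A c' x (frechet_derivative (snd c' \<circ> inv_chart c) (at (snd c x)) v)"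
proof -
  have "x \<in> carrier A" using assms by (auto simp: carrier_def)
  then show ?thesis
    unfolding chart_frame_def using assms chart_at_carrier
    by (intro chart_change(2) transition_differentiable) auto
qed

lemma local_expr_eq:
  "c \<in> A \<Longrightarrow> y \<in> snd c ` fst c \<Longrightarrow>
    local_expr A c \<alpha> y v = \<alpha> (inv_chart c y) (chart_frame A c (inv_chart c y) v)"
  by (simp add: local_expr_def chart_frame_def)

lemma local_expr_change:
  assumes "c \<in> A" "c' \<in> A" "y \<in> snd c ` (fst c \<inter> fst c')"
  shows "local_expr A c \<alpha> y v = local_expr A c' \<alpha> ((snd c' \<circ> inv_chart c) y)
     (frechet_derivative (snd c' \<circ> inv_chart c) (at y) v)"
proof -
  obtain x where x: "x \<in> fst c" "x \<in> fst c'" "y = snd c x" using assms(3) by auto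
  then show ?thesis
    using assms chart_frame_change[OF assms(1,2) x(1,2)]
    by (simp add: local_expr_eq)
qed

lemma local_expr_at: "x \<in> carrier A \<Longrightarrow> local_expr A (chart_at A x) \<alpha> (snd (chart_at A x) x) v = \<alpha> x v"
  using chart_at_carrier[of x] by (simp add: local_expr_eq chart_frame_self)

lemma smooth_in_has_derivative:
  "smooth_in A U u \<Longrightarrow> c \<in> A \<Longrightarrow> x \<in> fst c \<Longrightarrow> x \<in> U \<Longrightarrow>
    (u \<circ> inv_chart c has_derivative frechet_derivative (u \<circ> inv_chart c) (at (snd c x))) (at (snd c x))"
  unfolding smooth_in_def by (intro smooth_on_has_derivative[of "snd c ` (fst c \<inter> U)"]) auto

lemma smooth_in_differentiable:
  "smooth_in A U u \<Longrightarrow> c \<in> A \<Longrightarrow> x \<in> fst c \<Longrightarrow> x \<in> U \<Longrightarrow> u \<circ> inv_chart c differentiable at (snd c x)"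
  using smooth_in_has_derivative unfolding differentiable_def by blast

lemma d_fun_has_derivative:
  assumes "smooth_in A U u" "x \<in> U"
  shows "(u \<circ> inv_chart (chart_at A x) has_derivative d_fun A u x) (at (snd (chart_at A x) x))"
  unfolding d_fun_def using assms chart_at_in by (intro smooth_in_has_derivative)

lemma d_funI:
  "((\<lambda>y. u (inv_chart (chart_at A x) y)) has_derivative D) (at (snd (chart_at A x) x))
      \<Longrightarrow> d_fun A u x v = D v"
  unfolding d_fun_def o_def using frechet_derivativeI by metis

lemma d_fun_linear: "smooth_in A U u \<Longrightarrow> x \<in> U \<Longrightarrow> linear (d_fun A u x)"
  using d_fun_has_derivative has_derivative_linear by blast

lemma d_fun_cong:
  assumes "\<And>x. x \<in> U \<Longrightarrow> u x = w x" "x \<in> U"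
  shows "d_fun A u x = d_fun A w x"
  unfolding d_fun_def
  by (rule frechet_derivative_cong_open[OF chart_image_open[OF chart_at_in(1)[OF assms(2)] open_U]])
    (use assms chart_at_in in auto)

text \<open>\<open>d_fun\<close> uses a different chart at each point; this collects its values in
  one chart, where they can be differentiated again.\<close>

lemma d_fun_local_expr:
  assumes "smooth_in A U u" "c \<in> A" "y \<in> snd c ` (fst c \<inter> U)"
  shows "local_expr A c (d_fun A u) y v = frechet_derivative (u \<circ> inv_chart c) (at y) v"
proof -
  obtain x where x: "x \<in> fst c" "x \<in> U" "y = snd c x" using assms by auto
  then show ?thesis
    using assms chart_at_in chart_change(2)[OF assms(2) _ x(1), of "chart_at A x" u]
    by (simp add: local_expr_eq smooth_in_differentiable d_fun_def chart_frame_def)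
qed

lemma form_in_cong:
  assumes "\<And>x v. x \<in> U \<Longrightarrow> \<alpha> x v = \<beta> x v"
  shows "form_in A U \<alpha> \<longleftrightarrow> form_in A U \<beta>"
proof -
  have "\<alpha> x = \<beta> x" if "x \<in> U" for x using assms that by auto
  then have "(\<forall>x\<in>U. linear (\<alpha> x)) = (\<forall>x\<in>U. linear (\<beta> x))" by auto
  moreover have "smooth_on (snd c ` (fst c \<inter> U)) (\<lambda>y. local_expr A c \<alpha> y v)
      = smooth_on (snd c ` (fst c \<inter> U)) (\<lambda>y. local_expr A c \<beta> y v)" if "c \<in> A" for c v
    by (rule smooth_on_cong[OF chart_image_open[OF that open_U]])
      (use assms that in \<open>auto simp: local_expr_def\<close>)
  ultimately show ?thesis by (simp add: form_in_def)
qed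

lemma local_expr_linear:
  assumes "form_in A U \<alpha>" "c \<in> A" "y \<in> snd c ` (fst c \<inter> U)"
  shows "linear (local_expr A c \<alpha> y)"
proof -
  have "local_expr A c \<alpha> y = \<alpha> (inv_chart c y) \<circ> chart_frame A c (inv_chart c y)"
    using assms by (auto simp: local_expr_eq)
  then show ?thesis
    using assms by (auto simp: form_in_def intro!: linear_compose chart_frame_linear)
qed

lemma form_in_smooth:
  "form_in A U \<alpha> \<Longrightarrow> c \<in> A \<Longrightarrow> smooth_on (snd c ` (fst c \<inter> U)) (\<lambda>y. local_expr A c \<alpha> y v)"
  by (simp add: form_in_def)

lemma form_in_linear: "form_in A U \<alpha> \<Longrightarrow> x \<in> U \<Longrightarrow> linear (\<alpha> x)"
  by (simp add: form_in_def)

lemma ext_d_dloc: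
  "ext_d A \<alpha> x u v = dloc (local_expr A (chart_at A x) \<alpha>) (snd (chart_at A x) x) u v"
  by (simp add: ext_d_def dloc_def Let_def)

text \<open>\<open>ext_d\<close> is computed in the chart chosen at x. Applying
  \<open>dloc_pullback\<close> to the transition map gives independence of this choice, so that
  values at neighbouring points can be compared inside one chart.\<close>

lemma ext_d_chart:
  assumes "form_in A U \<alpha>" "c \<in> A" "x \<in> fst c" "x \<in> U"
  shows "dloc (local_expr A c \<alpha>) (snd c x) u v
    = ext_d A \<alpha> x (chart_frame A c x u) (chart_frame A c x v)"
proof -
  define c' where "c' = chart_at A x"
  have c': "c' \<in> A" "x \<in> fst c'" using chart_at_in assms by (auto simp: c'_def)
  let ?S = "snd c ` (fst c \<inter> (fst c' \<inter> U))" and ?\<tau> = "snd c' \<circ> inv_chart c"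
  have "dloc (local_expr A c \<alpha>) (snd c x) u v = dloc (local_expr A c' \<alpha>) (?\<tau> (snd c x))
     (frechet_derivative ?\<tau> (at (snd c x)) u) (frechet_derivative ?\<tau> (at (snd c x)) v)"
  proof (rule dloc_pullback)
    show "open ?S" using assms c' by (intro chart_image_open open_Int chart_open open_U)
    show "smooth_on ?S ?\<tau>"
      by (rule smooth_on_subset[OF transition_smooth[OF assms(2) c'(1)]]) auto
    show "?\<tau> ` ?S \<subseteq> snd c' ` (fst c' \<inter> U)" using assms(2) by auto
    show "open (snd c' ` (fst c' \<inter> U))" using c' by (intro chart_image_open open_U)
    show "linear (local_expr A c' \<alpha> z)" if "z \<in> snd c' ` (fst c' \<inter> U)" for z
      using local_expr_linear assms c' that by blast
    show "smooth_on (snd c' ` (fst c' \<inter> U)) (\<lambda>z. local_expr A c' \<alpha> z w)" for w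
      using form_in_smooth assms c' by blast
    show "local_expr A c \<alpha> y v = local_expr A c' \<alpha> (?\<tau> y) (frechet_derivative ?\<tau> (at y) v)"
      if "y \<in> ?S" for y v
      by (rule local_expr_change) (use that assms c' in auto)
    show "snd c x \<in> ?S" using assms c' by auto
  qed
  then show ?thesis using assms by (simp add: ext_d_dloc chart_frame_def c'_def)
qed

lemma ext_d_cong:
  assumes "\<And>x v. x \<in> U \<Longrightarrow> \<alpha> x v = \<beta> x v" "x \<in> U"
  shows "ext_d A \<alpha> x u v = ext_d A \<beta> x u v"
  unfolding ext_d_dloc
  by (rule dloc_cong[OF chart_image_open[OF chart_at_in(1)[OF assms(2)] open_U]])
    (use assms chart_at_in in \<open>auto simp: local_expr_eq\<close>)

lemma smooth_in_const: "smooth_in A U (\<lambda>x. k)"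
  by (simp add: smooth_in_def o_def smooth_on_const)

lemma smooth_in_add: "smooth_in A U u \<Longrightarrow> smooth_in A U w \<Longrightarrow> smooth_in A U (\<lambda>x. u x + w x)"
  unfolding smooth_in_def o_def by (intro ballI smooth_on_add chart_image_open open_U) auto

lemma smooth_in_diff: "smooth_in A U u \<Longrightarrow> smooth_in A U w \<Longrightarrow> smooth_in A U (\<lambda>x. u x - w x)"
  unfolding smooth_in_def o_def by (intro ballI smooth_on_diff chart_image_open open_U) auto

lemma smooth_in_minus: "smooth_in A U u \<Longrightarrow> smooth_in A U (\<lambda>x. - u x)"
  unfolding smooth_in_def o_def by (intro ballI smooth_on_minus chart_image_open open_U) auto

lemma smooth_in_mult:
  fixes u w :: "'m \<Rightarrow> 'b::real_normed_algebra"
  shows "smooth_in A U u \<Longrightarrow> smooth_in A U w \<Longrightarrow> smooth_in A U (\<lambda>x. u x * w x)"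
  unfolding smooth_in_def o_def by (intro ballI smooth_on_mult chart_image_open open_U) auto

lemma smooth_in_divide:
  fixes u w :: "'m \<Rightarrow> 'b::{euclidean_space, real_normed_field}"
  shows "smooth_in A U u \<Longrightarrow> smooth_in A U w \<Longrightarrow> (\<And>x. x \<in> U \<Longrightarrow> w x \<noteq> 0)
    \<Longrightarrow> smooth_in A U (\<lambda>x. u x / w x)"
  unfolding smooth_in_def o_def by (intro ballI smooth_on_divide chart_image_open open_U) auto

lemma smooth_in_cnj: "smooth_in A U u \<Longrightarrow> smooth_in A U (\<lambda>x. cnj (u x))"
  unfolding smooth_in_def o_def by (intro ballI smooth_on_cnj chart_image_open open_U) auto

lemma smooth_in_of_real: "smooth_in A U u \<Longrightarrow> smooth_in A U (\<lambda>x. complex_of_real (u x))"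
  unfolding smooth_in_def o_def by (intro ballI smooth_on_of_real chart_image_open open_U) auto

lemma smooth_in_Im: "smooth_in A U u \<Longrightarrow> smooth_in A U (\<lambda>x. Im (u x))"
  unfolding smooth_in_def o_def by (intro ballI smooth_on_Im chart_image_open open_U) auto

lemma smooth_in_cis: "smooth_in A U u \<Longrightarrow> smooth_in A U (\<lambda>x. cis (u x))"
  unfolding smooth_in_def o_def by (intro ballI smooth_on_cis chart_image_open open_U) auto

lemma smooth_in_cmod:
  "smooth_in A U u \<Longrightarrow> (\<And>x. x \<in> U \<Longrightarrow> u x \<noteq> 0) \<Longrightarrow> smooth_in A U (\<lambda>x. cmod (u x))"
  unfolding smooth_in_def o_def by (intro ballI smooth_on_cmod chart_image_open open_U) auto

lemma smooth_in_ln: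
  fixes u :: "'m \<Rightarrow> real"
  shows "smooth_in A U u \<Longrightarrow> (\<And>x. x \<in> U \<Longrightarrow> 0 < u x) \<Longrightarrow> smooth_in A U (\<lambda>x. ln (u x))"
  unfolding smooth_in_def o_def by (intro ballI smooth_on_ln chart_image_open open_U) auto

lemma smooth_in_Ln:
  "smooth_in A U u \<Longrightarrow> (\<And>x. x \<in> U \<Longrightarrow> 0 < Re (u x)) \<Longrightarrow> smooth_in A U (\<lambda>x. Ln (u x))"
  unfolding smooth_in_def o_def by (intro ballI smooth_on_Ln chart_image_open open_U) auto

lemma smooth_in_continuous_on:
  assumes "smooth_in A U u"
  shows "continuous_on U u"
proof (rule continuous_at_imp_continuous_on, rule ballI)
  fix x assume x: "x \<in> U"
  define c where "c = chart_at A x"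
  have c: "c \<in> A" "x \<in> fst c" using chart_at_in[OF x] by (auto simp: c_def)
  have "continuous_on (fst c \<inter> U) ((u \<circ> inv_chart c) \<circ> snd c)"
  proof (rule continuous_on_compose)
    show "continuous_on (fst c \<inter> U) (snd c)"
      using c mfd by (auto simp: smooth_manifold_def homeomorphism_def elim: continuous_on_subset)
    show "continuous_on (snd c ` (fst c \<inter> U)) (u \<circ> inv_chart c)"
      using assms c smooth_on_continuous unfolding smooth_in_def by blast
  qed
  moreover have "((u \<circ> inv_chart c) \<circ> snd c) y = u y" if "y \<in> fst c \<inter> U" for y
    using that c by auto
  ultimately have "continuous_on (fst c \<inter> U) u"
    using continuous_on_cong[OF refl] by blast
  then show "isCont u x"
    using c x chart_open open_U by (simp add: continuous_on_eq_continuous_at open_Int)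
qed

lemma d_fun_const: "d_fun A (\<lambda>x. k) x v = 0"
  by (rule d_funI) simp

lemma d_fun_add: "smooth_in A U u \<Longrightarrow> smooth_in A U w \<Longrightarrow> x \<in> U \<Longrightarrow>
    d_fun A (\<lambda>x. u x + w x) x v = d_fun A u x v + d_fun A w x v"
  by (rule d_funI) (intro has_derivative_add d_fun_has_derivative[unfolded o_def])

lemma d_fun_diff: "smooth_in A U u \<Longrightarrow> smooth_in A U w \<Longrightarrow> x \<in> U \<Longrightarrow>
    d_fun A (\<lambda>x. u x - w x) x v = d_fun A u x v - d_fun A w x v"
  by (rule d_funI) (intro has_derivative_diff d_fun_has_derivative[unfolded o_def])

lemma d_fun_mult:
  assumes "smooth_in A U u" "smooth_in A U w" "x \<in> U"
  shows "d_fun A (\<lambda>x. u x * w x) x v = u x * d_fun A w x v + d_fun A u x v * w x"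
proof -
  have "inv_chart (chart_at A x) (snd (chart_at A x) x) = x"
    using chart_at_in[OF assms(3)] by simp
  then show ?thesis
    using has_derivative_mult[OF d_fun_has_derivative[OF assms(1,3), unfolded o_def]
        d_fun_has_derivative[OF assms(2,3), unfolded o_def]]
    by (intro d_funI) simp
qed

lemma d_fun_cmult: "smooth_in A U w \<Longrightarrow> x \<in> U \<Longrightarrow> d_fun A (\<lambda>x. k * w x) x v = k * d_fun A w x v"
  by (simp add: d_fun_mult smooth_in_const d_fun_const)

lemma d_fun_cnj: "smooth_in A U u \<Longrightarrow> x \<in> U \<Longrightarrow> d_fun A (\<lambda>x. cnj (u x)) x v = cnj (d_fun A u x v)"
  by (rule d_funI) (intro bounded_linear.has_derivative[OF bounded_linear_cnj]
      d_fun_has_derivative[unfolded o_def])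

lemma d_fun_of_real_cnj:
  assumes "smooth_in A U u" "x \<in> U"
  shows "cnj (d_fun A (\<lambda>x. complex_of_real (u x)) x v) = d_fun A (\<lambda>x. complex_of_real (u x)) x v"
  using d_fun_cnj[OF smooth_in_of_real[OF assms(1)] assms(2)] by simp

lemma d_fun_exp:
  assumes "smooth_in A U u" "x \<in> U"
  shows "d_fun A (\<lambda>x. exp (u x)) x v = exp (u x) * d_fun A u x v"
proof -
  have "inv_chart (chart_at A x) (snd (chart_at A x) x) = x"
    using chart_at_in[OF assms(2)] by simp
  then show ?thesis
    using has_derivative_compose[OF d_fun_has_derivative[OF assms, unfolded
        o_def] DERIV_exp[THEN has_field_derivative_imp_has_derivative]]
    by (intro d_funI) simp
qed

lemma d_fun_cis:
  assumes "smooth_in A U u" "x \<in> U"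
  shows "d_fun A (\<lambda>x. cis (u x)) x v = \<i> * cis (u x) * d_fun A (\<lambda>x. complex_of_real (u x)) x v"
  using d_fun_exp[OF smooth_in_mult[OF smooth_in_const smooth_in_of_real[OF assms(1)]] assms(2), of \<i>]
    d_fun_cmult[OF smooth_in_of_real[OF assms(1)] assms(2), of \<i>]
  by (simp add: cis_conv_exp)

text \<open>Obtained by differentiating u = exp (ln u).\<close>

lemma d_fun_ln:
  assumes "smooth_in A U u" "x \<in> U" "\<And>x. x \<in> U \<Longrightarrow> 0 < u x"
  shows "d_fun A (\<lambda>x. complex_of_real (ln (u x))) x v
      = d_fun A (\<lambda>x. complex_of_real (u x)) x v / complex_of_real (u x)"
proof -
  have "d_fun A (\<lambda>x. complex_of_real (u x)) x = d_fun A (\<lambda>x. exp (complex_of_real (ln (u x)))) x"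
    by (rule d_fun_cong[OF _ assms(2)]) (simp add: assms(3) exp_of_real)
  then show ?thesis
    using d_fun_exp[OF smooth_in_of_real[OF
        smooth_in_ln[OF assms(1,3)]] assms(2)] assms(2) assms(3)[of x]
    by (simp add: exp_of_real)
qed

lemma form_in_scale:
  assumes "smooth_in A U u" "form_in A U \<alpha>"
  shows "form_in A U (\<lambda>x v. u x * \<alpha> x v)"
  unfolding form_in_def
proof (intro conjI ballI allI)
  show "linear (\<lambda>v. u x * \<alpha> x v)" if "x \<in> U" for x
    using linear_compose[OF form_in_linear[OF assms(2) that] bounded_linear.linear[OF
        bounded_linear_mult_right]]
    by (simp add: o_def)
  show "smooth_on (snd c ` (fst c \<inter> U)) (\<lambda>y. local_expr A c (\<lambda>x v. u x * \<alpha> x v) y v)" if "c \<in> A" for c v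
    using smooth_on_mult[OF chart_image_open[OF that open_U] _
        form_in_smooth[OF assms(2) that]] assms(1) that
    by (simp add: local_expr_def smooth_in_def o_def)
qed

lemma form_in_add:
  assumes "form_in A U \<alpha>" "form_in A U \<beta>"
  shows "form_in A U (\<lambda>x v. \<alpha> x v + \<beta> x v)"
  unfolding form_in_def
proof (intro conjI ballI allI)
  show "linear (\<lambda>v. \<alpha> x v + \<beta> x v)" if "x \<in> U" for x
    using linear_compose_add[OF form_in_linear[OF assms(1) that] form_in_linear[OF assms(2) that]] .
  show "smooth_on (snd c ` (fst c \<inter> U)) (\<lambda>y. local_expr A c (\<lambda>x v. \<alpha> x v + \<beta> x v) y v)" if "c \<in> A"
      for c v
    using smooth_on_add[OF chart_image_open[OF that open_U] form_in_smooth[OF assms(1) that]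
        form_in_smooth[OF assms(2) that]]
    by (simp add: local_expr_def)
qed

lemma form_in_cnj:
  assumes "form_in A U \<alpha>"
  shows "form_in A U (cnj_form \<alpha>)"
  unfolding form_in_def
proof (intro conjI ballI allI)
  show "linear (cnj_form \<alpha> x)" if "x \<in> U" for x
    using linear_compose[OF form_in_linear[OF assms that] bounded_linear.linear[OF bounded_linear_cnj]]
    by (simp add: o_def cnj_form_def)
  show "smooth_on (snd c ` (fst c \<inter> U)) (\<lambda>y. local_expr A c (cnj_form \<alpha>) y v)" if "c \<in> A" for c v
    using smooth_on_cnj[OF chart_image_open[OF that open_U] form_in_smooth[OF assms that]]
    by (simp add: local_expr_def cnj_form_def)
qed

lemma form_in_d_fun:
  assumes "smooth_in A U u"
  shows "form_in A U (d_fun A u)"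
  unfolding form_in_def
proof (intro conjI ballI allI)
  show "linear (d_fun A u x)" if "x \<in> U" for x using d_fun_linear[OF assms that] .
  show "smooth_on (snd c ` (fst c \<inter> U)) (\<lambda>y. local_expr A c (d_fun A u) y v)" if c: "c \<in> A" for c v
    using smooth_on_frechet assms c d_fun_local_expr[OF assms c]
    by (subst smooth_on_cong[OF chart_image_open[OF c open_U], of _
        "\<lambda>y. frechet_derivative (u \<circ> inv_chart c) (at y) v"])
      (auto simp: smooth_in_def)
qed

lemma local_expr_differentiable:
  assumes "form_in A U \<alpha>" "x \<in> U"
  shows "(\<lambda>y. local_expr A (chart_at A x) \<alpha> y v) differentiable at (snd (chart_at A x) x)"
  using smooth_on_differentiable[OF form_in_smooth[OF assms(1)]] chart_at_in[OF assms(2)] assms(2)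
      by auto

lemma ext_d_scale:
  assumes "smooth_in A U u" "form_in A U \<alpha>" "x \<in> U"
  shows "ext_d A (\<lambda>x v. u x * \<alpha> x v) x a b
    = d_fun A u x a * \<alpha> x b - d_fun A u x b * \<alpha> x a + u x * ext_d A \<alpha> x a b"
proof -
  let ?c = "chart_at A x"
  have c: "?c \<in> A" "x \<in> fst ?c" "x \<in> carrier A" using chart_at_in assms U_sub by auto
  have "frechet_derivative (\<lambda>y. local_expr A ?c (\<lambda>x v. u x * \<alpha> x v) y b) (at (snd ?c x)) a
    = u x * frechet_derivative (\<lambda>y. local_expr A ?c \<alpha> y b) (at (snd ?c x)) a + d_fun A u x a
        * \<alpha> x b" for a b
  proof -
    have "(\<lambda>y. local_expr A ?c (\<lambda>x v. u x * \<alpha> x v) y b) = (\<lambda>y. (u \<circ> inv_chart ?c) y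
        * local_expr A ?c \<alpha> y b)"
      by (simp add: local_expr_def)
    then show ?thesis
      using frechet_derivative_mult[OF smooth_in_differentiable[OF assms(1) c(1,2) assms(3)]
          local_expr_differentiable[OF assms(2,3)]] c local_expr_at[OF c(3)]
      by (simp add: d_fun_def)
  qed
  then show ?thesis by (simp add: ext_d_dloc dloc_def algebra_simps)
qed

lemma ext_d_add:
  assumes "form_in A U \<alpha>" "form_in A U \<beta>" "x \<in> U"
  shows "ext_d A (\<lambda>x v. \<alpha> x v + \<beta> x v) x a b = ext_d A \<alpha> x a b + ext_d A \<beta> x a b"
proof -
  have "local_expr A c (\<lambda>x v. \<alpha> x v + \<beta> x v) y v = local_expr A c \<alpha> y v + local_expr A c \<beta> y v"
      for c y v
    by (simp add: local_expr_def)
  then show ?thesis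
    by (simp add: ext_d_dloc dloc_def frechet_derivative_add local_expr_differentiable assms)
qed

lemma ext_d_cnj:
  assumes "form_in A U \<alpha>" "x \<in> U"
  shows "ext_d A (cnj_form \<alpha>) x a b = cnj (ext_d A \<alpha> x a b)"
proof -
  have "local_expr A c (cnj_form \<alpha>) y v = cnj (local_expr A c \<alpha> y v)" for c y v
    by (simp add: local_expr_def cnj_form_def)
  then show ?thesis
    by (simp add: ext_d_dloc dloc_def
        frechet_derivative_linear[OF bounded_linear_cnj] local_expr_differentiable assms)
qed

text \<open>In one chart du is the ordinary derivative of u, so this is the symmetry of second
  derivatives.\<close>

lemma ext_d_d_fun:
  assumes "smooth_in A U u" "x \<in> U"
  shows "ext_d A (d_fun A u) x a b = 0"
proof -
  let ?c = "chart_at A x"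
  have c: "?c \<in> A" "x \<in> fst ?c" using chart_at_in assms by auto
  have S: "open (snd ?c ` (fst ?c \<inter> U))" "snd ?c x \<in> snd ?c ` (fst ?c \<inter> U)"
    using chart_image_open[OF c(1) open_U] c assms by auto
  have "dloc (local_expr A ?c (d_fun A u)) (snd ?c x) a b
      = dloc (\<lambda>y. frechet_derivative (u \<circ> inv_chart ?c) (at y)) (snd ?c x) a b"
    by (rule dloc_cong[OF S]) (use d_fun_local_expr[OF assms(1) c(1)] in auto)
  also have "\<dots> = 0"
    unfolding dloc_def using second_derivative_symmetric[OF S] assms c(1)
    by (auto simp: smooth_in_def)
  finally show ?thesis by (simp add: ext_d_dloc)
qed

end

section \<open>Exterior derivative of 2-forms and d d = 0\<close>

definition cyclic_d :: "('e::euclidean_space \<Rightarrow> 'e \<Rightarrow> 'e \<Rightarrow> complex) \<Rightarrow> 'e \<Rightarrow> 'e \<Rightarrow> 'e \<Rightarrow> 'e \<Rightarrow> complex" where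
  "cyclic_d \<beta> y u v w = frechet_derivative (\<lambda>y. \<beta> y v w) (at y) u
     - frechet_derivative (\<lambda>y. \<beta> y u w) (at y) v + frechet_derivative (\<lambda>y. \<beta> y u v) (at y) w"

lemma cyclic_d_cong:
  assumes "open S" "y \<in> S" "\<And>y u v. y \<in> S \<Longrightarrow> \<beta> y u v = \<gamma> y u v"
  shows "cyclic_d \<beta> y u v w = cyclic_d \<gamma> y u v w"
proof -
  have "frechet_derivative (\<lambda>y. \<beta> y u v) (at y) = frechet_derivative (\<lambda>y. \<gamma> y u v) (at y)" for u v
    by (rule frechet_derivative_cong_open[OF assms(1,2)]) (use assms(3) in auto)
  then show ?thesis by (simp add: cyclic_d_def)
qed

lemma cyclic_d_dloc:
  assumes "open S" "y \<in> S" "\<And>v. smooth_on S (\<lambda>y. a y v)"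
  shows "cyclic_d (dloc a) y u v w = 0"
proof -
  have "frechet_derivative (\<lambda>y. dloc a y u v) (at y) w
    = frechet_derivative (\<lambda>y. frechet_derivative (\<lambda>y. a y v) (at y) u) (at y) w
    - frechet_derivative (\<lambda>y. frechet_derivative (\<lambda>y. a y u) (at y) v) (at y) w" for u v w
    unfolding dloc_def
    by (rule frechet_derivative_diff) (rule smooth_on_differentiable[OF
        smooth_on_frechet[OF assms(3)] assms(2)])+
  then show ?thesis
    using second_derivative_symmetric[OF assms(1,2,3)] by (simp add: cyclic_d_def)
qed

lemma cyclic_d_add:
  assumes "\<And>u v. (\<lambda>y. \<beta> y u v) differentiable at y" "\<And>u v. (\<lambda>y. \<gamma> y u v) differentiable at y"
  shows "cyclic_d (\<lambda>y u v. \<beta> y u v + \<gamma> y u v) y u v w = cyclic_d \<beta> y u v w + cyclic_d \<gamma> y u v w"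
  by (simp add: cyclic_d_def frechet_derivative_add assms)

text \<open>The rule d (f a \<and> b) = df \<and> a \<and> b + f (da \<and> b - a \<and> db)
  evaluated on three vectors; the six terms in the bracket are the two products of a 2-form with a
  1-form.\<close>

lemma cyclic_d_wedge:
  assumes "f differentiable at y" "\<And>v. (\<lambda>y. a y v) differentiable at y"
      "\<And>v. (\<lambda>y. b y v) differentiable at y"
  shows "cyclic_d (\<lambda>y u v. f y * (a y \<and>\<^sub>1 b y) u v) y u v w
    = wedge3 (frechet_derivative f (at y)) (a y) (b y) u v w
    + f y * (dloc a y u v * b y w - dloc a y u w * b y v + dloc a y v w * b y u
      - (a y u * dloc b y v w - a y v * dloc b y u w + a y w * dloc b y u v))"
proof -
  have d: "(\<lambda>y. a y u * b y v) differentiable at y" for u v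
    using assms(2,3) by (rule differentiable_mult)
  have D: "frechet_derivative (\<lambda>y. f y * (a y \<and>\<^sub>1 b y) u v) (at y) w
    = f y * ((a y u * frechet_derivative (\<lambda>y. b y v) (at y) w
        + frechet_derivative (\<lambda>y. a y u) (at y) w * b y v)
       - (a y v * frechet_derivative (\<lambda>y. b y u) (at y) w + frechet_derivative (\<lambda>y. a y v) (at y) w
           * b y u))
      + frechet_derivative f (at y) w * (a y u * b y v - a y v * b y u)" for u v w
    unfolding wedge_def
    by (simp add: frechet_derivative_mult frechet_derivative_diff assms d differentiable_diff)
  show ?thesis
    unfolding cyclic_d_def D by (simp add: dloc_def wedge3_def wedge_def algebra_simps)
qed

context open_submanifold
begin

text \<open>This is \<open>d (d \<gamma>) = 0\<close>: the term \<open>T f \<alpha> \<beta>\<close> is \<open>d (f \<alpha> \<and> \<beta>)\<close> evaluated at \<open>u, v, w\<close>.\<close>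

lemma ext_d_closed:
  assumes \<gamma>: "form_in A U \<gamma>"
    and f: "smooth_in A U f1" "smooth_in A U f2" "smooth_in A U f3"
    and \<alpha>: "form_in A U \<alpha>1" "form_in A U \<alpha>2" "form_in A U \<alpha>3"
    and \<beta>: "form_in A U \<beta>1" "form_in A U \<beta>2" "form_in A U \<beta>3"
    and eq: "\<forall>x\<in>U. \<forall>u v. ext_d A \<gamma> x u v = f1 x * (\<alpha>1 x \<and>\<^sub>1 \<beta>1 x) u v
      + f2 x * (\<alpha>2 x \<and>\<^sub>1 \<beta>2 x) u v + f3 x * (\<alpha>3 x \<and>\<^sub>1 \<beta>3 x) u v"
    and x: "x \<in> U"
    and T: "T = (\<lambda>f \<alpha> \<beta>. wedge3 (d_fun A f x) (\<alpha> x) (\<beta> x) u v w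
    + f x * (ext_d A \<alpha> x u v * \<beta> x w - ext_d A \<alpha> x u w * \<beta> x v + ext_d A \<alpha> x v w * \<beta> x u
      - (\<alpha> x u * ext_d A \<beta> x v w - \<alpha> x v * ext_d A \<beta> x u w + \<alpha> x w * ext_d A \<beta> x u v)))"
  shows "T f1 \<alpha>1 \<beta>1 + T f2 \<alpha>2 \<beta>2 + T f3 \<alpha>3 \<beta>3 = 0"
proof -
  let ?c = "chart_at A x"
  have c: "?c \<in> A" "x \<in> fst ?c" "x \<in> carrier A" using chart_at_in x U_sub by auto
  let ?S = "snd ?c ` (fst ?c \<inter> U)" and ?y = "snd ?c x"
  have S: "open ?S" "?y \<in> ?S" using chart_image_open[OF c(1) open_U] c x by auto
  let ?L = "local_expr A ?c"
  let ?R = "\<lambda>f \<alpha> \<beta> y u v. (f \<circ> inv_chart ?c) y * (?L \<alpha> y \<and>\<^sub>1 ?L \<beta> y) u v"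
  have d: "f \<circ> inv_chart ?c differentiable at ?y" if "smooth_in A U f" for f :: "'m \<Rightarrow> complex"
    using smooth_in_differentiable[OF that c(1,2) x] .
  have Rd: "(\<lambda>y. ?R f \<alpha> \<beta> y u v) differentiable at ?y" if "smooth_in A U f" "form_in A U \<alpha>"
      "form_in A U \<beta>" for f \<alpha> \<beta> u v
    unfolding wedge_def
    using d[OF that(1)] local_expr_differentiable[OF that(2) x] local_expr_differentiable[OF that(3) x]
    by (intro differentiable_mult differentiable_diff) (auto simp: o_def)
  have R: "cyclic_d (?R f \<alpha> \<beta>) ?y u v w = T f \<alpha> \<beta>" if "smooth_in A U f" "form_in A U \<alpha>"
      "form_in A U \<beta>" for f \<alpha> \<beta>
    using cyclic_d_wedge[OF d[OF that(1)] local_expr_differentiable[OF that(2) x]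
        local_expr_differentiable[OF that(3) x], where u = u and v = v and w = w] c(1,2)
    by (simp add: T local_expr_at[OF c(3)] ext_d_dloc d_fun_def local_expr_at[OF c(3), abs_def]
        wedge3_def wedge_def)
  have "0 = cyclic_d (dloc (?L \<gamma>)) ?y u v w"
    using cyclic_d_dloc[OF S form_in_smooth[OF \<gamma> c(1)]] by simp
  also have "\<dots> = cyclic_d (\<lambda>y u v. ?R f1 \<alpha>1 \<beta>1 y u v + ?R f2 \<alpha>2 \<beta>2 y u v + ?R f3 \<alpha>3 \<beta>3 y u v) ?y u v w"
  \<comment> \<open>The formula for d\<gamma> is about to be differentiated, so it has to hold near
    x; \<open>ext_d_chart\<close> transfers it to the fixed chart \<open>?c\<close> at every nearby
    z.\<close>
  proof (rule cyclic_d_cong[OF S])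
    fix y u v assume "y \<in> ?S"
    then obtain z where z: "z \<in> fst ?c" "z \<in> U" "y = snd ?c z" by auto
    then show "dloc (?L \<gamma>) y u v = ?R f1 \<alpha>1 \<beta>1 y u v + ?R f2 \<alpha>2 \<beta>2 y u v + ?R f3 \<alpha>3 \<beta>3 y u v"
      using ext_d_chart[OF \<gamma> c(1) z(1,2)] c(1) by (simp add: eq local_expr_eq wedge_def)
  qed
  also have "\<dots> = T f1 \<alpha>1 \<beta>1 + T f2 \<alpha>2 \<beta>2 + T f3 \<alpha>3 \<beta>3"
    using f \<alpha> \<beta> by (simp add: cyclic_d_add R Rd differentiable_add del: o_apply)
  finally show ?thesis by simp
qed

end

lemma carrier_submanifold:
  "smooth_manifold A \<Longrightarrow> open_submanifold A (carrier A)"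
  by unfold_locales (auto simp: smooth_manifold_def carrier_def)

section \<open>Smooth maps, pullback and naturality of d\<close>

locale manifold_map = M: open_submanifold A "carrier A" + N: open_submanifold B "carrier B"
  for A :: "('m::{t2_space,second_countable_topology}, 'e::euclidean_space) chart set"
    and B :: "('n::{t2_space,second_countable_topology}, 'f::euclidean_space) chart set" +
  fixes F :: "'m \<Rightarrow> 'n"
  assumes map_smooth: "smooth_map A B F"
begin

abbreviation "chart_map c c' \<equiv> snd c' \<circ> F \<circ> inv_chart c"

lemma map_carrier: "x \<in> carrier A \<Longrightarrow> F x \<in> carrier B"
  using map_smooth by (auto simp: smooth_map_def)

lemma preimage_open: "open T \<Longrightarrow> open (carrier A \<inter> F -` T)"
  using map_smooth M.open_U by (auto simp: smooth_map_def intro: continuous_open_preimage)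

lemma chart_map_domain:
  assumes "c \<in> A" "open T"
  shows "open (snd c ` (fst c \<inter> F -` T))"
proof -
  have "fst c \<inter> F -` T = fst c \<inter> (carrier A \<inter> F -` T)" using assms by (auto simp: carrier_def)
  then show ?thesis using M.chart_image_open[OF assms(1) preimage_open[OF assms(2)]] by simp
qed

lemma chart_map_smooth: "c \<in> A \<Longrightarrow> c' \<in> B \<Longrightarrow> smooth_on (snd c ` (fst c \<inter> F -` fst c')) (chart_map c c')"
  using map_smooth by (auto simp: smooth_map_def)

lemma map_chain:
  assumes c: "c \<in> A" "c' \<in> B" "x \<in> fst c" "F x \<in> fst c'"
    and g: "g \<circ> inv_chart c' differentiable at (snd c' (F x))"
  shows "frechet_derivative (g \<circ> F \<circ> inv_chart c) (at (snd c x)) v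
    = frechet_derivative (g \<circ> inv_chart c') (at (snd c' (F x)))
       (frechet_derivative (chart_map c c') (at (snd c x)) v)"
proof -
  let ?S = "snd c ` (fst c \<inter> F -` fst c')"
  have S: "open ?S" "snd c x \<in> ?S" using chart_map_domain N.chart_open c by auto
  have e: "chart_map c c' (snd c x) = snd c' (F x)" using c by simp
  have "((\<lambda>y. (g \<circ> inv_chart c') (chart_map c c' y)) has_derivative
    (\<lambda>v. frechet_derivative (g \<circ> inv_chart c') (at (snd c' (F x)))
      (frechet_derivative (chart_map c c') (at (snd c x)) v))) (at (snd c x))"
    using has_derivative_compose[OF smooth_on_has_derivative[OF chart_map_smooth[OF c(1,2)] S(2)]]
      has_derivative_frechet[OF g] e by metis
  then have "((g \<circ> F \<circ> inv_chart c) has_derivative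
    (\<lambda>v. frechet_derivative (g \<circ> inv_chart c') (at (snd c' (F x)))
      (frechet_derivative (chart_map c c') (at (snd c x)) v))) (at (snd c x))"
    by (subst has_derivative_cong_open[OF S]) (use c in auto)
  from fun_cong[OF frechet_derivativeI[OF this]] show ?thesis .
qed

lemma mderiv_comp:
  assumes "x \<in> carrier A"
    and "snd (chart_at C (G (F x))) \<circ> G \<circ> inv_chart (chart_at B (F x)) differentiable at (snd
        (chart_at B (F x)) (F x))"
  shows "mderiv A C (G \<circ> F) x v = mderiv B C G (F x) (mderiv A B F x v)"
  using map_chain[of "chart_at A x" "chart_at B (F x)" x "snd (chart_at C (G (F x))) \<circ> G" v] assms
    M.chart_at_carrier[OF assms(1)] N.chart_at_carrier[OF map_carrier[OF assms(1)]]
  by (simp add: mderiv_def o_assoc)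

text \<open>Both sides are the derivative of F read from c into the chart chosen at F x, factored
  once through a change of chart at the source and once at the target.\<close>

lemma mderiv_chart_frame:
  assumes "c \<in> A" "c' \<in> B" "x \<in> fst c" "F x \<in> fst c'"
  shows "mderiv A B F x (chart_frame A c x v)
    = chart_frame B c' (F x) (frechet_derivative (chart_map c c') (at (snd c x)) v)"
proof -
  let ?a = "chart_at A x" and ?b = "chart_at B (F x)"
  have x: "x \<in> carrier A" using assms by (auto simp: carrier_def)
  note ca = M.chart_at_carrier[OF x] N.chart_at_carrier[OF map_carrier[OF x]]
  have "chart_map ?a ?b differentiable at (snd ?a x)"
    using smooth_on_differentiable[OF chart_map_smooth] ca by auto
  then have "frechet_derivative (chart_map c ?b) (at (snd c x)) v
      = mderiv A B F x (chart_frame A c x v)"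
    unfolding mderiv_def chart_frame_def using assms ca by (intro M.chart_change) auto
  moreover have "frechet_derivative (chart_map c ?b) (at (snd c x)) v
    = chart_frame B c' (F x) (frechet_derivative (chart_map c c') (at (snd c x)) v)"
    unfolding chart_frame_def using assms ca N.transition_differentiable by (intro map_chain) auto
  ultimately show ?thesis by simp
qed

lemma mderiv_linear: "x \<in> carrier A \<Longrightarrow> linear (mderiv A B F x)"
  using smooth_on_differentiable[OF chart_map_smooth] M.chart_at_carrier[of x] N.chart_at_carrier[OF
      map_carrier[of x]]
  unfolding mderiv_def by (intro linear_frechet_derivative) auto

lemma local_expr_pullback:
  assumes "c \<in> A" "c' \<in> B" "y \<in> snd c ` (fst c \<inter> F -` fst c')"
  shows "local_expr A c (pullback A B F \<alpha>) y v
    = local_expr B c' \<alpha> (chart_map c c' y) (frechet_derivative (chart_map c c') (at y) v)"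
proof -
  obtain x where "x \<in> fst c" "F x \<in> fst c'" "y = snd c x" using assms by auto
  then show ?thesis
    using assms mderiv_chart_frame[OF assms(1,2), of x v]
    by (simp add: M.local_expr_eq N.local_expr_eq pullback_def)
qed

text \<open>This is \<open>dloc_pullback\<close> for F in the charts chosen at x and F x, where
  \<open>mderiv\<close> is by definition the derivative of the coordinate expression.\<close>

lemma ext_d_pullback:
  assumes W: "open W" "W \<subseteq> carrier B" "form_in B W \<alpha>" and x: "x \<in> carrier A" "F x \<in> W"
  shows "ext_d A (pullback A B F \<alpha>) x u v = ext_d B \<alpha> (F x) (mderiv A B F x u) (mderiv A B F x v)"
proof -
  interpret W: open_submanifold B W using W N.mfd by unfold_locales
  let ?c = "chart_at A x" and ?c' = "chart_at B (F x)"
  note c = M.chart_at_carrier[OF x(1)] N.chart_at_carrier[OF map_carrier[OF x(1)]]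
  have "dloc (local_expr A ?c (pullback A B F \<alpha>)) (snd ?c x) u v
    = dloc (local_expr B ?c' \<alpha>) (chart_map ?c ?c' (snd ?c x))
       (frechet_derivative (chart_map ?c ?c') (at (snd ?c x)) u) (frechet_derivative (chart_map ?c
           ?c') (at (snd ?c x)) v)"
  proof (rule dloc_pullback)
    let ?S = "snd ?c ` (fst ?c \<inter> F -` (fst ?c' \<inter> W))"
    show "open ?S" by (intro chart_map_domain open_Int N.chart_open W(1)) (use c in auto)
    show "snd ?c x \<in> ?S" using c x by auto
    show "smooth_on ?S (chart_map ?c ?c')"
      by (rule smooth_on_subset[OF chart_map_smooth]) (use c in auto)
    show "chart_map ?c ?c' ` ?S \<subseteq> snd ?c' ` (fst ?c' \<inter> W)" using c by auto
    show "open (snd ?c' ` (fst ?c' \<inter> W))" using c W by (intro N.chart_image_open) auto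
    show "linear (local_expr B ?c' \<alpha> z)" if "z \<in> snd ?c' ` (fst ?c' \<inter> W)" for z
      using W.local_expr_linear[OF W(3)] c that by blast
    show "smooth_on (snd ?c' ` (fst ?c' \<inter> W)) (\<lambda>z. local_expr B ?c' \<alpha> z w)" for w
      using W.form_in_smooth[OF W(3)] c by blast
    show "local_expr A ?c (pullback A B F \<alpha>) y v = local_expr B ?c' \<alpha> (chart_map ?c ?c' y)
       (frechet_derivative (chart_map ?c ?c') (at y) v)" if "y \<in> ?S" for y v
      by (rule local_expr_pullback) (use that c in auto)
  qed
  then show ?thesis using c by (simp add: M.ext_d_dloc N.ext_d_dloc mderiv_def)
qed

lemma smooth_in_map:
  assumes W: "open W" "smooth_in B W u" and V: "V \<subseteq> carrier A" "F ` V \<subseteq> W"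
  shows "smooth_in A V (u \<circ> F)"
  unfolding smooth_in_def
proof
  fix c assume c: "c \<in> A"
  show "smooth_on (snd c ` (fst c \<inter> V)) (u \<circ> F \<circ> inv_chart c)"
  proof (rule smooth_on_local)
    fix y assume "y \<in> snd c ` (fst c \<inter> V)"
    then obtain x where x: "x \<in> fst c" "x \<in> V" "y = snd c x" by auto
    define c' where "c' = chart_at B (F x)"
    have c': "c' \<in> B" "F x \<in> fst c'" using N.chart_at_carrier[OF map_carrier] x V by (auto simp: c'_def)
    let ?T = "snd c ` (fst c \<inter> F -` (fst c' \<inter> W))"
    have T: "open ?T" by (intro chart_map_domain open_Int N.chart_open W(1) c c'(1))
    have "smooth_on ?T (\<lambda>y. (u \<circ> inv_chart c') (chart_map c c' y))"
    proof (rule smooth_on_compose[OF T])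
      show "open (snd c' ` (fst c' \<inter> W))" using c' W by (intro N.chart_image_open) auto
      show "smooth_on (snd c' ` (fst c' \<inter> W)) (u \<circ> inv_chart c')"
        using W(2) c' by (auto simp: smooth_in_def)
      show "smooth_on ?T (chart_map c c')"
        by (rule smooth_on_subset[OF chart_map_smooth[OF c c'(1)]]) auto
    qed (use c c' in auto)
    then have "smooth_on ?T (u \<circ> F \<circ> inv_chart c)"
      by (subst smooth_on_cong[OF T]) (use c c' in auto)
    with T x c' V show "\<exists>T. open T \<and> y \<in> T \<and> smooth_on T (u \<circ> F \<circ> inv_chart c)" by blast
  qed
qed

lemma form_in_pullback:
  assumes W: "open W" "W \<subseteq> carrier B" "form_in B W \<alpha>" and V: "V \<subseteq> carrier A" "F ` V \<subseteq> W"
  shows "form_in A V (pullback A B F \<alpha>)"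
  unfolding form_in_def
proof (intro conjI ballI allI)
  fix x assume x: "x \<in> V"
  then have "linear (\<alpha> (F x) \<circ> mderiv A B F x)"
    using W V by (intro linear_compose mderiv_linear) (auto simp: form_in_def)
  then show "linear (pullback A B F \<alpha> x)" by (simp add: pullback_def o_def)
next
  interpret W: open_submanifold B W using W N.mfd by unfold_locales
  fix c v assume c: "c \<in> A"
  show "smooth_on (snd c ` (fst c \<inter> V)) (\<lambda>y. local_expr A c (pullback A B F \<alpha>) y v)"
  proof (rule smooth_on_local)
    fix y assume "y \<in> snd c ` (fst c \<inter> V)"
    then obtain x where x: "x \<in> fst c" "x \<in> V" "y = snd c x" by auto
    define c' where "c' = chart_at B (F x)"
    have c': "c' \<in> B" "F x \<in> fst c'" using N.chart_at_carrier[OF map_carrier] x V by (auto simp: c'_def)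
    let ?T = "snd c ` (fst c \<inter> F -` (fst c' \<inter> W))"
    let ?D = "\<lambda>y. frechet_derivative (chart_map c c') (at y) v"
    have T: "open ?T" by (intro chart_map_domain open_Int N.chart_open W(1) c c'(1))
    have sm: "smooth_on ?T (chart_map c c')"
      by (rule smooth_on_subset[OF chart_map_smooth[OF c c'(1)]]) auto
    have im: "chart_map c c' ` ?T \<subseteq> snd c' ` (fst c' \<inter> W)" using c by auto
    \<comment> \<open>As for compositions, the moving direction is expanded in \<open>Basis\<close>,
      where \<alpha> is known to be smooth.\<close>
    have "smooth_on ?T (\<lambda>y. \<Sum>i\<in>Basis. (?D y \<bullet> i) *\<^sub>R local_expr B c' \<alpha> (chart_map c c' y) i)"
      using smooth_on_linear[OF bounded_linear_inner_left T smooth_on_frechet[OF sm]]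
        smooth_on_compose[OF T W.chart_image_open[OF c'(1) W(1)] im W.form_in_smooth[OF W(3) c'(1)] sm]
      by (intro smooth_on_sum smooth_on_scaleR T) auto
    moreover have "local_expr A c (pullback A B F \<alpha>) y v
        = (\<Sum>i\<in>Basis. (?D y \<bullet> i) *\<^sub>R local_expr B c' \<alpha> (chart_map c c' y) i)" if "y \<in> ?T" for y
    proof -
      have "chart_map c c' y \<in> snd c' ` (fst c' \<inter> W)" using that im by blast
      note lin = W.local_expr_linear[OF W(3) c'(1) this]
      have y: "y \<in> snd c ` (fst c \<inter> F -` fst c')" using that by auto
      show ?thesis unfolding local_expr_pullback[OF c c'(1) y] by (rule linear_euclidean_sum[OF lin])
    qed
    ultimately have "smooth_on ?T (\<lambda>y. local_expr A c (pullback A B F \<alpha>) y v)"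
      by (subst smooth_on_cong[OF T]) auto
    with T x c' V show "\<exists>T. open T \<and> y \<in> T
        \<and> smooth_on T (\<lambda>y. local_expr A c (pullback A B F \<alpha>) y v)" by blast
  qed
qed

end

section \<open>Coframes on 3-manifolds\<close>

text \<open>Let X be the difference of the two sides. Of the three 2-forms, wedging with l keeps
  only m \<and> n, with n only m \<and> l, and with m only n \<and> l, each time leaving a multiple
  of l \<and> m \<and> n.\<close>

lemma wedge_coeffs_unique:
  assumes W: "wedge3 l m n u v w \<noteq> 0"
    and eq: "\<And>u v. a * (m \<and>\<^sub>1 n) u v + b * (m \<and>\<^sub>1 l) u v + c * (n \<and>\<^sub>1 l) u v
      = a' * (m \<and>\<^sub>1 n) u v + b' * (m \<and>\<^sub>1 l) u v + c' * (n \<and>\<^sub>1 l) u v"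
  shows "a = a'" "b = b'" "c = c'"
proof -
  have 1: "(a - a') * (m \<and>\<^sub>1 n) u v + (b - b') * (m \<and>\<^sub>1 l) u v + (c - c') * (n \<and>\<^sub>1 l) u v = 0" for u v
    using eq[of u v] by (simp add: algebra_simps)
  define X where "X = (\<lambda>u v. (a - a') * (m \<and>\<^sub>1 n) u v + (b - b') * (m \<and>\<^sub>1 l) u v + (c - c')
      * (n \<and>\<^sub>1 l) u v)"
  have X: "X u v = 0" for u v using 1 by (simp add: X_def)
  have "(a - a') * wedge3 l m n u v w = l u * X v w - l v * X u w + l w * X u v"
    by (simp add: X_def wedge3_def wedge_def algebra_simps)
  then show "a = a'" using X W by simp
  have "(b - b') * wedge3 l m n u v w = - (n u * X v w - n v * X u w + n w * X u v)"
    by (simp add: X_def wedge3_def wedge_def algebra_simps)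
  then show "b = b'" using X W by simp
  have "(c - c') * wedge3 l m n u v w = (m u * X v w - m v * X u w + m w * X u v)"
    by (simp add: X_def wedge3_def wedge_def algebra_simps)
  then show "c = c'" using X W by simp
qed

abbreviation e1 :: "real^3" where "e1 \<equiv> axis 1 1"
abbreviation e2 :: "real^3" where "e2 \<equiv> axis 2 1"
abbreviation e3 :: "real^3" where "e3 \<equiv> axis 3 1"

lemma linear_real3:
  fixes a :: "real^3 \<Rightarrow> complex"
  assumes "linear a"
  shows "a v = of_real (v$1) * a e1 + of_real (v$2) * a e2 + of_real (v$3) * a e3"
proof -
  have "v = (v$1) *\<^sub>R e1 + (v$2) *\<^sub>R e2 + (v$3) *\<^sub>R e3"
    by (simp add: vec_eq_iff forall_3 axis_def)
  then have "a v = a ((v$1) *\<^sub>R e1 + (v$2) *\<^sub>R e2 + (v$3) *\<^sub>R e3)" by simp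
  also have "\<dots> = (v$1) *\<^sub>R a e1 + (v$2) *\<^sub>R a e2 + (v$3) *\<^sub>R a e3"
    using assms by (simp add: linear_add linear_cmul)
  finally show ?thesis by (simp only: scaleR_conv_of_real)
qed

text \<open>Cramer's rule in the complexified dual of R^3, with \<open>wedge3\<close> on the
  standard basis as the determinant.\<close>

lemma cramer_real3:
  fixes a b c \<phi> :: "real^3 \<Rightarrow> complex"
  assumes "linear a" "linear b" "linear c" "linear \<phi>"
  shows "\<phi> v * wedge3 a b c e1 e2 e3
    = wedge3 \<phi> b c e1 e2 e3 * a v + wedge3 a \<phi> c e1 e2 e3 * b v + wedge3 a b \<phi> e1 e2 e3 * c v"
  unfolding linear_real3[OF assms(1), of v] linear_real3[OF assms(2), of v]
    linear_real3[OF assms(3), of v] linear_real3[OF assms(4), of v] wedge3_def wedge_def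
  by algebra

text \<open>On R^3 the value at u, v, w is det (u, v, w) times the value on the standard basis. A
  coframe is only known to be nonzero at some triple, while the quotients in
  \<open>frame_expand\<close> and \<open>smooth_in_D\<close> use the fixed one.\<close>

lemma wedge3_real3:
  fixes a b c :: "real^3 \<Rightarrow> complex"
  assumes "linear a" "linear b" "linear c" "wedge3 a b c u v w \<noteq> 0"
  shows "wedge3 a b c e1 e2 e3 \<noteq> 0"
proof
  assume 0: "wedge3 a b c e1 e2 e3 = 0"
  have "wedge3 a b c u v w = wedge3 a b c e1 e2 e3 *
    (of_real (u$1) * (of_real (v$2) * of_real (w$3) - of_real (v$3) * of_real (w$2))
     - of_real (u$2) * (of_real (v$1) * of_real (w$3) - of_real (v$3) * of_real (w$1))
     + of_real (u$3) * (of_real (v$1) * of_real (w$2) - of_real (v$2) * of_real (w$1)))"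
    unfolding wedge3_def wedge_def linear_real3[OF assms(1), of u] linear_real3[OF assms(1), of v]
        linear_real3[OF assms(1), of w]
      linear_real3[OF assms(2), of u] linear_real3[OF assms(2), of v] linear_real3[OF assms(2), of w]
      linear_real3[OF assms(3), of u] linear_real3[OF assms(3), of v] linear_real3[OF assms(3), of w]
    by algebra
  with 0 assms show False by simp
qed

lemma wedge3_combination:
  assumes "\<And>v. \<phi> v = c1 * a v + c2 * b v + c3 * c v"
  shows "wedge3 \<phi> b c u v w = c1 * wedge3 a b c u v w"
    "wedge3 a \<phi> c u v w = c2 * wedge3 a b c u v w"
    "wedge3 a b \<phi> u v w = c3 * wedge3 a b c u v w"
  by (simp_all add: assms wedge3_def wedge_def algebra_simps)

context open_submanifold
begin

lemma form_in_of_smooth_form1: "smooth_form1 A \<alpha> \<Longrightarrow> form_in A U \<alpha>"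
  using U_sub unfolding form_in_def smooth_form1_def by (blast intro: smooth_on_subset)

lemma smooth_in_of_smooth_fun: "smooth_fun A u \<Longrightarrow> smooth_in A U u"
  unfolding smooth_in_def smooth_fun_def by (blast intro: smooth_on_subset)

lemma chart_inj: "c \<in> A \<Longrightarrow> inj_on (snd c) (fst c)"
  using chart_inv by (metis inj_onI)

text \<open>\<open>inv_chart\<close> is an \<open>inv_into\<close> over the chart domain and may
  change when the domain is cut down; injectivity of the chart makes old and new agree on the
  smaller image.\<close>

lemma inv_chart_restrict:
  "c \<in> A \<Longrightarrow> y \<in> snd c ` (fst c \<inter> U) \<Longrightarrow> inv_chart (fst c \<inter> U, snd c) y = inv_chart c y"
  using inv_into_f_eq[OF inj_on_subset[OF chart_inj[of c]], of "fst c \<inter> U"]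
  by (force simp: inv_chart_def[of "(fst c \<inter> U, snd c)"])

lemma smooth_fun_restrict: "smooth_fun (restrict_atlas U A) u \<longleftrightarrow> smooth_in A U u"
  unfolding smooth_fun_def smooth_in_def restrict_atlas_def
  by (simp, intro ball_cong refl smooth_on_cong chart_image_open open_U) (simp_all add:
      inv_chart_restrict)

text \<open>The change of charts from \<open>chart_at A x\<close> to c supplies the
  preimage.\<close>

lemma chart_frame_surj:
  assumes "c \<in> A" "x \<in> fst c"
  obtains u where "chart_frame A c x u = v"
proof -
  have x: "x \<in> carrier A" using assms by (auto simp: carrier_def)
  show ?thesis
    using that chart_frame_change[of "chart_at A x" c x v] assms chart_at_carrier[OF x]
        chart_frame_self[OF x] by metis
qed

end

section \<open>Derivatives of functions along a coframe\<close>

locale coframe_on = open_submanifold A U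
  for A :: "('m::{t2_space,second_countable_topology}, real^3) chart set" and U +
  fixes R :: "'m rep"
  assumes coframe: "coframe A (lam R, mu R)"
begin

lemma lam_form: "form_in A U (lam R)" and mu_form: "form_in A U (mu R)"
  using coframe by (auto simp: coframe_def intro: form_in_of_smooth_form1)

lemma lam_real: "x \<in> carrier A \<Longrightarrow> cnj (lam R x v) = lam R x v"
  using coframe by (auto simp: coframe_def real_form1_def Reals_cnj_iff)

lemma frame_nonzero:
  assumes "x \<in> carrier A" obtains u v w where "wedge3 (lam R x) (mu R x) (cnj_form (mu R) x) u v w \<noteq> 0"
  using coframe assms by (auto simp: coframe_def)

lemma frame_coeffs_unique:
  assumes x: "x \<in> carrier A"
    and "\<And>v. c1 * lam R x v + c2 * mu R x v + c3 * cnj (mu R x v) = j1 * lam R x v + j2 * mu R x v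
        + j3 * cnj (mu R x v)"
  shows "c1 = j1 \<and> c2 = j2 \<and> c3 = j3"
proof -
  obtain u v w where W: "wedge3 (lam R x) (mu R x) (cnj_form (mu R) x) u v w \<noteq> 0"
    using frame_nonzero x by blast
  define \<phi> where "\<phi> = (\<lambda>v. c1 * lam R x v + c2 * mu R x v + c3 * cnj (mu R x v))"
  have \<phi>: "\<phi> v = c1 * lam R x v + c2 * mu R x v + c3 * cnj_form (mu R) x v"
    "\<phi> v = j1 * lam R x v + j2 * mu R x v + j3 * cnj_form (mu R) x v" for v
    using assms(2) by (simp_all add: \<phi>_def cnj_form_def)
  show ?thesis
    using wedge3_combination[of \<phi>, OF \<phi>(1), of u v w] wedge3_combination[of \<phi>, OF \<phi>(2), of u v w] W
        by auto
qed

text \<open>Coframe derivatives are descriptions by \<open>THE\<close>; with this rule they are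
  computed by writing du in the coframe and comparing coefficients.\<close>

lemma frame_coeffsI:
  assumes "x \<in> carrier A" "\<And>v. d_fun A u x v = c1 * lam R x v + c2 * mu R x v + c3 * cnj (mu R x v)"
  shows "D_lam A R u x = c1" "D_mu A R u x = c2" "D_mub A R u x = c3"
proof -
  have "frame_coeffs A R u x = (c1, c2, c3)"
    unfolding frame_coeffs_def
  proof (rule the_equality)
    show "case (c1, c2, c3) of (c1, c2, c3) \<Rightarrow> \<forall>v. d_fun A u x v = c1 * lam R x v + c2 * mu R x v
        + c3 * cnj (mu R x v)"
      using assms by simp
    fix k assume "case k of (c1, c2, c3) \<Rightarrow> \<forall>v. d_fun A u x v = c1 * lam R x v + c2 * mu R x v + c3
        * cnj (mu R x v)"
    moreover obtain j1 j2 j3 where k: "k = (j1, j2, j3)" by (cases k)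
    ultimately have "d_fun A u x v = j1 * lam R x v + j2 * mu R x v + j3 * cnj (mu R x v)" for v
      by simp
    then have "j1 * lam R x v + j2 * mu R x v + j3 * cnj (mu R x v)
        = c1 * lam R x v + c2 * mu R x v + c3 * cnj (mu R x v)" for v
      by (metis assms(2))
    from frame_coeffs_unique[OF assms(1) this] show "k = (c1, c2, c3)" by (simp add: k)
  qed
  then show "D_lam A R u x = c1" "D_mu A R u x = c2" "D_mub A R u x = c3"
    by (simp_all add: D_lam_def D_mu_def D_mub_def)
qed

lemma frame_vol:
  assumes "x \<in> U" shows "wedge3 (lam R x) (mu R x) (cnj_form (mu R) x) e1 e2 e3 \<noteq> 0"
proof -
  obtain u v w where "wedge3 (lam R x) (mu R x) (cnj_form (mu R) x) u v w \<noteq> 0"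
    using frame_nonzero assms U_sub by blast
  then show ?thesis
    using wedge3_real3 form_in_linear lam_form mu_form form_in_cnj[OF mu_form] assms by blast
qed

text \<open>Cramer's rule provides the coefficients whose existence the \<open>THE\<close> in
  \<open>frame_coeffs\<close> presupposes.\<close>

lemma frame_expand:
  assumes "smooth_in A U u" "x \<in> U"
  shows "d_fun A u x v = D_lam A R u x * lam R x v + D_mu A R u x * mu R x v + D_mub A R u x
      * cnj (mu R x v)"
proof -
  let ?l = "lam R x" and ?m = "mu R x" and ?n = "cnj_form (mu R) x" and ?d = "d_fun A u x"
  let ?W = "\<lambda>a b c. wedge3 a b c e1 e2 e3"
  have lin: "linear ?l" "linear ?m" "linear ?n" "linear ?d"
    using form_in_linear[OF _ assms(2)] lam_form mu_form form_in_cnj[OF mu_form]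
        d_fun_linear[OF assms] by blast+
  have E: "?d v = (?W ?d ?m ?n / ?W ?l ?m ?n) * ?l v + (?W ?l ?d ?n / ?W ?l ?m ?n) * ?m v
      + (?W ?l ?m ?d / ?W ?l ?m ?n) * cnj (?m v)" for v
    using cramer_real3[OF lin, of v] frame_vol[OF assms(2)] by (simp add: field_simps cnj_form_def)
  have "x \<in> carrier A" using assms U_sub by auto
  from frame_coeffsI[OF this E] E show ?thesis by simp
qed

text \<open>In a fixed chart each coefficient is a quotient of two determinants of local
  expressions, hence smooth. The iterated coframe derivatives of \<psi> in k0 and k1 depend on
  this.\<close>

lemma smooth_in_D:
  assumes u: "smooth_in A U u"
  shows "smooth_in A U (D_lam A R u)" "smooth_in A U (D_mu A R u)" "smooth_in A U (D_mub A R u)"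
proof -
  define L where "L = (\<lambda>c \<alpha> y. local_expr A c \<alpha> y)"
  let ?l = "lam R" and ?m = "mu R" and ?n = "cnj_form (mu R)" and ?d = "d_fun A u"
  define W where "W = (\<lambda>c a b d y. wedge3 (L c a y) (L c b y) (L c d y) e1 e2 e3)"
  have forms: "form_in A U ?l" "form_in A U ?m" "form_in A U ?n" "form_in A U ?d"
    using lam_form mu_form form_in_cnj form_in_d_fun[OF u] by auto
  have Wsm: "smooth_on (snd c ` (fst c \<inter> U)) (W c a b d)"
    if "c \<in> A" "form_in A U a" "form_in A U b" "form_in A U d" for c a b d
    unfolding W_def L_def wedge3_def wedge_def
    using form_in_smooth that chart_image_open[OF that(1) open_U]
    by (intro smooth_on_add smooth_on_diff smooth_on_mult) auto
  have eq: "D_lam A R u (inv_chart c y) = W c ?d ?m ?n y / W c ?l ?m ?n y"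
    "D_mu A R u (inv_chart c y) = W c ?l ?d ?n y / W c ?l ?m ?n y"
    "D_mub A R u (inv_chart c y) = W c ?l ?m ?d y / W c ?l ?m ?n y"
    and W0: "W c ?l ?m ?n y \<noteq> 0"
    if c: "c \<in> A" and y: "y \<in> snd c ` (fst c \<inter> U)" for c y
  proof -
    obtain x where x: "x \<in> fst c" "x \<in> U" "y = snd c x" using y by auto
    have Leq: "L c \<alpha> y v = \<alpha> x (chart_frame A c x v)" for \<alpha> v
      using x c by (simp add: L_def local_expr_eq)
    obtain u1 u2 u3 where "wedge3 (?l x) (?m x) (?n x) u1 u2 u3 \<noteq> 0" using frame_nonzero x U_sub
        by blast
    \<comment> \<open>The coframe condition concerns vectors in the model of
      \<open>chart_at A x\<close>; surjectivity of \<open>chart_frame\<close> carries it to the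
      chart c.\<close>
    moreover obtain v1 v2 v3 where "chart_frame A c x v1 = u1" "chart_frame A c x v2 = u2"
        "chart_frame A c x v3 = u3"
      using chart_frame_surj[OF c x(1)] by metis
    ultimately have "wedge3 (L c ?l y) (L c ?m y) (L c ?n y) v1 v2 v3 \<noteq> 0"
      by (simp add: Leq wedge3_def wedge_def)
    then show 0: "W c ?l ?m ?n y \<noteq> 0"
      unfolding W_def using wedge3_real3 local_expr_linear[OF _ c y] forms unfolding L_def by blast
    have "L c ?d y v = D_lam A R u x * L c ?l y v + D_mu A R u x * L c ?m y v + D_mub A R u x
        * L c ?n y v" for v
      by (simp add: Leq frame_expand[OF u x(2)] cnj_form_def)
    from wedge3_combination[where \<phi> = "L c ?d y", OF this]
    show "D_lam A R u (inv_chart c y) = W c ?d ?m ?n y / W c ?l ?m ?n y"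
      "D_mu A R u (inv_chart c y) = W c ?l ?d ?n y / W c ?l ?m ?n y"
      "D_mub A R u (inv_chart c y) = W c ?l ?m ?d y / W c ?l ?m ?n y"
      using 0 x c by (simp_all add: W_def)
  qed
  have "smooth_on (snd c ` (fst c \<inter> U)) (D_lam A R u \<circ> inv_chart c)"
    "smooth_on (snd c ` (fst c \<inter> U)) (D_mu A R u \<circ> inv_chart c)"
    "smooth_on (snd c ` (fst c \<inter> U)) (D_mub A R u \<circ> inv_chart c)" if c: "c \<in> A" for c
  proof -
    note S = chart_image_open[OF c open_U]
    have "smooth_on (snd c ` (fst c \<inter> U)) (\<lambda>y. W c ?d ?m ?n y / W c ?l ?m ?n y)"
      "smooth_on (snd c ` (fst c \<inter> U)) (\<lambda>y. W c ?l ?d ?n y / W c ?l ?m ?n y)"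
      "smooth_on (snd c ` (fst c \<inter> U)) (\<lambda>y. W c ?l ?m ?d y / W c ?l ?m ?n y)"
      using Wsm[OF c] W0[OF c] forms by (auto intro!: smooth_on_divide S)
    then show "smooth_on (snd c ` (fst c \<inter> U)) (D_lam A R u \<circ> inv_chart c)"
      "smooth_on (snd c ` (fst c \<inter> U)) (D_mu A R u \<circ> inv_chart c)"
      "smooth_on (snd c ` (fst c \<inter> U)) (D_mub A R u \<circ> inv_chart c)"
      by (simp_all add: smooth_on_cong[OF S, of "D_lam A R u \<circ> inv_chart c"] smooth_on_cong[OF S, of
          "D_mu A R u \<circ> inv_chart c"]
          smooth_on_cong[OF S, of "D_mub A R u \<circ> inv_chart c"] eq[OF c])
  qed
  then show "smooth_in A U (D_lam A R u)" "smooth_in A U (D_mu A R u)" "smooth_in A U (D_mub A R u)"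
    by (auto simp: smooth_in_def)
qed

lemma D_cong:
  assumes "\<And>x. x \<in> U \<Longrightarrow> u x = w x" "x \<in> U"
  shows "D_lam A R u x = D_lam A R w x" "D_mu A R u x = D_mu A R w x" "D_mub A R u x = D_mub A R w x"
  using d_fun_cong[OF assms] by (simp_all add: D_lam_def D_mu_def D_mub_def frame_coeffs_def)

text \<open>Conjugation fixes \<lambda> and exchanges \<mu> with its conjugate, so it exchanges the
  last two coefficients.\<close>

lemma D_cnj:
  assumes "smooth_in A U u" "x \<in> U"
  shows "D_lam A R (\<lambda>x. cnj (u x)) x = cnj (D_lam A R u x)"
    "D_mu A R (\<lambda>x. cnj (u x)) x = cnj (D_mub A R u x)"
    "D_mub A R (\<lambda>x. cnj (u x)) x = cnj (D_mu A R u x)"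
proof -
  have x: "x \<in> carrier A" using assms U_sub by auto
  have "d_fun A (\<lambda>x. cnj (u x)) x v = cnj (D_lam A R u x) * lam R x v + cnj (D_mub A R u x) * mu R x v
      + cnj (D_mu A R u x) * cnj (mu R x v)" for v
    using x by (simp add: d_fun_cnj[OF assms] frame_expand[OF assms] lam_real)
  from frame_coeffsI[OF x this] show "D_lam A R (\<lambda>x. cnj (u x)) x = cnj (D_lam A R u x)"
    "D_mu A R (\<lambda>x. cnj (u x)) x = cnj (D_mub A R u x)"
    "D_mub A R (\<lambda>x. cnj (u x)) x = cnj (D_mu A R u x)" by auto
qed

lemma D_real:
  assumes "smooth_in A U (\<lambda>x. complex_of_real (u x))" "x \<in> U"
  shows "cnj (D_lam A R (cpx u) x) = D_lam A R (cpx u) x"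
    "D_mub A R (cpx u) x = cnj (D_mu A R (cpx u) x)"
  using D_cnj[OF assms] by simp_all

end

section \<open>Structure equations on the base\<close>

lemma cis_mult_cnj: "cis a * cnj (cis a) = 1"
  by (simp add: cis_cnj cis_mult)

lemma cis_nat_pi:
  fixes \<epsilon> :: nat
  shows "cnj (cis (real \<epsilon> * pi)) = cis (real \<epsilon> * pi)"
    and "cis (real \<epsilon> * pi) * cis (real \<epsilon> * pi) = 1"
proof -
  show 1: "cnj (cis (real \<epsilon> * pi)) = cis (real \<epsilon> * pi)" by (simp add: complex_eq_iff sin_npi)
  show "cis (real \<epsilon> * pi) * cis (real \<epsilon> * pi) = 1" using cis_mult_cnj[of "real \<epsilon> * pi"]
      by (simp only: 1)
qed

lemma cis_half: "cis a = cis (a / 2) * cis (a / 2)"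
  by (simp only: cis_mult field_sum_of_halves)

text \<open>The forms of the theorem at \<open>\<rho> = 1\<close>, as forms on \<open>M\<close>: the forms on \<open>P\<close> are the pullbacks of
  \<open>red_omega\<close>, of \<open>\<rho>\<close> times \<open>red_omega1\<close>, and of \<open>red_Omega\<close> with \<open>d log \<rho>\<close> added.\<close>

definition red_omega :: "'m rep \<Rightarrow> nat \<Rightarrow> 'm form3" where
  "red_omega R \<epsilon> = (\<lambda>x v. (cis (real \<epsilon> * pi) * sh_abs R x) * lam R x v)"

definition red_omega1 :: "'m rep \<Rightarrow> ('m \<Rightarrow> real) \<Rightarrow> nat \<Rightarrow> 'm form3" where
  "red_omega1 R \<psi> \<epsilon> = (\<lambda>x v. cis (- (\<psi> x - real \<epsilon> * pi) / 2) * mu R x v)"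

text \<open>Forced by the \<mu> \<and> \<mu>bar component of the equation for d\<nu>: with \<nu> = c
  \<mu> and dc = - (i/2) c d\<psi> it reads p + (i/2) \<psi>' = - cnj N, where \<psi>' is the
  \<mu>bar derivative of \<psi>.\<close>

definition red_N :: "'m atlas3 \<Rightarrow> 'm rep \<Rightarrow> ('m \<Rightarrow> real) \<Rightarrow> 'm \<Rightarrow> complex" where
  "red_N A R \<psi> = (\<lambda>x. \<i> / 2 * D_mu A R (cpx \<psi>) x - cnj (cp R x))"

text \<open>With e the sign of \<omega>, the \<mu> \<and> \<lambda> component of the equation for
  d\<nu> is q + (i/2) \<open>D_lam\<close> \<psi> = - C + e |s| + i T0 e |s|. Its real part gives C,
  its imaginary part the formula for \<open>T0\<close>.\<close>

definition red_C :: "'m rep \<Rightarrow> nat \<Rightarrow> 'm \<Rightarrow> complex" where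
  "red_C R \<epsilon> = (\<lambda>x. cis (real \<epsilon> * pi) * sh_abs R x - 1 / 2 * (cq R x + cnj (cq R x)))"

definition red_Omega :: "'m atlas3 \<Rightarrow> 'm rep \<Rightarrow> ('m \<Rightarrow> real) \<Rightarrow> nat \<Rightarrow> 'm form3" where
  "red_Omega A R \<psi> \<epsilon> = (\<lambda>x v. red_N A R \<psi> x * mu R x v + cnj (red_N A R \<psi> x) * cnj_form (mu R) x v
     + red_C R \<epsilon> x * lam R x v)"

locale shear_congruence = coframe_on A U R
  for A :: "('m::{t2_space,second_countable_topology}, real^3) chart set" and U and R :: "'m rep" +
  fixes \<psi> :: "'m \<Rightarrow> real" and \<epsilon> :: nat
  assumes sf: "structure_functions A R"
    and no_twist: "\<And>x. x \<in> U \<Longrightarrow> tw R x = 0"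
    and shear: "\<And>x. x \<in> U \<Longrightarrow> sh R x \<noteq> 0"
    and branch: "arg_branch A U (sh R) \<psi>"
begin

abbreviation "sg \<equiv> cis (real \<epsilon> * pi)"
abbreviation "sg2 \<equiv> cis (real \<epsilon> * pi / 2)"
abbreviation "ph x \<equiv> cis (- (\<psi> x - real \<epsilon> * pi) / 2)"

lemma psi_smooth: "smooth_in A U \<psi>"
  using branch smooth_fun_restrict by (auto simp: arg_branch_def)

lemma cpsi_smooth: "smooth_in A U (cpx \<psi>)"
  by (rule smooth_in_of_real[OF psi_smooth])

lemma sh_polar: "x \<in> U \<Longrightarrow> sh R x = sh_abs R x * cis (\<psi> x)"
  using branch by (auto simp: arg_branch_def)

lemma coeffs_smooth:
  "smooth_in A U (cb R)" "smooth_in A U (cp R)" "smooth_in A U (cq R)" "smooth_in A U (sh R)"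
  using sf by (auto simp: structure_functions_def intro: smooth_in_of_smooth_fun)

lemma sh_abs_smooth: "smooth_in A U (sh_abs R)"
  by (intro smooth_in_of_real smooth_in_cmod coeffs_smooth shear)

lemma cnj_mu_form: "form_in A U (cnj_form (mu R))"
  by (rule form_in_cnj[OF mu_form])

lemma ext_d_lam:
  "x \<in> U \<Longrightarrow> ext_d A (lam R) x u v = cb R x * (mu R x \<and>\<^sub>1 lam R x) u v
     + cnj (cb R x) * (cnj_form (mu R) x \<and>\<^sub>1 lam R x) u v"
  and ext_d_mu:
  "x \<in> U \<Longrightarrow> ext_d A (mu R) x u v = cp R x * (mu R x \<and>\<^sub>1 cnj_form (mu R) x) u v
     + cq R x * (mu R x \<and>\<^sub>1 lam R x) u v + sh R x * (cnj_form (mu R) x \<and>\<^sub>1 lam R x) u v"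
  using sf U_sub no_twist by (auto simp: structure_functions_def Let_def)

text \<open>The only integrability condition that is needed: the component of \<open>d (d \<mu>) = 0\<close>, by which
  \<open>p\<^sub>\<lambda>\<close> is eliminated from the \<open>\<mu> \<and> \<lambda>\<close> component of \<open>d red_Omega\<close>.\<close>

lemma D_lam_cp:
  assumes x: "x \<in> U"
  shows "D_lam A R (cp R) x = cp R x * cnj (cq R x) + D_mub A R (cq R) x + cq R x * cnj (cb R x)
    - D_mu A R (sh R) x - sh R x * (cb R x - cnj (cp R x))"
proof -
  have xc: "x \<in> carrier A" using x U_sub by auto
  obtain u v w where W: "wedge3 (lam R x) (mu R x) (cnj_form (mu R) x) u v w \<noteq> 0"
    using frame_nonzero[OF xc] by blast
  let ?E = "cp R x * cnj (cq R x) + D_mub A R (cq R) x + cq R x * cnj (cb R x)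
    - D_mu A R (sh R) x - sh R x * (cb R x - cnj (cp R x))"
  let ?dm = "ext_d A (mu R) x" and ?dl = "ext_d A (lam R) x"
  have eq: "\<forall>x\<in>U. \<forall>u v. ext_d A (mu R) x u v = cp R x * (mu R x \<and>\<^sub>1 cnj_form (mu R) x) u v
     + cq R x * (mu R x \<and>\<^sub>1 lam R x) u v + sh R x * (cnj_form (mu R) x \<and>\<^sub>1 lam R x) u v"
    using ext_d_mu by blast
  note closed = ext_d_closed[OF mu_form coeffs_smooth(2,3,4) mu_form mu_form cnj_mu_form cnj_mu_form
      lam_form lam_form
      eq x refl, of u v w]
  \<comment> \<open>All terms of d (d \<mu>) on u, v, w are multiples of \<lambda> \<and> \<mu>
    \<and> \<mu>bar; the first factor is their total coefficient up to sign.\<close>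
  have "(D_lam A R (cp R) x - ?E) * wedge3 (lam R x) (mu R x) (cnj_form (mu R) x) u v w = 0"
    using closed
    unfolding ext_d_cnj[OF mu_form x] ext_d_lam[OF x] ext_d_mu[OF x]
    unfolding wedge3_def wedge_def cnj_form_def
      frame_expand[OF coeffs_smooth(2) x] frame_expand[OF coeffs_smooth(3) x]
          frame_expand[OF coeffs_smooth(4) x]
      complex_cnj_add complex_cnj_mult complex_cnj_diff complex_cnj_cnj lam_real[OF xc]
    by algebra
  then show ?thesis using W by simp
qed

text \<open>The polar form of s is differentiated. This rewrites the derivative of s in
  \<open>D_lam_cp\<close> through |s| and \<psi>, the quantities that occur in t1 and k1.\<close>

lemma D_mu_sh:
  assumes x: "x \<in> U"
  shows "D_mu A R (sh R) x = D_mu A R (sh_abs R) x * cis (\<psi> x) + \<i> * sh R x * D_mu A R (cpx \<psi>) x"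
proof -
  have xc: "x \<in> carrier A" using x U_sub by auto
  have "d_fun A (sh R) x v = d_fun A (\<lambda>x. sh_abs R x * cis (\<psi> x)) x v" for v
    by (rule fun_cong[OF d_fun_cong[OF sh_polar x]])
  then have "d_fun A (sh R) x v
    = (sh_abs R x * (\<i> * cis (\<psi> x) * D_lam A R (cpx \<psi>) x) + D_lam A R (sh_abs R) x * cis (\<psi> x))
        * lam R x v
    + (D_mu A R (sh_abs R) x * cis (\<psi> x) + \<i> * (sh_abs R x * cis (\<psi> x)) * D_mu A R (cpx \<psi>) x) * mu R x v
    + (sh_abs R x * (\<i> * cis (\<psi> x) * D_mub A R (cpx \<psi>) x) + D_mub A R (sh_abs R) x * cis (\<psi> x))
        * cnj (mu R x v)" for v
    unfolding d_fun_mult[OF sh_abs_smooth smooth_in_cis[OF psi_smooth] x] d_fun_cis[OF psi_smooth x]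
      frame_expand[OF sh_abs_smooth x] frame_expand[OF cpsi_smooth x]
    by (simp add: algebra_simps)
  from frame_coeffsI(2)[OF xc this] show ?thesis by (simp only: sh_polar[OF x, symmetric])
qed

lemma N_smooth: "smooth_in A U (red_N A R \<psi>)"
  unfolding red_N_def
  by (intro smooth_in_diff smooth_in_mult smooth_in_const smooth_in_cnj smooth_in_D cpsi_smooth
      coeffs_smooth)

lemma C_smooth: "smooth_in A U (red_C R \<epsilon>)"
  unfolding red_C_def
  by (intro smooth_in_diff smooth_in_add smooth_in_mult smooth_in_const smooth_in_cnj sh_abs_smooth
      coeffs_smooth)

lemma C_real: "cnj (red_C R \<epsilon> x) = red_C R \<epsilon> x"
  by (simp add: red_C_def cis_nat_pi add.commute)

text \<open>The \<mu> coefficient of dN is left out, since it meets \<mu> \<and> \<mu> in d (N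
  \<mu>).\<close>

lemma D_N:
  assumes x: "x \<in> U"
  shows "D_lam A R (red_N A R \<psi>) x = \<i> / 2 * D_lam A R (D_mu A R (cpx \<psi>)) x - cnj (D_lam A R (cp R) x)"
    "D_mub A R (red_N A R \<psi>) x = \<i> / 2 * D_mub A R (D_mu A R (cpx \<psi>)) x - cnj (D_mu A R (cp R) x)"
proof -
  have xc: "x \<in> carrier A" using x U_sub by auto
  note P = smooth_in_D(2)[OF cpsi_smooth]
  have "d_fun A (red_N A R \<psi>) x v
    = (\<i> / 2 * D_lam A R (D_mu A R (cpx \<psi>)) x - cnj (D_lam A R (cp R) x)) * lam R x v
    + (\<i> / 2 * D_mu A R (D_mu A R (cpx \<psi>)) x - cnj (D_mub A R (cp R) x)) * mu R x v
    + (\<i> / 2 * D_mub A R (D_mu A R (cpx \<psi>)) x - cnj (D_mu A R (cp R) x)) * cnj (mu R x v)" for v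
    unfolding red_N_def
      d_fun_diff[OF smooth_in_mult[OF smooth_in_const P] smooth_in_cnj[OF coeffs_smooth(2)] x]
      d_fun_cmult[OF P x] d_fun_cnj[OF coeffs_smooth(2) x] frame_expand[OF P x]
          frame_expand[OF coeffs_smooth(2) x]
    by (simp add: lam_real[OF xc] algebra_simps)
  from frame_coeffsI[OF xc this] show
    "D_lam A R (red_N A R \<psi>) x = \<i> / 2 * D_lam A R (D_mu A R (cpx \<psi>)) x - cnj (D_lam A R (cp R) x)"
    "D_mub A R (red_N A R \<psi>) x = \<i> / 2 * D_mub A R (D_mu A R (cpx \<psi>)) x - cnj (D_mu A R (cp R) x)"
        by auto
qed

lemma D_C:
  assumes x: "x \<in> U"
  shows "D_mu A R (red_C R \<epsilon>) x = sg * D_mu A R (sh_abs R) x - 1 / 2 * (D_mu A R (cq R) x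
      + D_mu A R (\<lambda>y. cnj (cq R y)) x)"
    "D_mub A R (red_C R \<epsilon>) x = cnj (D_mu A R (red_C R \<epsilon>) x)"
proof -
  have xc: "x \<in> carrier A" using x U_sub by auto
  note q = coeffs_smooth(3) note qc = smooth_in_cnj[OF q]
  have "d_fun A (red_C R \<epsilon>) x v
    = (sg * D_lam A R (sh_abs R) x - 1 / 2 * (D_lam A R (cq R) x + D_lam A R (\<lambda>y. cnj (cq R y)) x))
        * lam R x v
    + (sg * D_mu A R (sh_abs R) x - 1 / 2 * (D_mu A R (cq R) x + D_mu A R (\<lambda>y. cnj (cq R y)) x))
        * mu R x v
    + (sg * D_mub A R (sh_abs R) x - 1 / 2 * (D_mub A R (cq R) x + D_mub A R (\<lambda>y. cnj (cq R y)) x))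
        * cnj (mu R x v)" for v
    unfolding red_C_def
      d_fun_diff[OF smooth_in_mult[OF smooth_in_const sh_abs_smooth]
          smooth_in_mult[OF smooth_in_const smooth_in_add[OF q qc]] x]
      d_fun_cmult[OF sh_abs_smooth x] d_fun_cmult[OF smooth_in_add[OF q qc] x] d_fun_add[OF q qc x]
      frame_expand[OF sh_abs_smooth x] frame_expand[OF q x] frame_expand[OF qc x]
    by (simp add: algebra_simps)
  from frame_coeffsI(2)[OF xc this] show
    "D_mu A R (red_C R \<epsilon>) x = sg * D_mu A R (sh_abs R) x - 1 / 2 * (D_mu A R (cq R) x
        + D_mu A R (\<lambda>y. cnj (cq R y)) x)" .
  show "D_mub A R (red_C R \<epsilon>) x = cnj (D_mu A R (red_C R \<epsilon>) x)"
    using D_cnj(3)[OF C_smooth x] by (simp add: C_real)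
qed

lemma red_omega_form: "form_in A U (red_omega R \<epsilon>)"
  unfolding red_omega_def
  by (intro form_in_scale smooth_in_mult smooth_in_const sh_abs_smooth lam_form)

lemma ph_smooth: "smooth_in A U ph"
  by (intro smooth_in_cis smooth_in_divide smooth_in_minus smooth_in_diff smooth_in_const
      psi_smooth) auto

lemma red_omega1_form: "form_in A U (red_omega1 R \<psi> \<epsilon>)"
  unfolding red_omega1_def by (intro form_in_scale ph_smooth mu_form)

lemma red_Omega_form: "form_in A U (red_Omega A R \<psi> \<epsilon>)"
  unfolding red_Omega_def
  by (intro form_in_add form_in_scale smooth_in_cnj N_smooth C_smooth mu_form cnj_mu_form lam_form)

lemma red_omega_real: "x \<in> U \<Longrightarrow> cnj (red_omega R \<epsilon> x v) = red_omega R \<epsilon> x v"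
  using U_sub by (auto simp: red_omega_def cis_nat_pi lam_real subset_iff)

lemma red_Omega_real: "x \<in> U \<Longrightarrow> cnj (red_Omega A R \<psi> \<epsilon> x v) = red_Omega A R \<psi> \<epsilon> x v"
  using U_sub by (auto simp: red_Omega_def C_real lam_real subset_iff cnj_form_def)

text \<open>The unit c = \<open>ph x\<close> is g cnj h with g = \<open>sg2\<close> and h = exp (i
  \<psi>/2). These relations turn all trigonometry into polynomial identities in c, g, h and their
  conjugates, the form that \<open>algebra\<close> accepts.\<close>

lemma ph_facts: "ph x * cnj (ph x) = 1" "ph x = sg2 * cnj (cis (\<psi> x / 2))" "sg2 * cnj sg2 = 1"
  "cis (\<psi> x / 2) * cnj (cis (\<psi> x / 2)) = 1" "cis ((\<psi> x - real \<epsilon> * pi) / 2) = cnj (ph x)"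
  "cis (\<psi> x) = cis (\<psi> x / 2) * cis (\<psi> x / 2)" "cis (- \<psi> x / 2) = cnj (cis (\<psi> x / 2))"
  by (rule cis_mult_cnj, simp only: cis_cnj cis_mult, rule arg_cong[where f
      = cis], simp add: field_simps,
      rule cis_mult_cnj, rule cis_mult_cnj, simp only: cis_cnj, rule arg_cong[where f
          = cis], simp add: field_simps,
      rule cis_half, simp add: cis_cnj)

text \<open>Cleared of denominators so that t1 can enter polynomial identities.\<close>

lemma t1_eq:
  assumes "x \<in> U"
  shows "t1 A R \<psi> \<epsilon> x * sh_abs R x = (cb R x * sh_abs R x + D_mu A R (sh_abs R) x) * cnj (ph x)"
  using shear[OF assms] by (simp add: t1_def ph_facts(5))

text \<open>The \<mu> \<and> \<lambda> coefficient of d (|s| \<lambda>) is b |s| plus the \<mu>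
  derivative of |s|; replacing \<mu> by cnj c \<nu> turns it into t1 |s|. The other term is the
  conjugate, since |s| and \<lambda> are real.\<close>

lemma ext_d_red_omega:
  assumes x: "x \<in> U"
  shows "ext_d A (red_omega R \<epsilon>) x u v = t1 A R \<psi> \<epsilon> x * (red_omega1 R \<psi> \<epsilon> x \<and>\<^sub>1 red_omega R \<epsilon> x) u v
    + cnj (t1 A R \<psi> \<epsilon> x) * (cnj_form (red_omega1 R \<psi> \<epsilon>) x \<and>\<^sub>1 red_omega R \<epsilon> x) u v"
proof -
  have xc: "x \<in> carrier A" using x U_sub by auto
  define t where "t = t1 A R \<psi> \<epsilon> x"
  define Pn where "Pn = sh_abs R x"
  define c where "c = ph x"
  have t: "t * Pn = (cb R x * Pn + D_mu A R (sh_abs R) x) * cnj c"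
    using t1_eq[OF x] by (simp add: t_def Pn_def c_def)
  have Pr: "cnj Pn = Pn" by (simp add: Pn_def)
  have t': "cnj t * Pn = (cnj (cb R x) * Pn + cnj (D_mu A R (sh_abs R) x)) * c"
    using arg_cong[OF t, of cnj] Pr by simp
  have c: "c * cnj c = 1" unfolding c_def by (rule ph_facts)
  have real: "D_mub A R (sh_abs R) x = cnj (D_mu A R (sh_abs R) x)"
    by (rule D_real(2)[OF sh_abs_smooth x])
  have L: "ext_d A (red_omega R \<epsilon>) x u v = sg * (d_fun A (sh_abs R) x u * lam R x v
      - d_fun A (sh_abs R) x v * lam R x u
      + Pn * ext_d A (lam R) x u v)"
    unfolding red_omega_def Pn_def
      ext_d_scale[OF smooth_in_mult[OF smooth_in_const sh_abs_smooth] lam_form x]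
          d_fun_cmult[OF sh_abs_smooth x]
    by (simp add: algebra_simps)
  show ?thesis
    unfolding L ext_d_lam[OF x] frame_expand[OF sh_abs_smooth x] real
    unfolding red_omega_def red_omega1_def cnj_form_def wedge_def c_def[symmetric] Pn_def[symmetric]
        t_def[symmetric] complex_cnj_mult
    using t t' c by algebra
qed

lemma T0_eq:
  assumes "x \<in> U"
  shows "T0 A R \<psi> \<epsilon> x * sh_abs R x * 2 = (D_lam A R (cpx \<psi>) x + \<i> * (cnj (cq R x) - cq R x)) * sg"
  using shear[OF assms] by (simp add: T0_def)

lemma T0_real: "x \<in> U \<Longrightarrow> cnj (T0 A R \<psi> \<epsilon> x) = T0 A R \<psi> \<epsilon> x"
  using D_real(1)[OF cpsi_smooth] by (simp add: T0_def cis_nat_pi right_diff_distrib)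

text \<open>The \<mu> \<and> \<mu>bar and \<mu> \<and> \<lambda> components hold by the choice of N,
  C and \<open>T0\<close>. The \<mu>bar \<and> \<lambda> component is the half-angle property c s =
  e |s| cnj c, with e the sign \<open>sg\<close>.\<close>

lemma ext_d_red_omega1:
  assumes x: "x \<in> U"
  shows "ext_d A (red_omega1 R \<psi> \<epsilon>) x u v = (red_Omega A R \<psi> \<epsilon> x \<and>\<^sub>1 red_omega1 R \<psi> \<epsilon> x) u v
    + ((\<lambda>v. red_omega1 R \<psi> \<epsilon> x v + cnj_form (red_omega1 R \<psi> \<epsilon>) x v) \<and>\<^sub>1 red_omega R \<epsilon> x) u v
    + \<i> * T0 A R \<psi> \<epsilon> x * (red_omega1 R \<psi> \<epsilon> x \<and>\<^sub>1 red_omega R \<epsilon> x) u v"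
proof -
  have xc: "x \<in> carrier A" using x U_sub by auto
  define t where "t = T0 A R \<psi> \<epsilon> x"
  define Pn where "Pn = sh_abs R x"
  define g where "g = sg2"
  define h where "h = cis (\<psi> x / 2)"
  define c where "c = ph x"
  have t: "t * Pn * 2 = (D_lam A R (cpx \<psi>) x + \<i> * (cnj (cq R x) - cq R x)) * sg"
    using T0_eq[OF x] by (simp add: t_def Pn_def)
  have c: "c * cnj c = 1" "c = g * cnj h" "h * cnj h = 1" "g * cnj g = 1" "sg = g * g" "sg * sg = 1"
    unfolding c_def g_def h_def
    by (rule ph_facts cis_half cis_nat_pi)+
  have s: "sh R x = Pn * (h * h)" using sh_polar[OF x] ph_facts(6)[of x] by (simp add: Pn_def h_def)
  have real: "D_mub A R (cpx \<psi>) x = cnj (D_mu A R (cpx \<psi>) x)"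
    by (rule D_real(2)[OF cpsi_smooth x])
  have i2: "\<i> * \<i> = -1" by simp
  \<comment> \<open>\<open>algebra\<close> works with polynomials, so 1/2 enters as an unknown
    \<open>hf\<close> subject to 2 \<open>hf\<close> = 1.\<close>
  define hf :: complex where "hf = inverse 2"
  have hf: "2 * hf = 1" by (simp add: hf_def)
  have "smooth_in A U (\<lambda>x. - (\<psi> x - real \<epsilon> * pi) / 2)"
    by (intro smooth_in_divide smooth_in_minus smooth_in_diff smooth_in_const psi_smooth) auto
  note dc = d_fun_cis[OF this x]
  have "(\<lambda>x. complex_of_real (- (\<psi> x - real \<epsilon> * pi) / 2)) = (\<lambda>x. of_real (real \<epsilon> * pi / 2)
      + (- 1 / 2) * cpx \<psi> x)"
    by (auto simp: field_simps)
  then have "d_fun A (\<lambda>x. complex_of_real (- (\<psi> x - real \<epsilon> * pi) / 2)) x v = - 1 / 2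
      * d_fun A (cpx \<psi>) x v" for v
    by (simp only: d_fun_add[OF smooth_in_const smooth_in_mult[OF smooth_in_const cpsi_smooth] x]
        d_fun_cmult[OF cpsi_smooth x] d_fun_const add_0)
  with dc have dc: "d_fun A ph x v = - \<i> / 2 * c * d_fun A (cpx \<psi>) x v" for v
    by (simp only: c_def) simp
  have L: "ext_d A (red_omega1 R \<psi> \<epsilon>) x u v = - \<i> / 2 * c * d_fun A (cpx \<psi>) x u * mu R x v
      - (- \<i> / 2 * c * d_fun A (cpx \<psi>) x v) * mu R x u + c * ext_d A (mu R) x u v"
    unfolding red_omega1_def ext_d_scale[OF ph_smooth mu_form x] dc c_def ..
  show ?thesis
    unfolding L ext_d_mu[OF x] frame_expand[OF cpsi_smooth x] real s
    unfolding red_omega_def red_omega1_def red_Omega_def red_N_def red_C_def cnj_form_def wedge_def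
      c_def[symmetric] Pn_def[symmetric]
          t_def[symmetric] complex_cnj_mult complex_cnj_diff complex_cnj_i
      complex_cnj_divide complex_cnj_numeral complex_cnj_cnj complex_cnj_add
    unfolding divide_inverse hf_def[symmetric]
    using t c i2 hf by algebra
qed

lemma D_mub_psi: "x \<in> U \<Longrightarrow> D_mub A R (cpx \<psi>) x = cnj (D_mu A R (cpx \<psi>) x)"
  by (rule D_real(2)[OF cpsi_smooth])

text \<open>The second derivatives of \<psi> and the derivatives of p are paired with their
  conjugates, which makes the reality of k0 visible.\<close>

lemma k0_eq:
  assumes x: "x \<in> U"
  shows "k0 A R \<psi> x = - D_mub A R (D_mu A R (cpx \<psi>)) x - cnj (D_mub A R (D_mu A R (cpx \<psi>)) x)
    + cp R x * D_mu A R (cpx \<psi>) x + cnj (cp R x) * cnj (D_mu A R (cpx \<psi>) x)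
    + 2 * \<i> * (D_mu A R (cp R) x - cnj (D_mu A R (cp R) x))"
proof -
  have "D_mu A R (D_mub A R (cpx \<psi>)) x = cnj (D_mub A R (D_mu A R (cpx \<psi>)) x)"
    using D_cong(2)[OF D_mub_psi x] D_cnj(2)[OF smooth_in_D(2)[OF cpsi_smooth] x] by simp
  then show ?thesis
    by (simp only: k0_def D_cnj(3)[OF coeffs_smooth(2) x] D_mub_psi[OF x])
qed

lemma k0_real: "x \<in> U \<Longrightarrow> cnj (k0 A R \<psi> x) = k0 A R \<psi> x"
  by (simp add: k0_eq algebra_simps)

text \<open>The right side is twice the \<mu> \<and> \<lambda> coefficient of d
  \<open>red_Omega\<close>; the factor beside k1 is the ratio of \<nu> \<and> \<omega> to \<mu>
  \<and> \<lambda>. The definition of k1 contains no \<lambda> derivative of p: the one in that of N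
  is removed by the integrability condition \<open>D_lam_cp\<close>, which brings in the conjugate
  of t1.\<close>

lemma k1_eq:
  assumes x: "x \<in> U"
  shows "k1 A R \<psi> \<epsilon> x * (ph x * (sg * sh_abs R x)) = 2 * (- D_lam A R (red_N A R \<psi>) x
      + red_N A R \<psi> x * cq R x
    + cnj (red_N A R \<psi> x) * cnj (sh R x) + D_mu A R (red_C R \<epsilon>) x + red_C R \<epsilon> x * cb R x)"
proof -
  define Pn where "Pn = sh_abs R x"
  define t where "t = t1 A R \<psi> \<epsilon> x"
  define g where "g = sg2"
  define h where "h = cis (\<psi> x / 2)"
  define c where "c = ph x"
  define hf :: complex where "hf = inverse 2"
  define P where "P = D_mu A R (cpx \<psi>) x"
  define J where "J = inverse Pn"
  have Pn0: "Pn * J = 1" using shear[OF x] by (simp add: Pn_def J_def)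
  have Pr: "cnj Pn = Pn" by (simp add: Pn_def)
  have t: "t * Pn = (cb R x * Pn + D_mu A R (sh_abs R) x) * cnj c"
    unfolding t_def Pn_def c_def by (rule t1_eq[OF x])
  have t': "cnj t * Pn = (cnj (cb R x) * Pn + cnj (D_mu A R (sh_abs R) x)) * c"
    using arg_cong[OF t, of cnj] Pr by simp
  have c: "c * cnj c = 1" "c = g * cnj h" "h * cnj h = 1" "g * cnj g = 1" "sg = g * g" "sg * sg = 1"
    unfolding c_def g_def h_def
    by (rule ph_facts cis_half cis_nat_pi)+
  have s: "sh R x = Pn * (h * h)" using sh_polar[OF x] ph_facts(6)[of x] by (simp add: Pn_def h_def)
  have i2: "\<i> * \<i> = -1" by simp
  have hf: "2 * hf = 1" by (simp add: hf_def)
  have q: "D_mu A R (\<lambda>y. cnj (cq R y)) x = cnj (D_mub A R (cq R) x)"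
    by (rule D_cnj(2)[OF coeffs_smooth(3) x])
  have k: "k1 A R \<psi> \<epsilon> x = 2 * (t - cnj t) + g *
       ((cb R x * cnj (cq R x) - cb R x * cq R x - D_mu A R (cq R) x + cnj (D_mub A R (cq R) x)
         + \<i> * cq R x * P - \<i> * D_lam A R (D_mu A R (cpx \<psi>)) x) * h
        + \<i> * cnj P * Pn * cnj h) * J"
    unfolding k1_def ph_facts(7) g_def[symmetric] h_def[symmetric] t_def[symmetric] Pn_def[symmetric]
      D_mub_psi[OF x] P_def[symmetric] q
    unfolding J_def divide_inverse ..
  have lp: "cnj (D_lam A R (cp R) x) = cnj (cp R x) * cq R x + cnj (D_mub A R (cq R) x)
      + cnj (cq R x) * cb R x
    - (cnj (D_mu A R (sh_abs R) x) * cnj (h * h) - \<i> * (Pn * cnj (h * h)) * cnj P) - Pn * cnj (h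
        * h) * (cnj (cb R x) - cp R x)"
    unfolding D_lam_cp[OF x] D_mu_sh[OF x] P_def[symmetric] s ph_facts(6) h_def[symmetric]
    by (simp add: Pr)
  have N: "red_N A R \<psi> x = \<i> * hf * P - cnj (cp R x)"
    unfolding red_N_def hf_def P_def divide_inverse ..
  have Nc: "cnj (red_N A R \<psi> x) = - \<i> * hf * cnj P - cp R x"
    by (simp add: N hf_def)
  have DN: "D_lam A R (red_N A R \<psi>) x = \<i> * hf * D_lam A R (D_mu A R (cpx \<psi>)) x
      - cnj (D_lam A R (cp R) x)"
    unfolding D_N(1)[OF x] hf_def divide_inverse ..
  have DC: "D_mu A R (red_C R \<epsilon>) x = sg * D_mu A R (sh_abs R) x - hf * (D_mu A R (cq R) x
      + cnj (D_mub A R (cq R) x))"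
    using D_C(1)[OF x] by (simp add: hf_def q)
  have C: "red_C R \<epsilon> x = sg * Pn - hf * (cq R x + cnj (cq R x))"
    by (simp add: red_C_def hf_def Pn_def)
  have sc: "cnj (sh R x) = Pn * cnj (h * h)" by (simp only: s complex_cnj_mult Pr)
  define X where "X = cb R x * cnj (cq R x) - cb R x * cq R x - D_mu A R (cq R) x
      + cnj (D_mub A R (cq R) x)
         + \<i> * cq R x * P - \<i> * D_lam A R (D_mu A R (cpx \<psi>)) x"
  \<comment> \<open>Both use that g^4 = 1. The phases are simplified by hand, so that the closing
    \<open>algebra\<close> call faces an identity with the single relation 2 \<open>hf\<close> =
    1.\<close>
  have g1: "c * sg * g = cnj h" and g2: "c * c * sg = cnj h * cnj h" using c by algebra+
  have "k1 A R \<psi> \<epsilon> x * (c * (sg * Pn)) = 2 * ((t * Pn) * c * sg - (cnj t * Pn) * (c * sg))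
      + (X * h + \<i> * cnj P * Pn * cnj h) * (Pn * J) * (c * sg * g)"
    unfolding k X_def[symmetric] by algebra
  also have "\<dots> = 2 * ((cb R x * Pn + D_mu A R (sh_abs R) x) * (c * cnj c) * sg
      - (cnj (cb R x) * Pn + cnj (D_mu A R (sh_abs R) x)) * (c * c * sg))
      + (X * (h * cnj h) + \<i> * cnj P * Pn * (cnj h * cnj h))"
    unfolding t t' Pn0 g1 by algebra
  also have "\<dots> = 2 * ((cb R x * Pn + D_mu A R (sh_abs R) x) * sg
      - (cnj (cb R x) * Pn + cnj (D_mu A R (sh_abs R) x)) * (cnj h * cnj h))
      + (X + \<i> * cnj P * Pn * (cnj h * cnj h))"
    unfolding c(1) c(3) g2 by simp
  finally have *: "k1 A R \<psi> \<epsilon> x * (c * (sg * Pn)) = \<dots>" .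
  show ?thesis
    unfolding c_def[symmetric] Pn_def[symmetric] *
    unfolding Nc DN
    unfolding N DC C lp sc X_def complex_cnj_mult
    using hf by algebra
qed

text \<open>Only two coefficients are computed: \<open>red_Omega\<close> is real, so its \<mu>bar
  \<and> \<lambda> coefficient is the conjugate of the \<mu> \<and> \<lambda> one. The \<mu> \<and>
  \<mu>bar coefficient comes from d (N \<mu>) and its conjugate alone, as d\<lambda> has no such
  component when the twist vanishes.\<close>

lemma ext_d_red_Omega:
  assumes x: "x \<in> U"
  shows "ext_d A (red_Omega A R \<psi> \<epsilon>) x u v
    = \<i> * k0 A R \<psi> x / 2 * (red_omega1 R \<psi> \<epsilon> x \<and>\<^sub>1 cnj_form (red_omega1 R \<psi> \<epsilon>) x) u v
    + k1 A R \<psi> \<epsilon> x / 2 * (red_omega1 R \<psi> \<epsilon> x \<and>\<^sub>1 red_omega R \<epsilon> x) u v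
    + cnj (k1 A R \<psi> \<epsilon> x) / 2 * (cnj_form (red_omega1 R \<psi> \<epsilon>) x \<and>\<^sub>1 red_omega R \<epsilon> x) u v"
proof -
  define N where "N = red_N A R \<psi> x"
  define c where "c = ph x"
  define C where "C = red_C R \<epsilon> x"
  define Nl where "Nl = D_lam A R (red_N A R \<psi>) x"
  define Nm where "Nm = D_mu A R (red_N A R \<psi>) x"
  define Nn where "Nn = D_mub A R (red_N A R \<psi>) x"
  define Cm where "Cm = D_mu A R (red_C R \<epsilon>) x"
  define Pn where "Pn = sh_abs R x"
  have xc: "x \<in> carrier A" using x U_sub by auto
  define K where "K = - Nl + N * cq R x + cnj N * cnj (sh R x) + Cm + C * cb R x"
  have c: "c * cnj c = 1" unfolding c_def by (rule ph_facts)
  have K: "k1 A R \<psi> \<epsilon> x * (c * (sg * Pn)) = 2 * K"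
    unfolding K_def N_def C_def Nl_def Cm_def c_def Pn_def by (rule k1_eq[OF x])
  have Pr: "cnj Pn = Pn" by (simp add: Pn_def)
  have K': "cnj (k1 A R \<psi> \<epsilon> x) * (cnj c * (sg * Pn)) = 2 * cnj K"
    using arg_cong[OF K, of cnj] Pr cis_nat_pi(1) by simp
  have Cr: "cnj C = C" unfolding C_def by (rule C_real)
  have cK: "cnj K = - cnj Nl + cnj N * cnj (cq R x) + N * sh R x + cnj Cm + C * cnj (cb R x)"
    by (simp add: K_def Cr)
  have k0: "\<i> * k0 A R \<psi> x = 2 * (- Nn + cnj Nn + N * cp R x - cnj N * cnj (cp R x))"
    unfolding Nn_def D_N(2)[OF x] k0_eq[OF x]
    unfolding N_def red_N_def
    by (simp add: algebra_simps)
  note ncf = smooth_in_cnj[OF N_smooth]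
  have L: "ext_d A (red_Omega A R \<psi> \<epsilon>) x u v =
     (d_fun A (red_N A R \<psi>) x u * mu R x v - d_fun A (red_N A R \<psi>) x v * mu R x u + N
         * ext_d A (mu R) x u v)
   + (cnj (d_fun A (red_N A R \<psi>) x u) * cnj (mu R x v) - cnj (d_fun A (red_N A R \<psi>) x v)
       * cnj (mu R x u) + cnj N * cnj (ext_d A (mu R) x u v))
   + (d_fun A (red_C R \<epsilon>) x u * lam R x v - d_fun A (red_C R \<epsilon>) x v * lam R x u + C
       * ext_d A (lam R) x u v)"
    unfolding red_Omega_def
      ext_d_add[OF form_in_add[OF form_in_scale[OF N_smooth mu_form]
          form_in_scale[OF ncf cnj_mu_form]] form_in_scale[OF C_smooth lam_form] x]
      ext_d_add[OF form_in_scale[OF N_smooth mu_form] form_in_scale[OF ncf cnj_mu_form] x]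
      ext_d_scale[OF N_smooth mu_form x] ext_d_scale[OF ncf cnj_mu_form x]
          ext_d_scale[OF C_smooth lam_form x]
      ext_d_cnj[OF mu_form x] d_fun_cnj[OF N_smooth x]
    by (simp add: N_def C_def cnj_form_def)
  define hf :: complex where "hf = inverse 2"
  have hf: "2 * hf = 1" by (simp add: hf_def)
  show ?thesis
    unfolding L ext_d_mu[OF x] ext_d_lam[OF x] frame_expand[OF N_smooth x]
        frame_expand[OF C_smooth x] D_C(2)[OF x]
      Nl_def[symmetric] Nm_def[symmetric] Nn_def[symmetric] Cm_def[symmetric]
    unfolding red_omega_def red_omega1_def cnj_form_def wedge_def c_def[symmetric] Pn_def[symmetric]
      complex_cnj_mult complex_cnj_add complex_cnj_diff complex_cnj_cnj lam_real[OF xc]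
    unfolding divide_inverse hf_def[symmetric]
    using c hf k0 K[unfolded K_def] K'[unfolded cK] by algebra
qed

lemma invariants_smooth:
  "smooth_in A U (T0 A R \<psi> \<epsilon>)" "smooth_in A U (t1 A R \<psi> \<epsilon>)"
  "smooth_in A U (k0 A R \<psi>)" "smooth_in A U (k1 A R \<psi> \<epsilon>)"
proof -
  note sm = smooth_in_add smooth_in_diff smooth_in_minus smooth_in_mult smooth_in_const
      smooth_in_cnj smooth_in_D
    cpsi_smooth coeffs_smooth sh_abs_smooth smooth_in_divide smooth_in_cis psi_smooth
  have nz: "sh_abs R x \<noteq> 0" if "x \<in> U" for x using shear[OF that] by simp
  have nz2: "2 * sh_abs R x \<noteq> 0" if "x \<in> U" for x using shear[OF that] by simp
  show "smooth_in A U (T0 A R \<psi> \<epsilon>)"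
    unfolding T0_def[abs_def] by (intro sm nz2)
  show t1: "smooth_in A U (t1 A R \<psi> \<epsilon>)"
    unfolding t1_def[abs_def] by (intro sm nz) auto
  show "smooth_in A U (k0 A R \<psi>)"
    unfolding k0_def[abs_def] by (intro sm)
  show "smooth_in A U (k1 A R \<psi> \<epsilon>)"
    unfolding k1_def[abs_def] by (intro sm t1 nz) auto
qed

end

section \<open>The four-dimensional bundle\<close>

definition lift_chart :: "'m set \<Rightarrow> ('m, real^3) chart \<Rightarrow> ('m \<times> real, (real^3) \<times> real) chart" where
  "lift_chart U c = ((fst c \<inter> U) \<times> {0<..}, \<lambda>(x, r). (snd c x, r))"

lemma P_atlas_eq: "P_atlas A U = lift_chart U ` A"
  by (force simp: P_atlas_def restrict_atlas_def lift_chart_def image_image)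

lemma lift_chart_simps [simp]:
  "fst (lift_chart U c) = (fst c \<inter> U) \<times> {0<..}" "snd (lift_chart U c) z = (snd c (fst z), snd z)"
  by (simp_all add: lift_chart_def case_prod_beta)

lemma lift_chart_image: "snd (lift_chart U c) ` (V \<times> I) = (snd c ` V) \<times> I"
  by (force simp: image_iff)

lemma smooth_on_fst: "open S \<Longrightarrow> smooth_on S (fst :: 'a::real_normed_vector \<times> 'b::real_normed_vector \<Rightarrow>
    'a)"
  by (rule smooth_on_bounded_linear[OF bounded_linear_fst])

lemma smooth_on_snd: "open S \<Longrightarrow> smooth_on S (snd :: 'a::real_normed_vector \<times> 'b::real_normed_vector \<Rightarrow>
    'b)"
  by (rule smooth_on_bounded_linear[OF bounded_linear_snd])

lemma smooth_on_comp_fst: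
  fixes f :: "'a::euclidean_space \<Rightarrow> 'c::real_normed_vector"
  assumes "smooth_on S f" "open S" "open T"
  shows "smooth_on (S \<times> T) (\<lambda>z::'a \<times> 'b::real_normed_vector. f (fst z))"
  by (rule smooth_on_compose[OF open_Times[OF assms(2,3)] assms(2) _ assms(1) smooth_on_fst[OF
      open_Times[OF assms(2,3)]]]) auto

locale product_bundle = open_submanifold A U
  for A :: "('m::{t2_space,second_countable_topology}, real^3) chart set" and U
begin

abbreviation "PA \<equiv> P_atlas A U"

lemma lift_inv:
  assumes "c \<in> A" "y \<in> snd c ` (fst c \<inter> U)" "0 < r"
  shows "inv_chart (lift_chart U c) (y, r) = (inv_chart c y, r)"
proof -
  have "inj_on (snd (lift_chart U c)) ((fst c \<inter> U) \<times> {0<..})"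
    using chart_inj[OF assms(1)] by (auto simp: inj_on_def)
  moreover obtain x where "x \<in> fst c \<inter> U" "y = snd c x" using assms by auto
  ultimately have "inv_into ((fst c \<inter> U) \<times> {0<..}) (snd (lift_chart U c)) (y, r) = (x, r)"
    using assms(3) by (intro inv_into_f_eq) auto
  with \<open>x \<in> fst c \<inter> U\<close> \<open>y = snd c x\<close> assms(1) show ?thesis by (simp add: inv_chart_def[of
      "lift_chart U c"])
qed

lemma carrier_P: "carrier PA = U \<times> {0<..}"
  using U_sub by (fastforce simp: carrier_def P_atlas_eq)

lemma chart_continuous: "c \<in> A \<Longrightarrow> continuous_on (fst c) (snd c)"
  "c \<in> A \<Longrightarrow> continuous_on (snd c ` fst c) (inv_chart c)"
  using mfd by (auto simp: smooth_manifold_def homeomorphism_def)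

lemma lift_homeomorphism:
  assumes c: "c \<in> A"
  shows "homeomorphism (fst (lift_chart U c)) (snd (lift_chart U c) ` fst (lift_chart U c))
    (snd (lift_chart U c)) (inv_chart (lift_chart U c))"
proof (rule homeomorphismI)
  have "continuous_on ((fst c \<inter> U) \<times> {0<..}) (\<lambda>z. (snd c (fst z), snd z :: real))"
    by (intro continuous_on_Pair continuous_on_compose2[OF chart_continuous(1)[OF c]]
        continuous_intros) auto
  then show "continuous_on (fst (lift_chart U c)) (snd (lift_chart U c))"
      by (simp cong: continuous_on_cong)
  have "continuous_on ((snd c ` (fst c \<inter> U)) \<times> {0<..}) (\<lambda>z. (inv_chart c (fst z), snd z :: real))"
    by (intro continuous_on_Pair continuous_on_compose2[OF chart_continuous(2)[OF c]]
        continuous_intros) auto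
  moreover have "inv_chart (lift_chart U c) z = (inv_chart c (fst z), snd z)"
    if "z \<in> (snd c ` (fst c \<inter> U)) \<times> {0<..}" for z
    using lift_inv[OF c, of "fst z" "snd z"] that by auto
  ultimately have "continuous_on ((snd c ` (fst c \<inter> U)) \<times> {0<..}) (inv_chart (lift_chart U c))"
    by (subst continuous_on_cong[OF refl])
  then show "continuous_on (snd (lift_chart U c) ` fst (lift_chart U c)) (inv_chart (lift_chart U c))"
    by (simp add: lift_chart_image del: lift_chart_simps(2))
  show "inv_chart (lift_chart U c) ` snd (lift_chart U c) ` fst (lift_chart U c) \<subseteq> fst (lift_chart U c)"
    using lift_inv[OF c] c by auto
qed (use lift_inv[OF c] c in auto)

lemma P_manifold: "smooth_manifold PA"
  unfolding smooth_manifold_def P_atlas_eq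
proof (intro conjI ballI)
  fix d assume "d \<in> lift_chart U ` A"
  then obtain c where c: "c \<in> A" "d = lift_chart U c" by auto
  show "open (fst d)" unfolding c(2) lift_chart_simps by (intro open_Times open_Int
      chart_open[OF c(1)] open_U open_greaterThan)
  show "open (snd d ` fst d)"
    using c chart_image_open[OF c(1) open_U]
        by (simp add: lift_chart_image open_Times del: lift_chart_simps(2))
  show "homeomorphism (fst d) (snd d ` fst d) (snd d) (inv_chart d)"
    using lift_homeomorphism c by simp
  fix d' assume "d' \<in> lift_chart U ` A"
  then obtain c' where c': "c' \<in> A" "d' = lift_chart U c'" by auto
  have eq: "fst d \<inter> fst d' = (fst c \<inter> (fst c' \<inter> U)) \<times> {0<..}" using c c' by auto
  let ?S = "snd c ` (fst c \<inter> (fst c' \<inter> U))"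
  have S: "open ?S" by (intro chart_image_open open_Int chart_open c(1) c' c'(1) open_U)
  have S2: "open (?S \<times> {0::real<..})" using S by (intro open_Times) auto
  have "smooth_on ?S (snd c' \<circ> inv_chart c)"
    by (rule smooth_on_subset[OF transition_smooth[OF c(1) c'(1)]]) auto
  from smooth_on_Pair[OF S2 smooth_on_comp_fst[OF this S open_greaterThan] smooth_on_snd[OF S2]]
  have "smooth_on (?S \<times> {0<..}) (\<lambda>z. ((snd c' \<circ> inv_chart c) (fst z), snd z :: real))" .
  then have "smooth_on (?S \<times> {0<..}) (snd d' \<circ> inv_chart d)"
    by (subst smooth_on_cong[OF S2]) (use lift_inv[OF c(1)] c c' in auto)
  then show "smooth_on (snd d ` (fst d \<inter> fst d')) (snd d' \<circ> inv_chart d)"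
    unfolding eq by (simp add: c(2) lift_chart_image del: lift_chart_simps(2))
qed

lemma fst_smooth: "smooth_map PA A fst"
  unfolding smooth_map_def carrier_P
proof (intro conjI ballI)
  show "fst ` (U \<times> {0::real<..}) \<subseteq> carrier A" using U_sub by auto
  show "continuous_on (U \<times> {0::real<..}) fst" by (intro continuous_intros)
  fix d c' assume "d \<in> PA" and c': "c' \<in> A"
  then obtain c where c: "c \<in> A" "d = lift_chart U c" by (auto simp: P_atlas_eq)
  have eq: "fst d \<inter> fst -` fst c' = (fst c \<inter> (fst c' \<inter> U)) \<times> {0<..}" using c c' by auto
  let ?S = "snd c ` (fst c \<inter> (fst c' \<inter> U))"
  have S: "open ?S" by (intro chart_image_open open_Int chart_open c(1) c' c'(1) open_U)
  have S2: "open (?S \<times> {0::real<..})" using S by (intro open_Times) auto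
  have "smooth_on ?S (snd c' \<circ> inv_chart c)"
    by (rule smooth_on_subset[OF transition_smooth[OF c(1) c'(1)]]) auto
  from smooth_on_comp_fst[OF this S open_greaterThan]
  have "smooth_on (?S \<times> {0::real<..}) (\<lambda>z. (snd c' \<circ> inv_chart c) (fst z))" .
  then have "smooth_on (?S \<times> {0<..}) (snd c' \<circ> fst \<circ> inv_chart d)"
    by (subst smooth_on_cong[OF S2]) (use lift_inv[OF c(1)] c c' in auto)
  then show "smooth_on (snd d ` (fst d \<inter> fst -` fst c')) (snd c' \<circ> fst \<circ> inv_chart d)"
    unfolding eq by (simp add: c(2) lift_chart_image del: lift_chart_simps(2))
qed

text \<open>Through this interpretation the lemmas on P carry the prefix \<open>pr.M\<close> and
  those on M the prefix \<open>pr.N\<close>.\<close>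

sublocale pr: manifold_map PA A fst
  by unfold_locales
    (use P_manifold carrier_submanifold[OF P_manifold] carrier_submanifold[OF mfd] mfd fst_smooth
      in \<open>auto simp: open_submanifold_def\<close>)

lemma smooth_fun_P: "smooth_fun PA u \<longleftrightarrow> smooth_in PA (carrier PA) u"
proof -
  have "fst c \<inter> carrier PA = fst c" if "c \<in> PA" for c using that by (auto simp: carrier_def)
  then show ?thesis by (simp add: smooth_fun_def smooth_in_def)
qed

lemma smooth_form1_P: "smooth_form1 PA \<alpha> \<longleftrightarrow> form_in PA (carrier PA) \<alpha>"
proof -
  have "fst c \<inter> carrier PA = fst c" if "c \<in> PA" for c using that by (auto simp: carrier_def)
  then show ?thesis by (simp add: smooth_form1_def form_in_def)
qed

lemma fst_carrier: "fst ` carrier PA \<subseteq> U" "z \<in> carrier PA \<Longrightarrow> fst z \<in> U" "z \<in> carrier PA \<Longrightarrow> 0 < snd z"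
  by (auto simp: carrier_P)

lemma smooth_in_fst: "smooth_in A U u \<Longrightarrow> smooth_in PA (carrier PA) (\<lambda>z. u (fst z))"
  using pr.smooth_in_map[OF open_U _ order_refl fst_carrier(1)] by (simp add: o_def)

lemma form_in_fst: "form_in A U \<alpha> \<Longrightarrow> form_in PA (carrier PA) (pullback PA A fst \<alpha>)"
  using pr.form_in_pullback[OF open_U U_sub _ order_refl fst_carrier(1)] .

lemma ext_d_fst: "form_in A U \<alpha> \<Longrightarrow> z \<in> carrier PA \<Longrightarrow>
    ext_d PA (pullback PA A fst \<alpha>) z u v
        = ext_d A \<alpha> (fst z) (mderiv PA A fst z u) (mderiv PA A fst z v)"
  using pr.ext_d_pullback[OF open_U U_sub] fst_carrier(2) by blast

lemma chart_at_P:
  assumes "z \<in> carrier PA"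
  obtains c where "c \<in> A" "fst z \<in> fst c" "chart_at PA z = lift_chart U c"
  using pr.M.chart_at_carrier[OF assms] by (auto simp: P_atlas_eq)

lemma lift_inv_open:
  assumes "c \<in> A" "fst z \<in> fst c" "z \<in> carrier PA"
  shows "open ((snd c ` (fst c \<inter> U)) \<times> {0::real<..})"
      "snd (lift_chart U c) z \<in> (snd c ` (fst c \<inter> U)) \<times> {0<..}"
  using assms chart_image_open[OF assms(1) open_U] by (auto intro!: open_Times simp: carrier_P)

lemma mderiv_fst:
  assumes z: "z \<in> carrier PA" and c: "c \<in> A" "fst z \<in> fst c" "chart_at PA z = lift_chart U c"
  shows "mderiv PA A fst z v = chart_frame A c (fst z) (fst v)"
proof -
  let ?d = "chart_at PA z"
  have d: "?d \<in> PA" "z \<in> fst ?d" using pr.M.chart_at_carrier[OF z] by auto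
  note S = lift_inv_open[OF c(1,2) z]
  have "frechet_derivative (pr.chart_map ?d c) (at (snd ?d z)) = frechet_derivative fst (at (snd ?d z))"
  proof (rule frechet_derivative_cong_open[OF S(1)])
    show "snd ?d z \<in> (snd c ` (fst c \<inter> U)) \<times> {0<..}" using S(2) by (simp add: c(3))
    fix y assume "y \<in> (snd c ` (fst c \<inter> U)) \<times> {0::real<..}"
    then show "pr.chart_map ?d c y = fst y"
      using lift_inv[OF c(1), of "fst y" "snd y"] c(1) by (auto simp: c(3))
  qed
  also have "\<dots> = fst" by (rule frechet_derivativeI) (auto intro!: derivative_eq_intros)
  finally show ?thesis
    using pr.mderiv_chart_frame[OF d(1) c(1) d(2) c(2), of v] pr.M.chart_frame_self[OF z] by simp
qed

lemma snd_smooth: "smooth_in PA (carrier PA) snd"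
  unfolding smooth_in_def
proof
  fix d assume "d \<in> PA"
  then obtain c where c: "c \<in> A" "d = lift_chart U c" by (auto simp: P_atlas_eq)
  have eq: "fst d \<inter> carrier PA = (fst c \<inter> U) \<times> {0<..}" using c by (auto simp: carrier_P)
  let ?S = "snd c ` (fst c \<inter> U)"
  have S2: "open (?S \<times> {0::real<..})" using chart_image_open[OF c(1) open_U] by (intro open_Times) auto
  have "smooth_on (?S \<times> {0<..}) (snd \<circ> inv_chart d)"
    by (subst smooth_on_cong[OF S2, of _ snd]) (use lift_inv[OF c(1)] c S2
        in \<open>auto intro: smooth_on_snd\<close>)
  then show "smooth_on (snd d ` (fst d \<inter> carrier PA)) (snd \<circ> inv_chart d)"
    unfolding eq by (simp add: c(2) lift_chart_image del: lift_chart_simps(2))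
qed

lemma d_snd:
  assumes z: "z \<in> carrier PA" and c: "c \<in> A" "fst z \<in> fst c" "chart_at PA z = lift_chart U c"
  shows "d_fun PA (\<lambda>z. complex_of_real (snd z)) z v = of_real (snd v)"
proof (rule pr.M.d_funI)
  let ?d = "chart_at PA z"
  note S = lift_inv_open[OF c(1,2) z]
  have "((\<lambda>y. complex_of_real (snd y)) has_derivative (\<lambda>v. of_real (snd v))) (at (snd ?d z))"
    by (auto intro!: derivative_eq_intros)
  then show "((\<lambda>y. complex_of_real (snd (inv_chart ?d y))) has_derivative (\<lambda>v. of_real (snd v))) (at
      (snd ?d z))"
  proof (subst has_derivative_cong_open[OF S(1), of _ _ "\<lambda>y. complex_of_real (snd y)"])
    show "snd ?d z \<in> (snd c ` (fst c \<inter> U)) \<times> {0<..}" using S(2) by (simp add: c(3))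
  qed (use lift_inv[OF c(1)] c in auto)
qed

definition dlog :: "'m form4" where
  "dlog = d_fun PA (\<lambda>z. of_real (ln (snd z)))"

lemma lnr_smooth: "smooth_in PA (carrier PA) (\<lambda>z. complex_of_real (ln (snd z)))"
  using fst_carrier(3) by (intro pr.M.smooth_in_of_real pr.M.smooth_in_ln snd_smooth) auto

text \<open>The term d\<rho> arises from d (\<rho> \<nu>); written as \<rho> d log \<rho> it can be
  absorbed into \<Omega>.\<close>

lemma dlog_eq:
  assumes "z \<in> carrier PA"
  shows "d_fun PA (\<lambda>z. complex_of_real (snd z)) z v = of_real (snd z) * dlog z v"
  using pr.M.d_fun_ln[OF snd_smooth assms fst_carrier(3), of v] fst_carrier(3)[OF assms]
      by (simp add: dlog_def)

lemma dlog_form: "form_in PA (carrier PA) dlog"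
  unfolding dlog_def by (rule pr.M.form_in_d_fun[OF lnr_smooth])

lemma ext_d_dlog: "z \<in> carrier PA \<Longrightarrow> ext_d PA dlog z u v = 0"
  unfolding dlog_def by (rule pr.M.ext_d_d_fun[OF lnr_smooth])

lemma dlog_real: "z \<in> carrier PA \<Longrightarrow> cnj (dlog z v) = dlog z v"
  unfolding dlog_def
  using fst_carrier(3) by (intro pr.M.d_fun_of_real_cnj pr.M.smooth_in_ln snd_smooth) auto

lemma lift_vector:
  assumes "z \<in> carrier PA"
  obtains v where "mderiv PA A fst z v = u"
proof -
  obtain c where c: "c \<in> A" "fst z \<in> fst c" "chart_at PA z = lift_chart U c" using
      chart_at_P[OF assms] .
  obtain v where "chart_frame A c (fst z) v = u" using chart_frame_surj[OF c(1,2)] .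
  then show ?thesis using that[of "(v, 0)"] mderiv_fst[OF assms c] by simp
qed

text \<open>The coordinate direction of \<rho> lies in the kernel of the projection, and d log
  \<rho> does not vanish on it; it is the fourth vector in \<open>om_wedge4\<close>.\<close>

lemma vertical_vector:
  assumes z: "z \<in> carrier PA"
  obtains v where "mderiv PA A fst z v = 0" "dlog z v \<noteq> 0"
proof -
  obtain c where c: "c \<in> A" "fst z \<in> fst c" "chart_at PA z = lift_chart U c" using chart_at_P[OF z] .
  have "mderiv PA A fst z (0, 1) = 0"
    using mderiv_fst[OF z c] linear_0[OF chart_frame_linear[OF c(1,2)]] by simp
  moreover have "dlog z (0, 1) \<noteq> 0"
    using d_snd[OF z c, of "(0, 1)"] dlog_eq[OF z, of "(0, 1)"] by auto
  ultimately show ?thesis using that by blast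
qed

end

lemma structure_equationsD:
  assumes "structure_equations P \<omega> \<omega>1 \<Omega> F0 F1 G0 G1" "z \<in> carrier P"
  shows "ext_d P \<omega> z u v = F1 z * (\<omega>1 z \<and>\<^sub>1 \<omega> z) u v + cnj (F1 z) * (cnj_form \<omega>1 z \<and>\<^sub>1 \<omega> z) u v"
    "ext_d P \<omega>1 z u v = (\<Omega> z \<and>\<^sub>1 \<omega>1 z) u v + ((\<lambda>v. \<omega>1 z v + cnj_form \<omega>1 z v) \<and>\<^sub>1 \<omega> z) u v
      + \<i> * F0 z * (\<omega>1 z \<and>\<^sub>1 \<omega> z) u v"
    "ext_d P (cnj_form \<omega>1) z u v = (\<Omega> z \<and>\<^sub>1 cnj_form \<omega>1 z) u v
      + ((\<lambda>v. \<omega>1 z v + cnj_form \<omega>1 z v) \<and>\<^sub>1 \<omega> z) u v - \<i> * F0 z * (cnj_form \<omega>1 z \<and>\<^sub>1 \<omega> z) u v"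
    "ext_d P \<Omega> z u v = \<i> * G0 z * (\<omega>1 z \<and>\<^sub>1 cnj_form \<omega>1 z) u v + G1 z * (\<omega>1 z \<and>\<^sub>1 \<omega> z) u v
      + cnj (G1 z) * (cnj_form \<omega>1 z \<and>\<^sub>1 \<omega> z) u v"
    "F0 z \<in> \<real>" "G0 z \<in> \<real>"
  using assms unfolding structure_equations_def Let_def by blast+

lemma structure_equationsI:
  assumes "\<And>z. z \<in> carrier P \<Longrightarrow> F0 z \<in> \<real>" "\<And>z. z \<in> carrier P \<Longrightarrow> G0 z \<in> \<real>"
    "\<And>z u v. z \<in> carrier P \<Longrightarrow> ext_d P \<omega> z u v = F1 z * (\<omega>1 z \<and>\<^sub>1 \<omega> z) u v + cnj (F1 z)
        * (cnj_form \<omega>1 z \<and>\<^sub>1 \<omega> z) u v"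
    "\<And>z u v. z \<in> carrier P \<Longrightarrow> ext_d P \<omega>1 z u v = (\<Omega> z \<and>\<^sub>1 \<omega>1 z) u v
      + ((\<lambda>v. \<omega>1 z v + cnj_form \<omega>1 z v) \<and>\<^sub>1 \<omega> z) u v + \<i> * F0 z * (\<omega>1 z \<and>\<^sub>1 \<omega> z) u v"
    "\<And>z u v. z \<in> carrier P \<Longrightarrow> ext_d P (cnj_form \<omega>1) z u v = (\<Omega> z \<and>\<^sub>1 cnj_form \<omega>1 z) u v
      + ((\<lambda>v. \<omega>1 z v + cnj_form \<omega>1 z v) \<and>\<^sub>1 \<omega> z) u v - \<i> * F0 z * (cnj_form \<omega>1 z \<and>\<^sub>1 \<omega> z) u v"
    "\<And>z u v. z \<in> carrier P \<Longrightarrow> ext_d P \<Omega> z u v = \<i> * G0 z * (\<omega>1 z \<and>\<^sub>1 cnj_form \<omega>1 z) u v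
      + G1 z * (\<omega>1 z \<and>\<^sub>1 \<omega> z) u v + cnj (G1 z) * (cnj_form \<omega>1 z \<and>\<^sub>1 \<omega> z) u v"
  shows "structure_equations P \<omega> \<omega>1 \<Omega> F0 F1 G0 G1"
  unfolding structure_equations_def Let_def using assms by blast

section \<open>The forms on the bundle and their structure equations\<close>

locale shear_bundle = shear_congruence A U R \<psi> \<epsilon>
  for A :: "('m::{t2_space,second_countable_topology}, real^3) chart set" and U and R \<psi> \<epsilon>
begin

sublocale product_bundle A U by unfold_locales

abbreviation "om \<equiv> form_omega A U R \<epsilon>"
abbreviation "om1 \<equiv> form_omega1 A U R \<psi> \<epsilon>"
abbreviation "Om \<equiv> form_Omega A U R \<psi> \<epsilon>"

lemma om_eq: "om = pullback PA A fst (red_omega R \<epsilon>)"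
  by (simp add: form_omega_def pullback_def red_omega_def)

lemma om1_eq: "om1 = (\<lambda>z v. of_real (snd z) * pullback PA A fst (red_omega1 R \<psi> \<epsilon>) z v)"
  by (simp add: form_omega1_def pullback_def red_omega1_def mult.assoc)

text \<open>Inserting \<omega>1 = \<rho> c \<mu> cancels 1/\<rho> and the phases, and inserting
  \<omega> cancels 1/|s|; what remains beside d log \<rho> is N \<mu> + cnj N \<mu>bar + C
  \<lambda>.\<close>

lemma Om_eq:
  assumes z: "z \<in> carrier PA"
  shows "Om z v = dlog z v + pullback PA A fst (red_Omega A R \<psi> \<epsilon>) z v"
proof -
  define r where "r = complex_of_real (snd z)"
  define x where "x = fst z"
  have x: "x \<in> U" using fst_carrier(2)[OF z] by (simp add: x_def)
  have r: "r \<noteq> 0" using fst_carrier(3)[OF z] by (simp add: r_def)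
  define m where "m = pullback PA A fst (mu R) z v"
  define l where "l = pullback PA A fst (lam R) z v"
  define Pn where "Pn = sh_abs R x"
  define c where "c = ph x"
  have c: "c * cnj c = 1" unfolding c_def by (rule ph_facts)
  have Pn: "Pn \<noteq> 0" using shear[OF x] by (simp add: Pn_def)
  have rr: "cnj r = r" by (simp add: r_def)
  have "Om z v = dlog z v + (\<i> * D_mu A R (cpx \<psi>) x - 2 * cnj (cp R x)) / (2 * r) * cnj c * (r * c * m)
    + (- \<i> * D_mub A R (cpx \<psi>) x - 2 * cp R x) / (2 * r) * c * (r * cnj c * cnj m)
    + (1 - sg * (cq R x + cnj (cq R x)) / (2 * Pn)) * (sg * Pn * l)"
    unfolding form_Omega_def form_omega1_def form_omega_def Let_def cnj_form_def
      x_def[symmetric] r_def[symmetric] m_def[symmetric] l_def[symmetric] ph_facts(5) dlog_def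
      c_def[symmetric] Pn_def[symmetric] complex_cnj_mult rr ..
  also have "\<dots> = dlog z v + (\<i> * D_mu A R (cpx \<psi>) x - 2 * cnj (cp R x)) / 2 * (c * cnj c) * m
    + (- \<i> * D_mub A R (cpx \<psi>) x - 2 * cp R x) / 2 * (c * cnj c) * cnj m
    + (sg * Pn - (sg * sg) * (cq R x + cnj (cq R x)) / 2) * l"
    using r Pn by (simp add: field_simps)
  also have "\<dots> = dlog z v + (red_N A R \<psi> x * m + cnj (red_N A R \<psi> x) * cnj m + red_C R \<epsilon> x * l)"
    unfolding c cis_nat_pi D_mub_psi[OF x] red_N_def red_C_def Pn_def
    by (simp add: field_simps)
  finally show ?thesis
    by (simp add: pullback_def red_Omega_def x_def m_def l_def cnj_form_def)
qed

lemma Om_form: "form_in PA (carrier PA) Om"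
  by (subst pr.M.form_in_cong[OF Om_eq]) (auto intro!: pr.M.form_in_add dlog_form form_in_fst
      red_Omega_form)

lemma om_form: "form_in PA (carrier PA) om"
  unfolding om_eq by (intro form_in_fst red_omega_form)

lemma r_smooth: "smooth_in PA (carrier PA) (\<lambda>z. complex_of_real (snd z))"
  by (rule pr.M.smooth_in_of_real[OF snd_smooth])

lemma om1_form: "form_in PA (carrier PA) om1"
  unfolding om1_eq by (intro pr.M.form_in_scale r_smooth form_in_fst red_omega1_form)

lemma om_real: "z \<in> carrier PA \<Longrightarrow> cnj (om z v) = om z v"
  by (simp add: om_eq pullback_def red_omega_real fst_carrier(2))

lemma Om_real: "z \<in> carrier PA \<Longrightarrow> cnj (Om z v) = Om z v"
  by (simp add: Om_eq pullback_def red_Omega_real fst_carrier(2) dlog_real)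

text \<open>On lifted vectors the product is that of the coframe on M times \<open>sg\<close> |s|
  \<rho>^2.\<close>

lemma om_frame:
  assumes z: "z \<in> carrier PA"
  obtains u v w where "wedge3 (om z) (om1 z) (cnj_form om1 z) u v w \<noteq> 0"
proof -
  define x where "x = fst z"
  have x: "x \<in> U" using fst_carrier(2)[OF z] by (simp add: x_def)
  obtain u v w where W: "wedge3 (lam R x) (mu R x) (cnj_form (mu R) x) u v w \<noteq> 0"
    using frame_nonzero x U_sub by blast
  obtain u' v' w' where uvw: "mderiv PA A fst z u' = u" "mderiv PA A fst z v' = v"
      "mderiv PA A fst z w' = w"
    using lift_vector[OF z] by metis
  have "wedge3 (om z) (om1 z) (cnj_form om1 z) u' v' w'
    = (sg * sh_abs R x) * (of_real (snd z))\<^sup>2 * (ph x * cnj (ph x))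
        * wedge3 (lam R x) (mu R x) (cnj_form (mu R) x) u v w"
    by (simp add: wedge3_def wedge_def form_omega_def form_omega1_def cnj_form_def pullback_def uvw
        x_def[symmetric])
      (simp add: algebra_simps power2_eq_square)
  also have "\<dots> = (sg * sh_abs R x) * (of_real (snd z))\<^sup>2
      * wedge3 (lam R x) (mu R x) (cnj_form (mu R) x) u v w"
    by (simp only: ph_facts(1) mult_1_right)
  also have "\<dots> \<noteq> 0"
    using W shear[OF x] fst_carrier(3)[OF z] by simp
  finally show ?thesis using that by blast
qed

text \<open>Expansion along a vertical vector y: the first three forms are multiples of pullbacks
  from M and vanish on y, while \<Omega> takes the value of d log \<rho> there.\<close>

lemma om_wedge4:
  assumes z: "z \<in> carrier PA"
  shows "\<exists>u v w y. wedge4 (om z) (om1 z) (cnj_form om1 z) (Om z) u v w y \<noteq> 0"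
proof -
  obtain u v w where W: "wedge3 (om z) (om1 z) (cnj_form om1 z) u v w \<noteq> 0" using om_frame[OF z] .
  obtain y where y: "mderiv PA A fst z y = 0" "dlog z y \<noteq> 0" using vertical_vector[OF z] .
  have x: "fst z \<in> U" using fst_carrier(2)[OF z] .
  have 0: "om z y = 0" "om1 z y = 0" "cnj_form om1 z y = 0"
    using linear_0[OF form_in_linear[OF lam_form x]] linear_0[OF form_in_linear[OF mu_form x]]
    by (simp_all add: form_omega_def form_omega1_def pullback_def y cnj_form_def)
  have "Om z y = dlog z y"
    using linear_0[OF form_in_linear[OF red_Omega_form x]] by (simp add: Om_eq[OF z] pullback_def y)
  then have "wedge4 (om z) (om1 z) (cnj_form om1 z) (Om z) u v w y
      = dlog z y * wedge3 (om z) (om1 z) (cnj_form om1 z) u v w"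
    by (simp add: wedge4_def wedge3_def wedge_def 0 algebra_simps)
  then show ?thesis using W y by (metis mult_eq_0_iff)
qed

text \<open>The extra term in d (\<rho> \<nu>) = \<rho> (d log \<rho> \<and> \<nu> + d\<nu>)
  completes \<open>red_Omega\<close> to \<Omega>. On the right sides each \<nu> or \<nu>bar is a
  form on P divided by \<rho>: this gives the weights 1/\<rho> of \<open>P_T1\<close> and
  \<open>P_K1\<close>, 1/\<rho>^2 of \<open>P_K0\<close>, and none for \<open>P_T0\<close>, whose
  equation has degree one in \<nu> on both sides.\<close>

lemma P_structure:
  "structure_equations PA om om1 Om (P_T0 A R \<psi> \<epsilon>) (P_T1 A R \<psi> \<epsilon>) (P_K0 A R \<psi>) (P_K1 A R \<psi> \<epsilon>)"
proof (rule structure_equationsI)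
  fix z u v assume z: "z \<in> carrier PA"
  show "P_T0 A R \<psi> \<epsilon> z \<in> \<real>" "P_K0 A R \<psi> z \<in> \<real>"
    using T0_real k0_real fst_carrier(2)[OF z] by (simp_all add: Reals_cnj_iff P_T0_def P_K0_def)
  define x where "x = fst z"
  define r where "r = complex_of_real (snd z)"
  define D where "D = mderiv PA A fst z"
  have x: "x \<in> U" using fst_carrier(2)[OF z] by (simp add: x_def)
  have r: "r \<noteq> 0" "cnj r = r" using fst_carrier(3)[OF z] by (simp_all add: r_def)
  define w where "w = (\<lambda>v. red_omega R \<epsilon> x (D v))"
  define n where "n = (\<lambda>v. red_omega1 R \<psi> \<epsilon> x (D v))"
  define th where "th = (\<lambda>v. red_Omega A R \<psi> \<epsilon> x (D v))"
  have w: "om z v = w v" and n: "om1 z v = r * n v" and nb: "cnj_form om1 z v = r * cnj (n v)"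
    and th: "Om z v = dlog z v + th v" for v
    using Om_eq[OF z] r(2)
    by (simp_all add: om_eq om1_eq w_def n_def th_def pullback_def x_def r_def D_def cnj_form_def)
  have wr: "cnj (w v) = w v" and thr: "cnj (th v) = th v" for v
    using red_omega_real[OF x] red_Omega_real[OF x] by (simp_all add: w_def th_def)
  have dw: "ext_d PA om z u v = t1 A R \<psi> \<epsilon> x * (n u * w v - n v * w u)
      + cnj (t1 A R \<psi> \<epsilon> x) * (cnj (n u) * w v - cnj (n v) * w u)"
    unfolding om_eq ext_d_fst[OF red_omega_form z] x_def[symmetric] D_def[symmetric]
        ext_d_red_omega[OF x]
    by (simp add: wedge_def w_def n_def cnj_form_def)
  have dn: "ext_d PA om1 z u v = r * dlog z u * n v - r * dlog z v * n u
      + r * (th u * n v - th v * n u + ((n u + cnj (n u)) * w v - (n v + cnj (n v)) * w u)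
        + \<i> * T0 A R \<psi> \<epsilon> x * (n u * w v - n v * w u))"
    unfolding om1_eq pr.M.ext_d_scale[OF r_smooth form_in_fst[OF red_omega1_form] z] dlog_eq[OF z]
      ext_d_fst[OF red_omega1_form z] x_def[symmetric] D_def[symmetric] ext_d_red_omega1[OF x]
    by (simp add: wedge_def w_def n_def th_def cnj_form_def r_def pullback_def D_def x_def)
  have Om_cong: "ext_d PA Om z u v
      = ext_d PA (\<lambda>z v. dlog z v + pullback PA A fst (red_Omega A R \<psi> \<epsilon>) z v) z u v"
    by (rule pr.M.ext_d_cong[OF Om_eq z])
  have dth: "ext_d PA Om z u v = \<i> * k0 A R \<psi> x / 2 * (n u * cnj (n v) - n v * cnj (n u))
      + k1 A R \<psi> \<epsilon> x / 2 * (n u * w v - n v * w u)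
      + cnj (k1 A R \<psi> \<epsilon> x) / 2 * (cnj (n u) * w v - cnj (n v) * w u)"
    unfolding Om_cong pr.M.ext_d_add[OF dlog_form form_in_fst[OF red_Omega_form] z] ext_d_dlog[OF z]
      ext_d_fst[OF red_Omega_form z] x_def[symmetric] D_def[symmetric] ext_d_red_Omega[OF x]
    by (simp add: wedge_def w_def n_def cnj_form_def)
  have T1: "P_T1 A R \<psi> \<epsilon> z * r = t1 A R \<psi> \<epsilon> x" "cnj (P_T1 A R \<psi> \<epsilon> z) * r = cnj (t1 A R \<psi> \<epsilon> x)"
    and K1: "P_K1 A R \<psi> \<epsilon> z * r = k1 A R \<psi> \<epsilon> x / 2" "cnj (P_K1 A R \<psi> \<epsilon> z) * r = cnj (k1 A R \<psi> \<epsilon> x) / 2"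
    and K0: "P_K0 A R \<psi> z * (r * r) = k0 A R \<psi> x / 2" and T0: "P_T0 A R \<psi> \<epsilon> z = T0 A R \<psi> \<epsilon> x"
    using r by (simp_all add: P_T1_def P_K1_def P_K0_def P_T0_def x_def r_def power2_eq_square)
  have T0r: "cnj (T0 A R \<psi> \<epsilon> x) = T0 A R \<psi> \<epsilon> x" by (rule T0_real[OF x])
  have dnb: "ext_d PA (cnj_form om1) z u v = cnj (ext_d PA om1 z u v)"
    by (rule pr.M.ext_d_cnj[OF om1_form z])
  show "ext_d PA om z u v = P_T1 A R \<psi> \<epsilon> z * (om1 z \<and>\<^sub>1 om z) u v
      + cnj (P_T1 A R \<psi> \<epsilon> z) * (cnj_form om1 z \<and>\<^sub>1 om z) u v"
    unfolding dw wedge_def w n nb T1[symmetric] by (simp add: algebra_simps r(2))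
  show "ext_d PA om1 z u v = (Om z \<and>\<^sub>1 om1 z) u v + ((\<lambda>v. om1 z v + cnj_form om1 z v) \<and>\<^sub>1 om z) u v
      + \<i> * P_T0 A R \<psi> \<epsilon> z * (om1 z \<and>\<^sub>1 om z) u v"
    unfolding dn wedge_def w n nb th T0 by (simp add: algebra_simps)
  show "ext_d PA (cnj_form om1) z u v = (Om z \<and>\<^sub>1 cnj_form om1 z) u v
      + ((\<lambda>v. om1 z v + cnj_form om1 z v) \<and>\<^sub>1 om z) u v
      - \<i> * P_T0 A R \<psi> \<epsilon> z * (cnj_form om1 z \<and>\<^sub>1 om z) u v"
    unfolding dnb dn wedge_def w n nb th T0
    by (simp add: wr thr T0r r(2) dlog_real[OF z] algebra_simps)
  have "\<i> * k0 A R \<psi> x / 2 = \<i> * (P_K0 A R \<psi> z * (r * r))" by (simp add: K0)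
  then show "ext_d PA Om z u v = \<i> * P_K0 A R \<psi> z * (om1 z \<and>\<^sub>1 cnj_form om1 z) u v
      + P_K1 A R \<psi> \<epsilon> z * (om1 z \<and>\<^sub>1 om z) u v
      + cnj (P_K1 A R \<psi> \<epsilon> z) * (cnj_form om1 z \<and>\<^sub>1 om z) u v"
    unfolding dth wedge_def w n nb K1[symmetric] by (simp only:) (simp add: algebra_simps r(2))
qed

lemma P_invariants_smooth:
  "smooth_in PA (carrier PA) (P_T0 A R \<psi> \<epsilon>)" "smooth_in PA (carrier PA) (P_T1 A R \<psi> \<epsilon>)"
  "smooth_in PA (carrier PA) (P_K0 A R \<psi>)" "smooth_in PA (carrier PA) (P_K1 A R \<psi> \<epsilon>)"
proof -
  have nz: "complex_of_real (snd z) \<noteq> 0" if "z \<in> carrier PA" for z using fst_carrier(3)[OF that] by simp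
  note sm = pr.M.smooth_in_divide pr.M.smooth_in_mult pr.M.smooth_in_const r_smooth
      invariants_smooth[THEN smooth_in_fst]
  show "smooth_in PA (carrier PA) (P_T0 A R \<psi> \<epsilon>)"
    unfolding P_T0_def[abs_def] by (intro sm)
  show "smooth_in PA (carrier PA) (P_T1 A R \<psi> \<epsilon>)"
    unfolding P_T1_def[abs_def] by (intro sm nz)
  show "smooth_in PA (carrier PA) (P_K0 A R \<psi>)"
    unfolding P_K0_def[abs_def] power2_eq_square by (intro sm) (use nz in auto)
  show "smooth_in PA (carrier PA) (P_K1 A R \<psi> \<epsilon>)"
    unfolding P_K1_def[abs_def] by (intro sm) (use nz in auto)
qed

end

section \<open>Uniqueness of solutions of the structure equations\<close>

text \<open>The first identity says X = i t w modulo n, the second X = - i t w modulo n'.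
  Subtracting gives a linear relation with coefficient 2 i t at w, and w, n, n' are independent. The
  opposite signs are essential: were they equal, X = i t w would be a solution.\<close>

lemma connection_unique:
  assumes W: "wedge3 w n n' u0 v0 w0 \<noteq> 0"
    and 1: "\<And>u v. (X \<and>\<^sub>1 n) u v = \<i> * t * (w \<and>\<^sub>1 n) u v"
    and 2: "\<And>u v. (X \<and>\<^sub>1 n') u v = - \<i> * t * (w \<and>\<^sub>1 n') u v"
  shows "t = 0" "X v = 0"
proof -
  have "\<exists>p. n p \<noteq> 0" by (rule ccontr) (use W in \<open>simp add: wedge3_def wedge_def\<close>)
  moreover have "\<exists>q. n' q \<noteq> 0" by (rule ccontr) (use W in \<open>simp add: wedge3_def wedge_def\<close>)
  ultimately obtain p q where p: "n p \<noteq> 0" and q: "n' q \<noteq> 0" by blast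
  define k where "k = (X p - \<i> * t * w p) / n p"
  define k' where "k' = (X q + \<i> * t * w q) / n' q"
  have X: "X u = \<i> * t * w u + k * n u" for u
    using 1[of u p] p by (simp add: k_def wedge_def field_simps)
  have X': "X u = - \<i> * t * w u + k' * n' u" for u
    using 2[of u q] q by (simp add: k'_def wedge_def field_simps)
  have "0 = (2 * \<i> * t) * w u + k * n u + (- k') * n' u" for u
    using X[of u] X'[of u] by (simp add: algebra_simps)
  from wedge3_combination[where \<phi> = "\<lambda>_. 0" and a = w and b = n and c = n' and u = u0 and v = v0
      and w = w0, OF this] W
  have "t = 0" "k = 0" by (auto simp: wedge3_def wedge_def)
  then show "t = 0" "X v = 0" using X by auto
qed

text \<open>Pullbacks and explicit formulas are known to agree on the carrier only; exterior
  derivatives there are local, so this is enough.\<close>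

lemma structure_equations_cong:
  assumes P: "open_submanifold P (carrier P)"
    and eq: "\<And>z. z \<in> carrier P \<Longrightarrow> \<omega> z = \<omega>' z" "\<And>z. z \<in> carrier P \<Longrightarrow> \<omega>1 z = \<omega>1' z"
    and S: "structure_equations P \<omega> \<omega>1 \<Omega> F0 F1 G0 G1"
  shows "structure_equations P \<omega>' \<omega>1' \<Omega> F0 F1 G0 G1"
proof -
  interpret open_submanifold P "carrier P" by fact
  have c: "cnj_form \<omega>1 z = cnj_form \<omega>1' z" if "z \<in> carrier P" for z
    using eq(2)[OF that] by (simp add: cnj_form_def)
  have d: "ext_d P \<omega> z u v = ext_d P \<omega>' z u v" "ext_d P \<omega>1 z u v = ext_d P \<omega>1' z u v"
    "ext_d P (cnj_form \<omega>1) z u v = ext_d P (cnj_form \<omega>1') z u v" if "z \<in> carrier P" for z u v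
    by (rule ext_d_cong[OF _ that], simp only: eq c)+
  show ?thesis
    by (rule structure_equationsI)
      (simp_all only: d[symmetric] eq[symmetric] c[symmetric] structure_equationsD[OF S])
qed

lemma structure_equations_unique:
  assumes P: "open_submanifold P (carrier P)"
    and frame: "\<And>z. z \<in> carrier P \<Longrightarrow> \<exists>u v w. wedge3 (\<omega> z) (\<omega>1 z) (cnj_form \<omega>1 z) u v w \<noteq> 0"
    and S: "structure_equations P \<omega> \<omega>1 \<Omega> F0 F1 G0 G1" "structure_equations P \<omega> \<omega>1 \<Omega>' F0' F1' G0' G1'"
    and z: "z \<in> carrier P"
  shows "\<Omega> z = \<Omega>' z \<and> F0 z = F0' z \<and> F1 z = F1' z \<and> G0 z = G0' z \<and> G1 z = G1' z"
proof -
  interpret open_submanifold P "carrier P" by fact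
  have \<Omega>: "\<Omega> z = \<Omega>' z \<and> F0 z = F0' z" if z: "z \<in> carrier P" for z
  proof -
    obtain u0 v0 w0 where W: "wedge3 (\<omega> z) (\<omega>1 z) (cnj_form \<omega>1 z) u0 v0 w0 \<noteq> 0" using frame[OF z]
        by blast
    let ?X = "\<lambda>v. \<Omega> z v - \<Omega>' z v" and ?t = "F0 z - F0' z"
    note D = structure_equationsD[OF S(1) z] structure_equationsD[OF S(2) z]
    have h1: "(?X \<and>\<^sub>1 \<omega>1 z) u v = \<i> * ?t * (\<omega> z \<and>\<^sub>1 \<omega>1 z) u v" for u v
      using D(2,8)[of u v] by (simp add: wedge_def algebra_simps)
    have h2: "(?X \<and>\<^sub>1 cnj_form \<omega>1 z) u v = - \<i> * ?t * (\<omega> z \<and>\<^sub>1 cnj_form \<omega>1 z) u v" for u v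
      using D(3,9)[of u v] by (simp add: wedge_def algebra_simps)
    have "?t = 0" "?X v = 0" for v
      using connection_unique[where X = ?X and t = ?t, OF W h1 h2] by auto
    then show ?thesis by (auto simp: fun_eq_iff)
  qed
  obtain u0 v0 w0 where W: "wedge3 (\<omega> z) (\<omega>1 z) (cnj_form \<omega>1 z) u0 v0 w0 \<noteq> 0" using frame[OF z] by blast
  \<comment> \<open>d\<Omega> at z depends on \<Omega> near z, so the equality of the two forms on
    the whole carrier is used here, not only at z.\<close>
  have d: "ext_d P \<Omega> z u v = ext_d P \<Omega>' z u v" for u v
    by (rule ext_d_cong[OF _ z]) (use \<Omega> in auto)
  have "0 * (\<omega>1 z \<and>\<^sub>1 cnj_form \<omega>1 z) u v + F1 z * (\<omega>1 z \<and>\<^sub>1 \<omega> z) u v + cnj (F1 z)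
      * (cnj_form \<omega>1 z \<and>\<^sub>1 \<omega> z) u v
      = 0 * (\<omega>1 z \<and>\<^sub>1 cnj_form \<omega>1 z) u v + F1' z * (\<omega>1 z \<and>\<^sub>1 \<omega> z) u v + cnj (F1' z)
          * (cnj_form \<omega>1 z \<and>\<^sub>1 \<omega> z) u v" for u v
    using structure_equationsD(1)[OF S(1) z] structure_equationsD(1)[OF S(2) z] by simp
  from wedge_coeffs_unique(2)[OF W this] have F1: "F1 z = F1' z" .
  have G: "(\<i> * G0 z) * (\<omega>1 z \<and>\<^sub>1 cnj_form \<omega>1 z) u v + G1 z * (\<omega>1 z \<and>\<^sub>1 \<omega> z) u v + cnj (G1 z)
      * (cnj_form \<omega>1 z \<and>\<^sub>1 \<omega> z) u v
      = (\<i> * G0' z) * (\<omega>1 z \<and>\<^sub>1 cnj_form \<omega>1 z) u v + G1' z * (\<omega>1 z \<and>\<^sub>1 \<omega> z) u v + cnj (G1' z)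
          * (cnj_form \<omega>1 z \<and>\<^sub>1 \<omega> z) u v" for u v
    using structure_equationsD(4)[OF S(1) z] structure_equationsD(4)[OF S(2) z] d by simp
  from wedge_coeffs_unique(1,2)[OF W G] have "G0 z = G0' z" "G1 z = G1' z" by auto
  with \<Omega>[OF z] F1 show ?thesis by blast
qed

text \<open>Since \<open>\<sigma>\<^sup>2 = 1\<close> forces \<open>d \<sigma> = 0\<close>, no connectedness is needed here.\<close>

lemma structure_equations_sign:
  assumes P: "open_submanifold P (carrier P)" and f: "form_in P (carrier P) \<omega>1"
    and \<sigma>: "smooth_in P (carrier P) \<sigma>" "\<And>z. z \<in> carrier P \<Longrightarrow> \<sigma> z = 1 \<or> \<sigma> z = -1"
    and S: "structure_equations P \<omega> \<omega>1 \<Omega> F0 F1 G0 G1"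
  shows "structure_equations P \<omega> (\<lambda>z v. \<sigma> z * \<omega>1 z v) \<Omega> F0 (\<lambda>z. \<sigma> z * F1 z) G0 (\<lambda>z. \<sigma> z * G1 z)"
proof -
  interpret open_submanifold P "carrier P" by fact
  have \<sigma>d: "d_fun P \<sigma> z v = 0" if z: "z \<in> carrier P" for z v
  proof -
    have "d_fun P (\<lambda>z. \<sigma> z * \<sigma> z) z = d_fun P (\<lambda>z. 1) z"
      by (rule d_fun_cong[OF _ z]) (use \<sigma>(2) in fastforce)
    then have "2 * \<sigma> z * d_fun P \<sigma> z v = 0"
      using d_fun_mult[OF \<sigma>(1) \<sigma>(1) z, of v] d_fun_const[of 1 z v] by simp
    then show ?thesis using \<sigma>(2)[OF z] by auto
  qed
  have c: "cnj_form (\<lambda>z v. \<sigma> z * \<omega>1 z v) z v = \<sigma> z * cnj_form \<omega>1 z v" if "z \<in> carrier P" for z v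
    using \<sigma>(2)[OF that] by (auto simp: cnj_form_def)
  have d: "ext_d P (\<lambda>z v. \<sigma> z * \<omega>1 z v) z u v = \<sigma> z * ext_d P \<omega>1 z u v"
    "ext_d P (cnj_form (\<lambda>z v. \<sigma> z * \<omega>1 z v)) z u v = \<sigma> z * ext_d P (cnj_form \<omega>1) z u v"
    if z: "z \<in> carrier P" for z u v
    using ext_d_scale[OF \<sigma>(1) f z] ext_d_scale[OF \<sigma>(1) form_in_cnj[OF f] z] \<sigma>d[OF z]
      ext_d_cong[of "cnj_form (\<lambda>z v. \<sigma> z * \<omega>1 z v)" "\<lambda>z v. \<sigma> z * cnj_form \<omega>1 z v", OF c z]
    by simp_all
  show ?thesis
  proof (rule structure_equationsI)
    fix z u v assume z: "z \<in> carrier P"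
    note D = structure_equationsD(1-4)[OF S z, of u v, unfolded wedge_def]
    show "F0 z \<in> \<real>" "G0 z \<in> \<real>" using structure_equationsD(5,6)[OF S z] by auto
    note cz = c[OF z]
    show "ext_d P \<omega> z u v = \<sigma> z * F1 z * ((\<lambda>v. \<sigma> z * \<omega>1 z v) \<and>\<^sub>1 \<omega> z) u v
        + cnj (\<sigma> z * F1 z) * (cnj_form (\<lambda>z v. \<sigma> z * \<omega>1 z v) z \<and>\<^sub>1 \<omega> z) u v"
      using \<sigma>(2)[OF z] unfolding D wedge_def cz by (auto simp: algebra_simps)
    show "ext_d P (\<lambda>z v. \<sigma> z * \<omega>1 z v) z u v = (\<Omega> z \<and>\<^sub>1 (\<lambda>v. \<sigma> z * \<omega>1 z v)) u v
      + ((\<lambda>v. \<sigma> z * \<omega>1 z v + cnj_form (\<lambda>z v. \<sigma> z * \<omega>1 z v) z v) \<and>\<^sub>1 \<omega> z) u v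
      + \<i> * F0 z * ((\<lambda>v. \<sigma> z * \<omega>1 z v) \<and>\<^sub>1 \<omega> z) u v"
      unfolding d[OF z] D wedge_def cz by (simp add: algebra_simps)
    show "ext_d P (cnj_form (\<lambda>z v. \<sigma> z * \<omega>1 z v)) z u v = (\<Omega> z \<and>\<^sub>1 cnj_form (\<lambda>z v. \<sigma> z * \<omega>1 z v) z) u v
      + ((\<lambda>v. \<sigma> z * \<omega>1 z v + cnj_form (\<lambda>z v. \<sigma> z * \<omega>1 z v) z v) \<and>\<^sub>1 \<omega> z) u v
      - \<i> * F0 z * (cnj_form (\<lambda>z v. \<sigma> z * \<omega>1 z v) z \<and>\<^sub>1 \<omega> z) u v"
      unfolding d[OF z] D wedge_def cz by (simp add: algebra_simps)
    show "ext_d P \<Omega> z u v = \<i> * G0 z * ((\<lambda>v. \<sigma> z * \<omega>1 z v) \<and>\<^sub>1 cnj_form (\<lambda>z v. \<sigma> z * \<omega>1 z v) z) u v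
      + \<sigma> z * G1 z * ((\<lambda>v. \<sigma> z * \<omega>1 z v) \<and>\<^sub>1 \<omega> z) u v
      + cnj (\<sigma> z * G1 z) * (cnj_form (\<lambda>z v. \<sigma> z * \<omega>1 z v) z \<and>\<^sub>1 \<omega> z) u v"
      using \<sigma>(2)[OF z] unfolding D wedge_def cz by (auto simp: algebra_simps)
  qed
qed

lemma (in manifold_map) structure_equations_pullback:
  assumes f: "form_in B (carrier B) \<omega>" "form_in B (carrier B) \<omega>1" "form_in B (carrier B) \<Omega>"
    and S: "structure_equations B \<omega> \<omega>1 \<Omega> F0 F1 G0 G1"
  shows "structure_equations A (pullback A B F \<omega>) (pullback A B F \<omega>1) (pullback A B F \<Omega>)
    (F0 \<circ> F) (F1 \<circ> F) (G0 \<circ> F) (G1 \<circ> F)"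
proof -
  have c: "cnj_form (pullback A B F \<omega>1) = pullback A B F (cnj_form \<omega>1)"
    by (simp add: cnj_form_def pullback_def)
  note d = ext_d_pullback[OF N.open_U order_refl _ _ map_carrier]
  show ?thesis
  proof (rule structure_equationsI)
    fix z u v assume z: "z \<in> carrier A"
    note D = structure_equationsD[OF S map_carrier[OF z]]
    show "(F0 \<circ> F) z \<in> \<real>" "(G0 \<circ> F) z \<in> \<real>" using D by auto
  qed (simp_all only: c, simp_all only: d f N.form_in_cnj[OF f(2)] structure_equationsD(1-4)[OF S
      map_carrier],
      simp_all add: wedge_def pullback_def)
qed

section \<open>Change of representative\<close>

lemma nonvanishing_sign:
  fixes f :: "'a::topological_space \<Rightarrow> real"
  assumes "connected S" "continuous_on S f" "\<And>x. x \<in> S \<Longrightarrow> f x \<noteq> 0"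
  shows "(\<forall>x\<in>S. 0 < f x) \<or> (\<forall>x\<in>S. f x < 0)"
proof (rule ccontr)
  assume "\<not> ?thesis"
  then obtain x y where xy: "x \<in> S" "y \<in> S" "f x < 0" "0 < f y"
    using assms(3) by (meson linorder_neqE_linordered_idom)
  have "connected (f ` S)" using connected_continuous_image assms by blast
  then have "0 \<in> f ` S"
    using connectedD_interval[of "f ` S" "f x" "f y" 0] xy by auto
  then show False using assms(3) by auto
qed

context manifold_map
begin

text \<open>\<open>inv_into\<close> agrees with an explicit inverse only on the carrier, so
  smoothness of the inverse has to be transferred from a map with the same values there.\<close>

lemma smooth_map_cong:
  assumes "\<And>x. x \<in> carrier A \<Longrightarrow> G x = F x"
  shows "smooth_map A B G"
  unfolding smooth_map_def
proof (intro conjI ballI)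
  show "G ` carrier A \<subseteq> carrier B" using assms map_carrier by auto
  show "continuous_on (carrier A) G"
    using map_smooth assms unfolding smooth_map_def by (metis continuous_on_cong)
  fix c c' assume c: "c \<in> A" "c' \<in> B"
  then have e: "G x = F x" if "x \<in> fst c" for x using assms that by (auto simp: carrier_def)
  then have eq: "fst c \<inter> G -` fst c' = fst c \<inter> F -` fst c'" by auto
  show "smooth_on (snd c ` (fst c \<inter> G -` fst c')) (snd c' \<circ> G \<circ> inv_chart c)"
    unfolding eq
    by (subst smooth_on_cong[OF chart_map_domain[OF c(1) N.chart_open[OF c(2)]], of _ "chart_map c c'"])
      (use chart_map_smooth[OF c] e c in auto)
qed

end

section \<open>Scalings of the fibre coordinate\<close>

definition fibre_scale :: "('m \<Rightarrow> real) \<Rightarrow> 'm \<times> real \<Rightarrow> 'm \<times> real" where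
  "fibre_scale \<kappa> z = (fst z, snd z * \<kappa> (fst z))"

context product_bundle
begin

lemma fibre_scale_carrier:
  "(\<And>x. x \<in> U \<Longrightarrow> 0 < \<kappa> x) \<Longrightarrow> z \<in> carrier PA \<Longrightarrow> fibre_scale \<kappa> z \<in> carrier PA"
  by (auto simp: carrier_P fibre_scale_def)

lemma fibre_scale_smooth:
  assumes \<kappa>: "smooth_in A U \<kappa>" "\<And>x. x \<in> U \<Longrightarrow> 0 < \<kappa> x"
  shows "smooth_map PA PA (fibre_scale \<kappa>)"
  unfolding smooth_map_def
proof (intro conjI ballI)
  show "fibre_scale \<kappa> ` carrier PA \<subseteq> carrier PA" using fibre_scale_carrier[of \<kappa>] \<kappa>(2) by auto
  have "continuous_on (U \<times> {0<..}) (\<lambda>z. (fst z, snd z * \<kappa> (fst z)))"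
    by (intro continuous_on_Pair continuous_on_mult continuous_intros
        continuous_on_compose2[OF smooth_in_continuous_on[OF \<kappa>(1)]]) auto
  then show "continuous_on (carrier PA) (fibre_scale \<kappa>)"
    unfolding carrier_P fibre_scale_def[abs_def] .
  fix d d' assume "d \<in> PA" "d' \<in> PA"
  then obtain c c' where c: "c \<in> A" "d = lift_chart U c" and c': "c' \<in> A" "d' = lift_chart U c'"
    by (auto simp: P_atlas_eq)
  let ?S = "snd c ` (fst c \<inter> (fst c' \<inter> U))"
  have eq: "fst d \<inter> fibre_scale \<kappa> -` fst d' = (fst c \<inter> (fst c' \<inter> U)) \<times> {0<..}"
    using c c' \<kappa>(2) by (auto simp: fibre_scale_def)
  have S: "open ?S" by (intro chart_image_open open_Int chart_open c(1) c'(1) open_U)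
  have S2: "open (?S \<times> {0::real<..})" using S by (intro open_Times) auto
  have s1: "smooth_on ?S (snd c' \<circ> inv_chart c)"
    by (rule smooth_on_subset[OF transition_smooth[OF c(1) c'(1)]]) auto
  have s2: "smooth_on ?S (\<kappa> \<circ> inv_chart c)"
    by (rule smooth_on_subset[of "snd c ` (fst c \<inter> U)"]) (use \<kappa>(1) c in \<open>auto simp: smooth_in_def\<close>)
  note smooth_on_Pair[OF S2 smooth_on_comp_fst[OF s1 S open_greaterThan]
      smooth_on_mult[OF S2 smooth_on_snd[OF S2] smooth_on_comp_fst[OF s2 S open_greaterThan]]]
  then have "smooth_on (?S \<times> {0<..}) (snd d' \<circ> fibre_scale \<kappa> \<circ> inv_chart d)"
    by (subst smooth_on_cong[OF S2]) (use lift_inv[OF c(1)] c c' in \<open>auto simp: fibre_scale_def\<close>)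
  then show "smooth_on (snd d ` (fst d \<inter> fibre_scale \<kappa> -` fst d')) (snd d' \<circ> fibre_scale \<kappa> \<circ>
      inv_chart d)"
    unfolding eq by (simp add: c(2) lift_chart_image del: lift_chart_simps(2))
qed

lemma fibre_scale_diffeomorphism:
  assumes \<kappa>: "smooth_in A U \<kappa>" "\<And>x. x \<in> U \<Longrightarrow> 0 < \<kappa> x"
  shows "diffeomorphism PA PA (fibre_scale \<kappa>)"
proof -
  let ?i = "fibre_scale (\<lambda>x. 1 / \<kappa> x)"
  have i: "smooth_map PA PA ?i"
    using \<kappa> by (intro fibre_scale_smooth smooth_in_divide smooth_in_const) (auto simp:
        less_imp_neq[THEN not_sym])
  have inv: "?i (fibre_scale \<kappa> z) = z" "fibre_scale \<kappa> (?i z) = z" if "z \<in> carrier PA" for z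
    using \<kappa>(2)[of "fst z"] that by (auto simp: fibre_scale_def carrier_P)
  have car: "fibre_scale \<kappa> z \<in> carrier PA" "?i z \<in> carrier PA" if "z \<in> carrier PA" for z
    using fibre_scale_carrier[OF _ that, of \<kappa>] fibre_scale_carrier[OF _ that, of "\<lambda>x. 1 / \<kappa> x"] \<kappa>(2)
        by auto
  have bij: "bij_betw (fibre_scale \<kappa>) (carrier PA) (carrier PA)"
    by (rule bij_betw_byWitness[where f' = ?i]) (use inv car in auto)
  interpret I: manifold_map PA PA ?i
    by unfold_locales (rule i)
  have "smooth_map PA PA (inv_into (carrier PA) (fibre_scale \<kappa>))"
  proof (rule I.smooth_map_cong)
    fix z assume z: "z \<in> carrier PA"
    show "inv_into (carrier PA) (fibre_scale \<kappa>) z = ?i z"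
      by (rule inv_into_f_eq) (use bij z inv car in \<open>auto simp: bij_betw_def\<close>)
  qed
  then show ?thesis
    unfolding diffeomorphism_def using bij fibre_scale_smooth[OF \<kappa>] by blast
qed

text \<open>The chain rule for \<open>fst \<circ> F = fst\<close>. Consequently a form pulled back
  from M is unchanged by F, apart from coefficients that involve \<rho>.\<close>

lemma mderiv_fibre_scale:
  assumes F: "smooth_map PA PA F" "\<And>z. fst (F z) = fst z" and z: "z \<in> carrier PA"
  shows "mderiv PA A fst (F z) (mderiv PA PA F z v) = mderiv PA A fst z v"
proof -
  interpret F: manifold_map PA PA F by unfold_locales (rule F(1))
  let ?d = "chart_at PA (F z)" and ?c = "chart_at A (fst (F z))"
  have Fz: "F z \<in> carrier PA" using F.map_carrier z by blast
  have d: "?d \<in> PA" "F z \<in> fst ?d" using pr.M.chart_at_carrier[OF Fz] by auto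
  have c: "?c \<in> A" "fst (F z) \<in> fst ?c" using pr.N.chart_at_carrier[OF pr.map_carrier[OF Fz]] by auto
  have "pr.chart_map ?d ?c differentiable at (snd ?d (F z))"
    by (rule smooth_on_differentiable[OF pr.chart_map_smooth[OF d(1) c(1)]]) (use d c in auto)
  from F.mderiv_comp[where G = fst and C = A, OF z this, of v]
  have "mderiv PA A (fst \<circ> F) z v = mderiv PA A fst (F z) (mderiv PA PA F z v)" .
  moreover have "fst \<circ> F = fst" using F(2) by auto
  ultimately show ?thesis by simp
qed

end

context shear_congruence
begin

lemma ph_square: "cnj (ph x) * cnj (ph x) = cis (\<psi> x) * sg"
proof -
  have "cnj (ph x) * cnj (ph x) = cis (\<psi> x - real \<epsilon> * pi)"
    unfolding cis_cnj cis_mult by (rule arg_cong[where f = cis]) (simp add: field_simps)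
  also have "\<dots> = cis (\<psi> x) * cnj sg" by (simp add: cis_cnj cis_mult)
  finally show ?thesis by (simp only: cis_nat_pi)
qed

end

section \<open>Two representatives of one congruence\<close>

locale coframe_change = shear_congruence A U R \<psi> \<epsilon>
  for A :: "('m::{t2_space,second_countable_topology}, real^3) chart set" and U and R \<psi> \<epsilon> +
  fixes R' :: "'m rep" and f :: "'m \<Rightarrow> real" and h :: "'m \<Rightarrow> complex"
  assumes coframe': "coframe A (lam R', mu R')" and sf': "structure_functions A R'"
    and f_smooth: "smooth_in A U f" and h_smooth: "smooth_in A U h"
    and f_nz: "\<And>x. x \<in> U \<Longrightarrow> f x \<noteq> 0" and h_nz: "\<And>x. x \<in> U \<Longrightarrow> h x \<noteq> 0"
    and lam': "\<And>x v. x \<in> U \<Longrightarrow> lam R' x v = of_real (f x) * lam R x v"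
    and mu': "\<And>x v. x \<in> U \<Longrightarrow> mu R' x v = h x * mu R x v"
begin

text \<open>In d (f \<lambda>) = df \<and> \<lambda> + f d\<lambda> the first term has no \<mu>
  \<and> \<mu>bar component, so the twist is only rescaled.\<close>

lemma twist_change: assumes x: "x \<in> U" shows "tw R' x = 0"
proof -
  have xc: "x \<in> carrier A" using x U_sub by auto
  obtain u0 v0 w0 where W: "wedge3 (lam R x) (mu R x) (cnj_form (mu R) x) u0 v0 w0 \<noteq> 0"
    using frame_nonzero[OF xc] by blast
  note fs = smooth_in_of_real[OF f_smooth]
  define F where "F = complex_of_real (f x)"
  define H where "H = h x"
  have "ext_d A (lam R') x u v = d_fun A (cpx f) x u * lam R x v - d_fun A (cpx f) x v * lam R x u
      + F * ext_d A (lam R) x u v" for u v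
    using ext_d_cong[OF lam' x] ext_d_scale[OF fs lam_form x] by (simp add: F_def)
  moreover have "ext_d A (lam R') x u v = \<i> * of_real (tw R' x)
      * (mu R' x \<and>\<^sub>1 cnj_form (mu R') x) u v + cb R' x * (mu R' x \<and>\<^sub>1 lam R' x) u v
          + cnj (cb R' x) * (cnj_form (mu R') x \<and>\<^sub>1 lam R' x) u v" for u v
    using sf' xc by (auto simp: structure_functions_def Let_def)
  ultimately have "(\<i> * of_real (tw R' x) * H * cnj H) * (mu R x \<and>\<^sub>1 cnj_form (mu R) x) u v
      + (cb R' x * H * F) * (mu R x \<and>\<^sub>1 lam R x) u v + (cnj (cb R' x) * cnj H * F)
          * (cnj_form (mu R) x \<and>\<^sub>1 lam R x) u v
    = 0 * (mu R x \<and>\<^sub>1 cnj_form (mu R) x) u v + (D_mu A R (cpx f) x + F * cb R x)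
        * (mu R x \<and>\<^sub>1 lam R x) u v
      + (D_mub A R (cpx f) x + F * cnj (cb R x)) * (cnj_form (mu R) x \<and>\<^sub>1 lam R x) u v" for u v
    unfolding ext_d_lam[OF x] frame_expand[OF fs x]
    by (simp add: wedge_def cnj_form_def lam'[OF x] mu'[OF x] F_def[symmetric]
        H_def[symmetric] algebra_simps)
  from wedge_coeffs_unique(1)[OF W this] show "tw R' x = 0" using h_nz[OF x] by (simp add: H_def)
qed

text \<open>In d (h \<mu>) the term dh \<and> \<mu> has no \<mu>bar \<and> \<lambda> component, so
  the new shear comes from h s alone; the factors on the left express the new 2-form by the old
  one.\<close>

lemma shear_change:
  assumes x: "x \<in> U"
  shows "cnj (h x) * of_real (f x) * sh R' x = h x * sh R x"
proof -
  have xc: "x \<in> carrier A" using x U_sub by auto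
  obtain u0 v0 w0 where W: "wedge3 (lam R x) (mu R x) (cnj_form (mu R) x) u0 v0 w0 \<noteq> 0"
    using frame_nonzero[OF xc] by blast
  define F where "F = complex_of_real (f x)"
  define H where "H = h x"
  have "ext_d A (mu R') x u v = d_fun A h x u * mu R x v - d_fun A h x v * mu R x u + H
      * ext_d A (mu R) x u v" for u v
    using ext_d_cong[OF mu' x] ext_d_scale[OF h_smooth mu_form x] by (simp add: H_def)
  moreover have "ext_d A (mu R') x u v = cp R' x * (mu R' x \<and>\<^sub>1 cnj_form (mu R') x) u v + cq R' x
      * (mu R' x \<and>\<^sub>1 lam R' x) u v
          + sh R' x * (cnj_form (mu R') x \<and>\<^sub>1 lam R' x) u v" for u v
    using sf' xc by (auto simp: structure_functions_def Let_def)
  ultimately have "(cp R' x * H * cnj H) * (mu R x \<and>\<^sub>1 cnj_form (mu R) x) u v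
      + (cq R' x * H * F) * (mu R x \<and>\<^sub>1 lam R x) u v + (sh R' x * cnj H * F)
          * (cnj_form (mu R) x \<and>\<^sub>1 lam R x) u v
    = (H * cp R x - D_mub A R h x) * (mu R x \<and>\<^sub>1 cnj_form (mu R) x) u v + (H * cq R x
        - D_lam A R h x) * (mu R x \<and>\<^sub>1 lam R x) u v
      + (H * sh R x) * (cnj_form (mu R) x \<and>\<^sub>1 lam R x) u v" for u v
    unfolding ext_d_mu[OF x] frame_expand[OF h_smooth x]
    by (simp add: wedge_def cnj_form_def lam'[OF x] mu'[OF x] F_def[symmetric]
        H_def[symmetric] algebra_simps)
  from wedge_coeffs_unique(3)[OF W this] show "cnj (h x) * of_real (f x) * sh R' x = h x * sh R x"
    by (simp add: F_def H_def mult_ac)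
qed

lemma shear_nz': "x \<in> U \<Longrightarrow> sh R' x \<noteq> 0"
  using shear_change[of x] shear[of x] h_nz[of x] by auto

lemma shear_abs_change: "x \<in> U \<Longrightarrow> cmod (sh R' x) * \<bar>f x\<bar> = cmod (sh R x)"
  using arg_cong[OF shear_change[of x], of cmod] h_nz[of x] by (simp add: norm_mult mult_ac)

text \<open>The sign \<sigma> is a function on U rather than a constant, so that the notion makes
  sense over a disconnected U.\<close>

definition gauge_map :: "('m \<Rightarrow> real) \<Rightarrow> nat \<Rightarrow> ('m \<times> real \<Rightarrow> 'm \<times> real) \<Rightarrow> ('m \<Rightarrow> complex) \<Rightarrow> bool" where
  "gauge_map \<psi>' \<epsilon>' F \<sigma> \<longleftrightarrow> (let P = P_atlas A U in
     diffeomorphism P P F \<and> smooth_in A U \<sigma> \<and> (\<forall>x\<in>U. \<sigma> x = 1 \<or> \<sigma> x = -1) \<and>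
     (\<forall>z\<in>carrier P. F z \<in> carrier P \<and> fst (F z) = fst z \<and>
       pullback P P F (form_omega A U R' \<epsilon>') z = form_omega A U R \<epsilon> z \<and>
       pullback P P F (form_omega1 A U R' \<psi>' \<epsilon>') z = (\<lambda>v. \<sigma> (fst z) * form_omega1 A U R \<psi> \<epsilon> z v) \<and>
       pullback P P F (form_Omega A U R' \<psi>' \<epsilon>') z = form_Omega A U R \<psi> \<epsilon> z \<and>
       P_T0 A R' \<psi>' \<epsilon>' (F z) = P_T0 A R \<psi> \<epsilon> z \<and> P_T1 A R' \<psi>' \<epsilon>' (F z) = \<sigma> (fst z) * P_T1 A R \<psi> \<epsilon> z \<and>
       P_K0 A R' \<psi>' (F z) = P_K0 A R \<psi> z \<and> P_K1 A R' \<psi>' \<epsilon>' (F z) = \<sigma> (fst z) * P_K1 A R \<psi> \<epsilon> z))"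

lemma gauge_equivalence:
  assumes branch': "arg_branch A U (sh R') \<psi>'"
    and rel: "\<And>x. x \<in> U \<Longrightarrow> cis (real \<epsilon>' * pi) * sh_abs R' x * of_real (f x) = cis (real \<epsilon> * pi)
        * sh_abs R x"
  shows "\<exists>F \<sigma>. gauge_map \<psi>' \<epsilon>' F \<sigma>"
proof -
  interpret B: shear_bundle A U R \<psi> \<epsilon> by unfold_locales
  interpret B': shear_bundle A U R' \<psi>' \<epsilon>'
    by unfold_locales (use coframe' sf' twist_change shear_nz' branch' in auto)
  define \<kappa> where "\<kappa> x = 1 / cmod (h x)" for x
  define F where "F = fibre_scale \<kappa>"
  \<comment> \<open>The factor that remains between the pulled back form \<omega>1 of the second
    representative and that of the first, with cnj c in place of 1/c.\<close>
  define \<sigma> where "\<sigma> x = of_real (\<kappa> x) * h x * B'.ph x * cnj (ph x)" for x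
  have \<kappa>: "smooth_in A U \<kappa>" "\<And>x. x \<in> U \<Longrightarrow> 0 < \<kappa> x"
    unfolding \<kappa>_def[abs_def] using h_nz
    by (auto intro!: smooth_in_divide smooth_in_const smooth_in_cmod h_smooth)
  have F: "smooth_map B.PA B.PA F" "diffeomorphism B.PA B.PA F"
    unfolding F_def using B.fibre_scale_smooth[OF \<kappa>] B.fibre_scale_diffeomorphism[OF \<kappa>] by auto
  have Ffst: "fst (F z) = fst z" and Fsnd: "snd (F z) = snd z * \<kappa> (fst z)" for z
    by (simp_all add: F_def fibre_scale_def)
  interpret F: manifold_map B.PA B.PA F by unfold_locales (rule F(1))
  have \<sigma>_smooth: "smooth_in A U \<sigma>"
    unfolding \<sigma>_def[abs_def]
    by (intro smooth_in_mult smooth_in_of_real smooth_in_cnj \<kappa> h_smooth ph_smooth B'.ph_smooth)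
  have \<sigma>: "\<sigma> x = 1 \<or> \<sigma> x = -1" if x: "x \<in> U" for x
  proof -
    define H where "H = h x"
    define k where "k = complex_of_real (\<kappa> x)"
    define S where "S = sh_abs R x"
    define S' where "S' = sh_abs R' x"
    define c where "c = ph x"
    define c' where "c' = B'.ph x"
    define a where "a = cis (\<psi> x)"
    define a' where "a' = cis (\<psi>' x)"
    define fx where "fx = complex_of_real (f x)"
    have nz: "H \<noteq> 0" "S \<noteq> 0" using h_nz shear x by (simp_all add: H_def S_def)
    have "H * cnj H = of_real (cmod H) * of_real (cmod H)"
      by (simp add: complex_norm_square[symmetric] power2_eq_square)
    then have k: "k * k * (H * cnj H) = 1"
      using nz by (simp add: k_def \<kappa>_def H_def power2_eq_square)
    have sc: "cnj H * fx * (S' * a') = H * (S * a)"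
      using shear_change[OF x] sh_polar[OF x] B'.sh_polar[OF x]
      by (simp only: H_def fx_def S'_def a'_def S_def a_def)
    have re: "B'.sg * S' * fx = sg * S" using rel[OF x] by (simp only: S'_def fx_def S_def)
    have c1: "cnj c * cnj c = a * sg" unfolding c_def a_def by (rule ph_square)
    have "cnj c' * cnj c' = a' * B'.sg" unfolding c'_def a'_def by (rule B'.ph_square)
    from arg_cong[OF this, of cnj] have "c' * c' = cnj a' * B'.sg"
      by (simp only: complex_cnj_mult complex_cnj_cnj cis_nat_pi(1))
    moreover have "a' * cnj a' = 1" unfolding a'_def by (rule cis_mult_cnj)
    ultimately have c2: "a' * (c' * c') = B'.sg" by (simp only: mult.assoc[symmetric] mult_1_left)
    have sq: "sg * sg = 1" "B'.sg * B'.sg = 1" by (rule cis_nat_pi)+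
    \<comment> \<open>\<open>shear_change\<close> says that h^2 / |h|^2 is f times the quotient of
      the new shear by the old, and \<open>rel\<close> makes c'^2 / c^2 its inverse. Multiplying by
      S cnj H a' avoids divisions.\<close>
    have "(\<sigma> x * \<sigma> x) * (S * cnj H * a') = (k * k * (H * cnj H)) * H * (a' * (c' * c')) * (cnj c
        * cnj c) * S"
      unfolding \<sigma>_def k_def[symmetric] H_def[symmetric] c_def[symmetric] c'_def[symmetric]
          by (simp add: algebra_simps)
    also have "\<dots> = B'.sg * sg * (H * (S * a))" unfolding k c1 c2 by (simp add: algebra_simps)
    also have "\<dots> = sg * cnj H * a' * (B'.sg * S' * fx)" unfolding sc[symmetric]
        by (simp add: algebra_simps)
    also have "\<dots> = (sg * sg) * (S * cnj H * a')" unfolding re by (simp add: algebra_simps)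
    finally have "(\<sigma> x * \<sigma> x) * (S * cnj H * a') = S * cnj H * a'" unfolding sq by simp
    moreover have "S * cnj H * a' \<noteq> 0" using nz by (simp add: a'_def)
    ultimately have "\<sigma> x * \<sigma> x = 1" by (metis mult_cancel_right mult_1_left)
    then show ?thesis by (simp add: square_eq_1_iff)
  qed
  note D = B.mderiv_fibre_scale[OF F(1) Ffst]
  have Fc: "F z \<in> carrier B.PA" if "z \<in> carrier B.PA" for z using F.map_carrier that .
  have om: "pullback B.PA B.PA F B'.om z = B.om z" if z: "z \<in> carrier B.PA" for z
  proof
    fix v
    have x: "fst z \<in> U" using B.fst_carrier(2)[OF z] .
    show "pullback B.PA B.PA F B'.om z v = B.om z v"
      using rel[OF x] unfolding pullback_def[of B.PA B.PA] form_omega_def Ffst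
      unfolding pullback_def Ffst D[OF z] lam'[OF x] mult.assoc[symmetric] by simp
  qed
  have om1: "pullback B.PA B.PA F B'.om1 z = (\<lambda>v. \<sigma> (fst z) * B.om1 z v)" if z: "z \<in> carrier B.PA" for z
  proof
    fix v
    have x: "fst z \<in> U" using B.fst_carrier(2)[OF z] .
    have p: "cnj (ph (fst z)) * ph (fst z) = 1" using ph_facts(1)[of "fst z"]
        by (simp only: mult.commute)
    have "pullback B.PA B.PA F B'.om1 z v
      = of_real (snd z * \<kappa> (fst z)) * B'.ph (fst z) * (h (fst z)
          * mu R (fst z) (mderiv B.PA A fst z v))"
      unfolding pullback_def[of B.PA B.PA] form_omega1_def Ffst Fsnd
      unfolding pullback_def Ffst D[OF z] mu'[OF x] ..
    also have "\<dots> = of_real (snd z * \<kappa> (fst z)) * B'.ph (fst z) * (h (fst z)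
        * mu R (fst z) (mderiv B.PA A fst z v)) * (cnj (ph (fst z)) * ph (fst z))"
      unfolding p by simp
    also have "\<dots> = \<sigma> (fst z) * B.om1 z v"
      unfolding \<sigma>_def form_omega1_def pullback_def of_real_mult by (simp only: mult_ac)
    finally show "pullback B.PA B.PA F B'.om1 z v = \<sigma> (fst z) * B.om1 z v" .
  qed
  have sm\<sigma>: "smooth_in B.PA (carrier B.PA) (\<lambda>z. \<sigma> (fst z))" by (rule B.smooth_in_fst[OF \<sigma>_smooth])
  have \<sigma>P: "\<sigma> (fst z) = 1 \<or> \<sigma> (fst z) = -1" if "z \<in> carrier B.PA" for z
    using \<sigma> B.fst_carrier(2)[OF that] .
  note SE = structure_equations_sign[OF B.pr.M.open_submanifold_axioms B.om1_form sm\<sigma> \<sigma>P B.P_structure]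
  note SE' = structure_equations_cong[OF B.pr.M.open_submanifold_axioms om om1
      F.structure_equations_pullback[OF B'.om_form B'.om1_form B'.Om_form B'.P_structure]]
  have frame: "\<exists>u v w. wedge3 (B.om z) (\<lambda>v. \<sigma> (fst z) * B.om1 z v) (cnj_form (\<lambda>z v. \<sigma> (fst z)
      * B.om1 z v) z) u v w \<noteq> 0"
    if z: "z \<in> carrier B.PA" for z
  proof -
    obtain u v w where W: "wedge3 (B.om z) (B.om1 z) (cnj_form B.om1 z) u v w \<noteq> 0"
        using B.om_frame[OF z] .
    have "wedge3 (B.om z) (\<lambda>v. \<sigma> (fst z) * B.om1 z v) (cnj_form (\<lambda>z v. \<sigma> (fst z) * B.om1 z v) z) u v w
      = wedge3 (B.om z) (B.om1 z) (cnj_form B.om1 z) u v w"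
      using \<sigma>P[OF z] by (auto simp: wedge3_def wedge_def cnj_form_def)
    then show ?thesis using W by metis
  qed
  \<comment> \<open>Two solutions with the same \<omega> and \<omega>1: the pulled back one of the
    second representative and the sign-twisted one of the first. Uniqueness yields \<Omega> and all
    four functions at once.\<close>
  note uniq = structure_equations_unique[OF B.pr.M.open_submanifold_axioms frame SE' SE]
  show ?thesis
    unfolding gauge_map_def Let_def
    by (intro exI[of _ F] exI[of _ \<sigma>] conjI ballI F(2) \<sigma>_smooth \<sigma> Fc Ffst om om1)
      (use uniq in auto)
qed

end

section \<open>Solutions proportional to a given coframe\<close>

context shear_bundle
begin

text \<open>The \<open>\<mu>bar \<and> \<lambda>\<close> component of the second structure equation, isolated by taking the wedge
  product with \<open>\<mu>\<close>.\<close>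

lemma shear_normalization:
  assumes g: "smooth_in PA (carrier PA) g" and z: "z \<in> carrier PA"
    and S: "structure_equations PA (\<lambda>z v. of_real (f z) * pullback PA A fst (lam R) z v)
      (\<lambda>z v. g z * pullback PA A fst (mu R) z v) \<Omega> F0 F1 G0 G1"
  shows "g z * sh R (fst z) = cnj (g z) * of_real (f z)"
proof -
  define x where "x = fst z"
  define D where "D = mderiv PA A fst z"
  have x: "x \<in> U" using fst_carrier(2)[OF z] by (simp add: x_def)
  obtain u0 v0 w0 where W0: "wedge3 (lam R x) (mu R x) (cnj_form (mu R) x) u0 v0 w0 \<noteq> 0"
    using frame_nonzero x U_sub by blast
  obtain u v w where uvw: "D u = u0" "D v = v0" "D w = w0"
    using lift_vector[OF z] unfolding D_def by metis
  define l where "l = (\<lambda>v. lam R x (D v))"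
  define m where "m = (\<lambda>v. mu R x (D v))"
  define n where "n = (\<lambda>v. cnj (m v))"
  define a where "a = g z"
  define fz where "fz = complex_of_real (f z)"
  have W: "wedge3 l m n u v w \<noteq> 0"
    using W0 by (simp add: wedge3_def wedge_def l_def m_def n_def uvw cnj_form_def)
  have E: "d_fun PA g z u * m v - d_fun PA g z v * m u
      + a * (cp R x * (m u * n v - m v * n u) + cq R x * (m u * l v - m v * l u) + sh R x * (n u
          * l v - n v * l u))
    = \<Omega> z u * (a * m v) - \<Omega> z v * (a * m u)
      + ((a * m u + cnj a * n u) * (fz * l v) - (a * m v + cnj a * n v) * (fz * l u))
      + \<i> * F0 z * (a * m u * (fz * l v) - a * m v * (fz * l u))" for u v
    using structure_equationsD(2)[OF S z, of u v]
    unfolding pr.M.ext_d_scale[OF g form_in_fst[OF mu_form] z] ext_d_fst[OF mu_form z]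
    unfolding x_def[symmetric] ext_d_mu[OF x] D_def[symmetric]
    by (simp add: wedge_def cnj_form_def pullback_def x_def[symmetric] D_def[symmetric] a_def fz_def
        l_def m_def n_def)
  \<comment> \<open>In E the unknowns \<Omega>, \<open>F0\<close> and dg occur only in 2-forms
    divisible by m, so the wedge product with m removes them all.\<close>
  have "(a * sh R x - cnj a * fz) * wedge3 l m n u v w = 0"
    using E[of u v] E[of u w] E[of v w] unfolding wedge3_def wedge_def by algebra
  then show ?thesis using W by (simp add: a_def fz_def x_def)
qed

text \<open>Taking moduli in \<open>shear_normalization\<close> with |g| = \<rho> gives |f| = |s|
  and leaves a sign of f, recorded by \<epsilon>; the phase then gives g^2 and leaves a sign of g,
  recorded by the branch. Both signs are constant because U, and with it P, is connected.\<close>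

lemma normalized_coframe_unique:
  assumes conn: "connected U" and f: "smooth_in PA (carrier PA) f" and g: "smooth_in PA (carrier PA) g"
    and gn: "\<And>z. z \<in> carrier PA \<Longrightarrow> cmod (g z) = snd z"
    and S: "structure_equations PA (\<lambda>z v. of_real (f z) * pullback PA A fst (lam R) z v)
      (\<lambda>z v. g z * pullback PA A fst (mu R) z v) \<Omega> F0 F1 G0 G1"
  shows "\<exists>\<epsilon>\<in>{0,1}. \<exists>\<psi>'. arg_branch A U (sh R) \<psi>' \<and> (\<forall>z\<in>carrier PA.
     (\<lambda>v. of_real (f z) * pullback PA A fst (lam R) z v) = form_omega A U R \<epsilon> z \<and>
     (\<lambda>v. g z * pullback PA A fst (mu R) z v) = form_omega1 A U R \<psi>' \<epsilon> z \<and>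
     \<Omega> z = form_Omega A U R \<psi>' \<epsilon> z \<and>
     F0 z = P_T0 A R \<psi>' \<epsilon> z \<and> F1 z = P_T1 A R \<psi>' \<epsilon> z \<and>
     G0 z = P_K0 A R \<psi>' z \<and> G1 z = P_K1 A R \<psi>' \<epsilon> z)"
proof -
  note norm = shear_normalization[OF g _ S]
  have r: "0 < snd z" "fst z \<in> U" if "z \<in> carrier PA" for z using fst_carrier(2,3)[OF that] by auto
  have fabs: "\<bar>f z\<bar> = cmod (sh R (fst z))" if z: "z \<in> carrier PA" for z
    using arg_cong[OF norm[OF z], of cmod] gn[OF z] r[OF z] by (simp add: norm_mult)
  have connP: "connected (carrier PA)" unfolding carrier_P using conn by (intro connected_Times) auto
  have fnz: "f z \<noteq> 0" if z: "z \<in> carrier PA" for z using fabs[OF z] shear[OF r(2)[OF z]] by auto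
  from nonvanishing_sign[OF connP pr.M.smooth_in_continuous_on[OF f] fnz]
  obtain \<epsilon>1 :: nat where \<epsilon>1: "\<epsilon>1 \<in> {0,1}" "\<And>z. z \<in> carrier PA \<Longrightarrow> of_real (f z) = cis (real \<epsilon>1 * pi)
      * sh_abs R (fst z)"
  proof
    assume "\<forall>z\<in>carrier PA. 0 < f z"
    then show ?thesis using that[of 0] fabs by force
  next
    assume "\<forall>z\<in>carrier PA. f z < 0"
    then show ?thesis using that[of 1] fabs by (force simp: abs_if)
  qed
  interpret E: shear_bundle A U R \<psi> \<epsilon>1 by unfold_locales
  \<comment> \<open>The phase of g relative to the standard phase for \<psi>;
    \<open>shear_normalization\<close> makes its square 1.\<close>
  define G where "G z = g z * cnj (E.ph (fst z)) / of_real (snd z)" for z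
  have Gsm: "smooth_in PA (carrier PA) G"
    unfolding G_def[abs_def] using r
    by (intro pr.M.smooth_in_divide pr.M.smooth_in_mult g smooth_in_fst smooth_in_cnj E.ph_smooth
        r_smooth) force
  have G: "G z = 1 \<or> G z = -1" if z: "z \<in> carrier PA" for z
  proof -
    define a where "a = g z"
    define \<rho> where "\<rho> = complex_of_real (snd z)"
    define s where "s = sh_abs R (fst z)"
    define k where "k = cis (\<psi> (fst z))"
    have nz: "\<rho> \<noteq> 0" "s \<noteq> 0" using r[OF z] shear[OF r(2)[OF z]] by (simp_all add: \<rho>_def s_def)
    have aa: "a * cnj a = \<rho> * \<rho>"
      using gn[OF z] by (simp add: a_def \<rho>_def complex_norm_square[symmetric] power2_eq_square)
    have n: "a * (s * k) = cnj a * (E.sg * s)"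
      using norm[OF z] \<epsilon>1(2)[OF z] sh_polar[OF r(2)[OF z]] by (simp only: a_def s_def k_def)
    have "G z * G z * (\<rho> * \<rho> * s) = a * a * (cnj (E.ph (fst z)) * cnj (E.ph (fst z))) * s"
      using nz by (simp add: G_def a_def \<rho>_def field_simps)
    also have "\<dots> = a * (a * (s * k)) * E.sg" unfolding E.ph_square k_def by (simp only: mult_ac)
    also have "\<dots> = (a * cnj a) * (E.sg * E.sg) * s" unfolding n by (simp only: mult_ac)
    also have "\<dots> = 1 * (\<rho> * \<rho> * s)" unfolding aa cis_nat_pi by simp
    finally have "G z * G z = 1" using nz by simp
    then show ?thesis by (simp add: square_eq_1_iff)
  qed
  have "continuous_on (carrier PA) (\<lambda>z. Re (G z))"
    by (intro continuous_intros pr.M.smooth_in_continuous_on[OF Gsm])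
  moreover have "Re (G z) \<noteq> 0" if "z \<in> carrier PA" for z using G[OF that] by auto
  ultimately have "(\<forall>z\<in>carrier PA. 0 < Re (G z)) \<or> (\<forall>z\<in>carrier PA. Re (G z) < 0)"
    by (rule nonvanishing_sign[OF connP])
  then have Gc: "(\<forall>z\<in>carrier PA. G z = 1) \<or> (\<forall>z\<in>carrier PA. G z = -1)"
    using G by force
  have gG: "g z = G z * (of_real (snd z) * E.ph (fst z))" if z: "z \<in> carrier PA" for z
  proof -
    have "G z * (of_real (snd z) * E.ph (fst z)) = g z * (E.ph (fst z) * cnj (E.ph (fst z)))"
      using r[OF z] by (simp add: G_def)
    then show ?thesis by (simp only: ph_facts(1) E.ph_facts(1) mult_1_right)
  qed
  obtain \<psi>1 where \<psi>1: "arg_branch A U (sh R) \<psi>1"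
    "\<And>z. z \<in> carrier PA \<Longrightarrow> g z = of_real (snd z) * cis (- (\<psi>1 (fst z) - real \<epsilon>1 * pi) / 2)"
    using Gc
  proof
    assume "\<forall>z\<in>carrier PA. G z = 1"
    then show ?thesis using that[OF branch] gG by simp
  next
    assume m: "\<forall>z\<in>carrier PA. G z = -1"
    \<comment> \<open>Adding 2 pi to \<psi> shifts the half angle by - pi, so the negative of the
      standard form belongs to another branch for the same shear.\<close>
    let ?\<psi> = "\<lambda>x. \<psi> x + 2 * pi"
    have "arg_branch A U (sh R) ?\<psi>"
      using branch unfolding arg_branch_def smooth_fun_restrict
      by (auto intro: smooth_in_add smooth_in_const simp flip: cis_mult)
    moreover have "cis (- (?\<psi> x - real \<epsilon>1 * pi) / 2) = - E.ph x" for x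
    proof -
      have "- (?\<psi> x - real \<epsilon>1 * pi) / 2 = - (\<psi> x - real \<epsilon>1 * pi) / 2 + - pi" by (simp add: field_simps)
      then have "cis (- (?\<psi> x - real \<epsilon>1 * pi) / 2) = E.ph x * cis (- pi)" by (simp only: cis_mult)
      then show ?thesis by (simp add: cis.ctr complex_eq_iff)
    qed
    ultimately show ?thesis using that[of ?\<psi>] gG m by simp
  qed
  interpret N: shear_bundle A U R \<psi>1 \<epsilon>1 by unfold_locales (use sf no_twist shear \<psi>1(1) in auto)
  have om: "(\<lambda>v. of_real (f z) * pullback PA A fst (lam R) z v) = N.om z" if "z \<in> carrier PA" for z
    by (simp add: form_omega_def \<epsilon>1(2)[OF that])
  have om1: "(\<lambda>v. g z * pullback PA A fst (mu R) z v) = N.om1 z" if "z \<in> carrier PA" for z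
    by (simp add: form_omega1_def \<psi>1(2)[OF that])
  note SE = structure_equations_cong[OF pr.M.open_submanifold_axioms om om1 S]
  have "\<exists>u v w. wedge3 (N.om z) (N.om1 z) (cnj_form N.om1 z) u v w \<noteq> 0" if "z \<in> carrier PA" for z
    using N.om_frame[OF that] by blast
  note uniq = structure_equations_unique[OF pr.M.open_submanifold_axioms this SE N.P_structure]
  show ?thesis
    by (intro bexI[OF _ \<epsilon>1(1)] exI[of _ \<psi>1] conjI \<psi>1(1) ballI om om1) (use uniq in auto)
qed

end

section \<open>Local branches of the phase\<close>

context open_submanifold
begin

text \<open>Dividing by the value at x0 moves the values near x0 into the right half plane, where
  \<open>Ln\<close> is smooth; \<open>Arg\<close> of that value is added back as a constant.\<close>

lemma branch_exists:
  fixes s :: "'m \<Rightarrow> complex"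
  assumes s: "smooth_in A U s" "s x0 \<noteq> 0" "x0 \<in> U"
  shows "\<exists>V \<psi>. open V \<and> x0 \<in> V \<and> V \<subseteq> U \<and> smooth_in A V \<psi> \<and> (\<forall>x\<in>V. s x = of_real (cmod (s x))
      * cis (\<psi> x))"
proof -
  define q where "q x = s x / s x0" for x
  define V where "V = {x \<in> U. 0 < Re (q x)}"
  define \<psi> where "\<psi> x = Arg (s x0) + Im (Ln (q x))" for x
  have qsm: "smooth_in A U q" unfolding q_def[abs_def] by (intro smooth_in_divide smooth_in_const s)
  have "open (U \<inter> (\<lambda>x. Re (q x)) -` {0<..})"
    by (intro continuous_open_preimage open_U open_greaterThan continuous_intros
        smooth_in_continuous_on[OF qsm])
  also have "U \<inter> (\<lambda>x. Re (q x)) -` {0<..} = V" by (auto simp: V_def)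
  finally have V: "open V" "V \<subseteq> U" by (auto simp: V_def)
  interpret V: open_submanifold A V using mfd V U_sub by unfold_locales auto
  have "smooth_in A V q" using qsm V(2) unfolding smooth_in_def by (blast intro: smooth_on_subset)
  then have "smooth_in A V \<psi>"
    unfolding \<psi>_def[abs_def] by (intro V.smooth_in_add V.smooth_in_const V.smooth_in_Im
        V.smooth_in_Ln) (auto simp: V_def)
  moreover have "s x = of_real (cmod (s x)) * cis (\<psi> x)" if "x \<in> V" for x
  proof -
    have q0: "q x \<noteq> 0" using that by (auto simp: V_def)
    have "q x = exp (Ln (q x))" using q0 by simp
    also have "\<dots> = of_real (cmod (q x)) * cis (Im (Ln (q x)))"
      using q0 by (simp add: exp_eq_polar)
    finally have q: "q x = of_real (cmod (q x)) * cis (Im (Ln (q x)))" .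
    have "s x = s x0 * q x" using s by (simp add: q_def)
    also have "\<dots> = (of_real (cmod (s x0)) * cis (Arg (s x0))) * (of_real (cmod (q x))
        * cis (Im (Ln (q x))))"
      using q rcis_cmod_Arg[of "s x0"] by (simp add: rcis_def)
    also have "\<dots> = of_real (cmod (s x0) * cmod (q x)) * cis (\<psi> x)"
      by (simp add: \<psi>_def cis_mult[symmetric])
    also have "cmod (s x0) * cmod (q x) = cmod (s x)" using s by (simp add: q_def norm_divide)
    finally show ?thesis .
  qed
  moreover have "x0 \<in> V" using s by (simp add: V_def q_def)
  ultimately show ?thesis using V by blast
qed

end

lemma carrier_chart: "c \<in> A \<Longrightarrow> fst c \<inter> carrier A = fst c"
  by (auto simp: carrier_def)

lemma smooth_fun_carrier: "smooth_fun A u \<longleftrightarrow> smooth_in A (carrier A) u"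
  by (simp add: smooth_fun_def smooth_in_def carrier_chart)

lemma smooth_in_subset: "smooth_in A U u \<Longrightarrow> V \<subseteq> U \<Longrightarrow> smooth_in A V u"
  unfolding smooth_in_def by (blast intro: smooth_on_subset)

lemma oriented_congruence_related:
  assumes "smooth_manifold A" "oriented_congruence A S" "(l, m) \<in> S" "(l', m') \<in> S"
  obtains f :: "'m::{t2_space,second_countable_topology} \<Rightarrow> real" and h :: "'m \<Rightarrow> complex"
  where "coframe A (l, m)" "coframe A (l', m')" "smooth_fun A f" "smooth_fun A h"
    "\<And>x. x \<in> carrier A \<Longrightarrow> f x \<noteq> 0" "\<And>x. x \<in> carrier A \<Longrightarrow> h x \<noteq> 0"
    "\<And>x v. x \<in> carrier A \<Longrightarrow> l' x v = of_real (f x) * l x v"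
    "\<And>x v. x \<in> carrier A \<Longrightarrow> m' x v = h x * m x v"
proof -
  interpret open_submanifold A "carrier A" by (rule carrier_submanifold[OF assms(1)])
  obtain p where "S = congruence_rel A `` {p}"
    using assms(2) by (auto simp: oriented_congruence_def elim: quotientE)
  moreover obtain l0 m0 where "p = (l0, m0)" by (cases p)
  ultimately have rel: "((l0, m0), (l, m)) \<in> congruence_rel A" "((l0, m0), (l', m')) \<in> congruence_rel A"
    using assms(3,4) by auto
  obtain f1 :: "'m \<Rightarrow> real" and h1 :: "'m \<Rightarrow> complex" where 1: "coframe A (l, m)" "smooth_fun A f1"
      "smooth_fun A h1"
    "\<forall>x\<in>carrier A. f1 x \<noteq> 0 \<and> h1 x \<noteq> 0 \<and> (\<forall>v. l x v = of_real (f1 x) * l0 x v \<and> m x v = h1 x * m0 x v)"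
    using rel(1) unfolding congruence_rel_def by blast
  obtain f2 :: "'m \<Rightarrow> real" and h2 :: "'m \<Rightarrow> complex" where 2: "coframe A (l', m')" "smooth_fun A f2"
      "smooth_fun A h2"
    "\<forall>x\<in>carrier A. f2 x \<noteq> 0 \<and> h2 x \<noteq> 0 \<and> (\<forall>v. l' x v = of_real (f2 x) * l0 x v \<and> m' x v = h2 x
        * m0 x v)"
    using rel(2) unfolding congruence_rel_def by blast
  show ?thesis
  \<comment> \<open>Both pairs are multiples of the pair p that generates the class, so the
    quotients of the factors relate them directly.\<close>
  proof (rule that[of "\<lambda>x. f2 x / f1 x" "\<lambda>x. h2 x / h1 x"])
    show "smooth_fun A (\<lambda>x. f2 x / f1 x)" "smooth_fun A (\<lambda>x. h2 x / h1 x)"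
      using 1 2 unfolding smooth_fun_carrier by (auto intro!: smooth_in_divide)
  qed (use 1 2 in auto)
qed

lemma (in coframe_on) arg_branch_subset:
  assumes "arg_branch A U s \<psi>" "open V" "V \<subseteq> U"
  shows "arg_branch A V s \<psi>"
proof -
  interpret V: open_submanifold A V using assms mfd U_sub by unfold_locales auto
  show ?thesis
    using assms smooth_in_subset[OF _ assms(3)] by (auto simp:
        arg_branch_def smooth_fun_restrict V.smooth_fun_restrict)
qed

lemma cis_nat_pi_cases: "cis (real \<epsilon> * pi) = 1 \<or> cis (real \<epsilon> * pi) = -1" for \<epsilon> :: nat
  using cis_nat_pi(2)[of \<epsilon>] by (simp only: square_eq_1_iff)

lemma T0_sign: "T0 A R \<psi> \<epsilon>' x = cis (real \<epsilon>' * pi) * cis (real \<epsilon> * pi) * T0 A R \<psi> \<epsilon> x"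
proof -
  have "cis (real \<epsilon> * pi) * (a * cis (real \<epsilon> * pi)) = a" for a
    using cis_nat_pi(2)[of \<epsilon>] by (metis mult.assoc mult.commute mult_1_left)
  then show ?thesis unfolding T0_def by (simp only: mult.assoc) (simp only: mult.commute)
qed

text \<open>The sign parameter enters t1 only through a factor \<open>cis\<close>, which never
  vanishes.\<close>

lemma t1_sign: "t1 A R \<psi> \<epsilon>' x = 0 \<longleftrightarrow> t1 A R \<psi> \<epsilon> x = 0"
  by (simp add: t1_def)

section \<open>Comparison of the invariants of two representatives\<close>

context coframe_change
begin

text \<open>\<open>shear_abs_change\<close> equates the moduli, so only the sign of f has to be
  compensated, and \<epsilon>' runs over both signs.\<close>

lemma matching_sign:
  assumes "(\<forall>x\<in>U. 0 < f x) \<or> (\<forall>x\<in>U. f x < 0)"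
  shows "\<exists>\<epsilon>'\<in>{0, 1::nat}. \<forall>x\<in>U. cis (real \<epsilon>' * pi) * sh_abs R' x * of_real (f x) = cis (real \<epsilon> * pi)
      * sh_abs R x"
proof -
  obtain \<tau> :: real where \<tau>: "\<tau> = 1 \<or> \<tau> = -1" "\<And>x. x \<in> U \<Longrightarrow> f x = \<tau> * \<bar>f x\<bar>"
  proof (rule disjE[OF assms])
    assume "\<forall>x\<in>U. 0 < f x" then show ?thesis by (intro that[of 1]) auto
  next
    assume "\<forall>x\<in>U. f x < 0" then show ?thesis by (intro that[of "-1"]) auto
  qed
  have "\<exists>\<epsilon>'\<in>{0, 1::nat}. cis (real \<epsilon>' * pi) * of_real \<tau> = cis (real \<epsilon> * pi)"
    using \<tau>(1) cis_nat_pi_cases[of \<epsilon>] by auto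
  then obtain \<epsilon>' :: nat where \<epsilon>': "\<epsilon>' \<in> {0, 1}" "cis (real \<epsilon>' * pi) * of_real \<tau> = cis (real \<epsilon> * pi)"
      by blast
  have "cis (real \<epsilon>' * pi) * sh_abs R' x * of_real (f x) = cis (real \<epsilon> * pi) * sh_abs R x" if x:
      "x \<in> U" for x
  proof -
    have "complex_of_real (f x) = of_real \<tau> * of_real \<bar>f x\<bar>" using \<tau>(2)[OF x] by (metis of_real_mult)
    then have "cis (real \<epsilon>' * pi) * sh_abs R' x * of_real (f x) = (cis (real \<epsilon>' * pi) * of_real \<tau>)
        * of_real (cmod (sh R' x) * \<bar>f x\<bar>)"
      by (simp only: of_real_mult mult_ac)
    then show ?thesis by (simp only: \<epsilon>'(2) shear_abs_change[OF x])
  qed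
  with \<epsilon>' show ?thesis by blast
qed

lemma gauge_invariants:
  assumes branch': "arg_branch A U (sh R') \<psi>'"
    and rel: "\<And>x. x \<in> U \<Longrightarrow> cis (real \<epsilon>' * pi) * sh_abs R' x * of_real (f x) = cis (real \<epsilon> * pi)
        * sh_abs R x"
    and x: "x \<in> U"
  shows "T0 A R' \<psi>' \<epsilon>' x = T0 A R \<psi> \<epsilon> x" "t1 A R' \<psi>' \<epsilon>' x = 0 \<longleftrightarrow> t1 A R \<psi> \<epsilon> x = 0"
    "k0 A R' \<psi>' x = 0 \<longleftrightarrow> k0 A R \<psi> x = 0" "k1 A R' \<psi>' \<epsilon>' x = 0 \<longleftrightarrow> k1 A R \<psi> \<epsilon> x = 0"
proof -
  interpret product_bundle A U by unfold_locales
  obtain F \<sigma> where F: "gauge_map \<psi>' \<epsilon>' F \<sigma>" using gauge_equivalence[OF branch' rel] by blast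
  note F = F[unfolded gauge_map_def Let_def]
  \<comment> \<open>Any point of the fibre over x would serve; \<rho> = 1 makes the powers of \<rho>
    in \<open>P_T1\<close>, \<open>P_K0\<close> and \<open>P_K1\<close> trivial at z.\<close>
  define z where "z = (x, 1::real)"
  have z: "z \<in> carrier PA" "fst z = x" "snd z = 1" using x by (auto simp: z_def carrier_P)
  have Fz: "F z \<in> carrier PA" "fst (F z) = x" using F z by auto
  have nz: "complex_of_real (snd (F z)) \<noteq> 0" using fst_carrier(3)[OF Fz(1)] by simp
  have s: "\<sigma> x \<noteq> 0" using F x by auto
  have "P_T0 A R' \<psi>' \<epsilon>' (F z) = P_T0 A R \<psi> \<epsilon> z" "P_T1 A R' \<psi>' \<epsilon>' (F z) = \<sigma> x * P_T1 A R \<psi> \<epsilon> z"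
    "P_K0 A R' \<psi>' (F z) = P_K0 A R \<psi> z" "P_K1 A R' \<psi>' \<epsilon>' (F z) = \<sigma> x * P_K1 A R \<psi> \<epsilon> z"
    using F z by auto
  then show "T0 A R' \<psi>' \<epsilon>' x = T0 A R \<psi> \<epsilon> x" "t1 A R' \<psi>' \<epsilon>' x = 0 \<longleftrightarrow> t1 A R \<psi> \<epsilon> x = 0"
    "k0 A R' \<psi>' x = 0 \<longleftrightarrow> k0 A R \<psi> x = 0" "k1 A R' \<psi>' \<epsilon>' x = 0 \<longleftrightarrow> k1 A R \<psi> \<epsilon> x = 0"
    using nz s z Fz by (auto simp: P_T0_def P_T1_def P_K0_def P_K1_def field_simps)
qed

text \<open>Around \<open>x0\<close> the factor \<open>f\<close> has constant sign, hence some choice \<open>\<epsilon>''\<close> of \<open>\<epsilon>'\<close> makes the two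
  forms \<open>\<omega>\<close> agree there; changing \<open>\<epsilon>'\<close> multiplies \<open>t1\<close> by a unit and does not affect \<open>k0\<close>.\<close>

lemma local_invariants:
  assumes branch': "arg_branch A U (sh R') \<psi>'" and x0: "x0 \<in> U"
  shows "t1 A R' \<psi>' \<epsilon>' x0 = 0 \<longleftrightarrow> t1 A R \<psi> \<epsilon> x0 = 0" "k0 A R' \<psi>' x0 = 0 \<longleftrightarrow> k0 A R \<psi> x0 = 0"
proof -
  \<comment> \<open>The points of U at which f has the sign that it has at x0; an open set, by
    continuity of f.\<close>
  define V where "V = {x \<in> U. 0 < f x * f x0}"
  have "open (U \<inter> (\<lambda>x. f x * f x0) -` {0<..})"
    by (intro continuous_open_preimage open_U open_greaterThan continuous_intros
        smooth_in_continuous_on[OF f_smooth])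
  also have "U \<inter> (\<lambda>x. f x * f x0) -` {0<..} = V" by (auto simp: V_def)
  finally have V: "open V" "V \<subseteq> U" by (auto simp: V_def)
  have xV: "x0 \<in> V" using x0 f_nz[OF x0] by (auto simp: V_def zero_less_mult_iff linorder_neq_iff)
  interpret V: coframe_change A V R \<psi> \<epsilon> R' f h
    using V mfd U_sub coframe sf no_twist shear
        arg_branch_subset[OF branch V] coframe' sf' f_nz h_nz lam' mu'
      smooth_in_subset[OF f_smooth V(2)] smooth_in_subset[OF h_smooth V(2)]
    by unfold_locales auto
  have "(\<forall>x\<in>V. 0 < f x) \<or> (\<forall>x\<in>V. f x < 0)"
    by (cases "0 < f x0") (auto simp: V_def zero_less_mult_iff)
  from V.matching_sign[OF this] obtain \<epsilon>'' :: nat where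
    rel: "\<forall>x\<in>V. cis (real \<epsilon>'' * pi) * sh_abs R' x * of_real (f x) = cis (real \<epsilon> * pi) * sh_abs R x"
        by blast
  note I = V.gauge_invariants[OF arg_branch_subset[OF branch' V] rel[rule_format] xV]
  show "t1 A R' \<psi>' \<epsilon>' x0 = 0 \<longleftrightarrow> t1 A R \<psi> \<epsilon> x0 = 0"
    using I(2) t1_sign[of A R' \<psi>' \<epsilon>' x0 \<epsilon>''] by simp
  show "k0 A R' \<psi>' x0 = 0 \<longleftrightarrow> k0 A R \<psi> x0 = 0" by (rule I(3))
qed

text \<open>Both forms are multiples of \<lambda>, which is nonzero at every point and whose values
  are attained on lifted vectors. A hypothesis on \<omega> thus becomes a relation between
  scalars.\<close>

lemma form_omega_eq_iff:
  "(\<forall>z\<in>carrier (P_atlas A U). form_omega A U R' \<epsilon>' z = form_omega A U R \<epsilon> z)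
    \<longleftrightarrow> (\<forall>x\<in>U. cis (real \<epsilon>' * pi) * sh_abs R' x * of_real (f x) = cis (real \<epsilon> * pi) * sh_abs R x)"
    (is "?L \<longleftrightarrow> ?R")
proof -
  interpret product_bundle A U by unfold_locales
  have eq: "form_omega A U R' \<epsilon>' z v
      = (cis (real \<epsilon>' * pi) * sh_abs R' (fst z) * of_real (f (fst z))) * pullback PA A fst (lam R) z v"
    if "z \<in> carrier PA" for z v
    unfolding form_omega_def pullback_def lam'[OF fst_carrier(2)[OF that]] by (simp only: mult.assoc)
  show ?thesis
  proof
    assume L: ?L
    show ?R
    proof
      fix x assume x: "x \<in> U"
      define z where "z = (x, 1::real)"
      have z: "z \<in> carrier PA" "fst z = x" using x by (auto simp: z_def carrier_P)
      have "\<exists>v. lam R x v \<noteq> 0"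
      proof (rule ccontr)
        assume "\<nexists>v. lam R x v \<noteq> 0"
        then show False using frame_vol[OF x] by (simp add: wedge3_def wedge_def)
      qed
      then obtain v where v: "lam R x v \<noteq> 0" by blast
      obtain v' where v': "mderiv PA A fst z v' = v" using lift_vector[OF z(1)] .
      have "form_omega A U R' \<epsilon>' z v' = form_omega A U R \<epsilon> z v'" using L z by auto
      then show "cis (real \<epsilon>' * pi) * sh_abs R' x * of_real (f x) = cis (real \<epsilon> * pi) * sh_abs R x"
        using v unfolding eq[OF z(1)] by (simp add: form_omega_def pullback_def z(2) v')
    qed
  next
    assume R: ?R
    show ?L
    proof (intro ballI ext)
      fix z v assume z: "z \<in> carrier PA"
      show "form_omega A U R' \<epsilon>' z v = form_omega A U R \<epsilon> z v"
        unfolding eq[OF z] R[rule_format, OF fst_carrier(2)[OF z]] by (simp only: form_omega_def)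
    qed
  qed
qed

end

text \<open>The open sets with a branch of the phase cover M. Vanishing of k1 is compared only for
  equal \<omega>, because \<epsilon> enters k1 inhomogeneously: passing from 0 to 1 multiplies t1 by
  -i, its conjugate by i, and the remaining term B by i. With t1 and B taken at 0, the condition k1
  = 0 then changes from B = 2 (cnj t1 - t1) to B = 2 (t1 + cnj t1).\<close>

theorem theorem8p2:
  fixes A :: "('m::{t2_space,second_countable_topology}, real^3) chart set"
    and S :: "('m form3 \<times> 'm form3) set"
    and R :: "'m rep"
  assumes manifold: "smooth_manifold A"
    and congruence: "oriented_congruence A S"
    and representative: "(lam R, mu R) \<in> S" "structure_functions A R"
    and no_twist: "\<forall>x\<in>carrier A. tw R x = 0"
    and shear: "\<forall>x\<in>carrier A. sh R x \<noteq> 0"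
  shows "(\<forall>x\<in>carrier A. \<exists>U \<psi>. open U \<and> x \<in> U \<and> U \<subseteq> carrier A \<and> arg_branch A U (sh R) \<psi>) \<and>
    (\<forall>U \<psi>. \<forall>\<epsilon>\<in>{0,1}. open U \<longrightarrow> U \<subseteq> carrier A \<longrightarrow> arg_branch A U (sh R) \<psi> \<longrightarrow>
        (let P = P_atlas A U;
             \<omega> = form_omega A U R \<epsilon>; \<omega>1 = form_omega1 A U R \<psi> \<epsilon>; \<Omega> = form_Omega A U R \<psi> \<epsilon> in
         smooth_manifold P \<and> carrier P = U \<times> {0<..} \<and> smooth_map P A fst \<and>
         smooth_form1 P \<omega> \<and> real_form1 P \<omega> \<and> smooth_form1 P \<omega>1 \<and>
         smooth_form1 P \<Omega> \<and> real_form1 P \<Omega> \<and>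
         (\<forall>z\<in>carrier P. \<exists>u v w y. wedge4 (\<omega> z) (\<omega>1 z) (cnj_form \<omega>1 z) (\<Omega> z) u v w y \<noteq> 0) \<and>
         smooth_fun P (P_T0 A R \<psi> \<epsilon>) \<and> smooth_fun P (P_T1 A R \<psi> \<epsilon>) \<and>
         smooth_fun P (P_K0 A R \<psi>) \<and> smooth_fun P (P_K1 A R \<psi> \<epsilon>) \<and>
         structure_equations P \<omega> \<omega>1 \<Omega>
           (P_T0 A R \<psi> \<epsilon>) (P_T1 A R \<psi> \<epsilon>) (P_K0 A R \<psi>) (P_K1 A R \<psi> \<epsilon>))) \<and>
    (\<forall>U \<psi> (f :: 'm \<times> real \<Rightarrow> real) (g :: 'm \<times> real \<Rightarrow> complex) \<omega> \<omega>1 \<Omega> F0 F1 G0 G1.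
        open U \<longrightarrow> connected U \<longrightarrow> U \<subseteq> carrier A \<longrightarrow> arg_branch A U (sh R) \<psi> \<longrightarrow>
        (let P = P_atlas A U in
         smooth_fun P f \<longrightarrow> smooth_fun P g \<longrightarrow> smooth_form1 P \<Omega> \<longrightarrow>
         (\<forall>z\<in>carrier P. cmod (g z) = snd z) \<longrightarrow>
         \<omega> = (\<lambda>z v. of_real (f z) * pullback P A fst (lam R) z v) \<longrightarrow>
         \<omega>1 = (\<lambda>z v. g z * pullback P A fst (mu R) z v) \<longrightarrow>
         structure_equations P \<omega> \<omega>1 \<Omega> F0 F1 G0 G1 \<longrightarrow>
         (\<exists>\<epsilon>\<in>{0,1}. \<exists>\<psi>'. arg_branch A U (sh R) \<psi>' \<and>
            (\<forall>z\<in>carrier P.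
               \<omega> z = form_omega A U R \<epsilon> z \<and> \<omega>1 z = form_omega1 A U R \<psi>' \<epsilon> z \<and>
               \<Omega> z = form_Omega A U R \<psi>' \<epsilon> z \<and>
               F0 z = P_T0 A R \<psi>' \<epsilon> z \<and> F1 z = P_T1 A R \<psi>' \<epsilon> z \<and>
               G0 z = P_K0 A R \<psi>' z \<and> G1 z = P_K1 A R \<psi>' \<epsilon> z)))) \<and>
    (\<forall>R' U \<psi> \<psi>'. (lam R', mu R') \<in> S \<longrightarrow> structure_functions A R' \<longrightarrow>
        open U \<longrightarrow> U \<subseteq> carrier A \<longrightarrow> arg_branch A U (sh R) \<psi> \<longrightarrow> arg_branch A U (sh R') \<psi>' \<longrightarrow>
        (let P = P_atlas A U in
         (\<forall>\<epsilon>\<in>{0,1}. \<forall>\<epsilon>'\<in>{0,1}.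
            (connected U \<longrightarrow> (\<exists>\<sigma>\<in>{1,-1}. \<forall>x\<in>U. T0 A R' \<psi>' \<epsilon>' x = \<sigma> * T0 A R \<psi> \<epsilon> x)) \<and>
            ((\<forall>x\<in>U. t1 A R' \<psi>' \<epsilon>' x = 0) \<longleftrightarrow> (\<forall>x\<in>U. t1 A R \<psi> \<epsilon> x = 0)) \<and>
            ((\<forall>x\<in>U. k0 A R' \<psi>' x = 0) \<longleftrightarrow> (\<forall>x\<in>U. k0 A R \<psi> x = 0)) \<and>
            ((\<forall>z\<in>carrier P. form_omega A U R' \<epsilon>' z = form_omega A U R \<epsilon> z) \<longrightarrow>
               (\<forall>x\<in>U. T0 A R' \<psi>' \<epsilon>' x = T0 A R \<psi> \<epsilon> x) \<and>
               ((\<forall>x\<in>U. k1 A R' \<psi>' \<epsilon>' x = 0) \<longleftrightarrow> (\<forall>x\<in>U. k1 A R \<psi> \<epsilon> x = 0)) \<and>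
               (connected U \<longrightarrow>
                  (\<exists>F. \<exists>\<sigma>\<in>{1,-1}. diffeomorphism P P F \<and> (\<forall>z\<in>carrier P.
                     fst (F z) = fst z \<and>
                     pullback P P F (form_omega A U R' \<epsilon>') z = form_omega A U R \<epsilon> z \<and>
                     pullback P P F (form_omega1 A U R' \<psi>' \<epsilon>') z
                       = (\<lambda>v. \<sigma> * form_omega1 A U R \<psi> \<epsilon> z v) \<and>
                     pullback P P F (form_Omega A U R' \<psi>' \<epsilon>') z = form_Omega A U R \<psi> \<epsilon> z \<and>
                     P_T0 A R' \<psi>' \<epsilon>' (F z) = P_T0 A R \<psi> \<epsilon> z \<and>
                     P_T1 A R' \<psi>' \<epsilon>' (F z) = \<sigma> * P_T1 A R \<psi> \<epsilon> z \<and>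
                     P_K0 A R' \<psi>' (F z) = P_K0 A R \<psi> z \<and>
                     P_K1 A R' \<psi>' \<epsilon>' (F z) = \<sigma> * P_K1 A R \<psi> \<epsilon> z))))) \<and>
         (connected U \<longrightarrow> (\<forall>\<epsilon>\<in>{0,1}. \<exists>\<epsilon>'\<in>{0,1}.
            \<forall>z\<in>carrier P. form_omega A U R' \<epsilon>' z = form_omega A U R \<epsilon> z))))"
proof -
  have cf: "coframe A (lam R, mu R)"
    using oriented_congruence_related[OF manifold congruence representative(1) representative(1)]
        by metis
  interpret M: open_submanifold A "carrier A" by (rule carrier_submanifold[OF manifold])
  have SB: "shear_bundle A U R \<psi>" if "open U" "U \<subseteq> carrier A" "arg_branch A U (sh R) \<psi>" for U \<psi>
    by unfold_locales (use manifold that cf representative no_twist shear in auto)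
  show ?thesis
  proof (intro conjI, goal_cases)
    case 1
    show ?case
    proof
      fix x assume x: "x \<in> carrier A"
      have sm: "smooth_in A (carrier A) (sh R)"
        using representative(2) by (simp add: structure_functions_def smooth_fun_carrier)
      have "sh R x \<noteq> 0" using shear x by blast
      from M.branch_exists[OF sm this x] obtain V \<psi> where V: "open V" "x \<in> V" "V \<subseteq> carrier A"
        "smooth_in A V \<psi>" "\<forall>x\<in>V. sh R x = of_real (cmod (sh R x)) * cis (\<psi> x)" by blast
      interpret V: open_submanifold A V using V manifold by unfold_locales
      have "arg_branch A V (sh R) \<psi>" using V by (simp add: arg_branch_def V.smooth_fun_restrict)
      with V show "\<exists>U \<psi>. open U \<and> x \<in> U \<and> U \<subseteq> carrier A \<and> arg_branch A U (sh R) \<psi>" by blast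
    qed
  next
    case 2
    show ?case
    proof (intro allI ballI impI, goal_cases)
      case (1 U \<psi> \<epsilon>)
      then interpret B: shear_bundle A U R \<psi> \<epsilon> by (intro SB)
      show ?case
        unfolding Let_def real_form1_def Reals_cnj_iff B.smooth_fun_P B.smooth_form1_P
        by (intro conjI ballI allI B.P_manifold B.carrier_P B.fst_smooth B.om_form B.om_real B.om1_form
            B.Om_form B.Om_real B.om_wedge4 B.P_invariants_smooth B.P_structure)
    qed
  next
    case 3
    show ?case
    proof (intro allI impI, unfold Let_def, intro impI, goal_cases)
      case (1 U \<psi> f g \<omega> \<omega>1 \<Omega> F0 F1 G0 G1)
      \<comment> \<open>The value 0 only instantiates the locale; the \<epsilon> of the conclusion
        is produced by the lemma from the sign of f.\<close>
      then interpret B: shear_bundle A U R \<psi> 0 by (intro SB)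
      show ?case
        using B.normalized_coframe_unique[OF 1(2), of f g \<Omega> F0 F1 G0 G1] 1(5,6,8,11)
        unfolding 1(9,10) B.smooth_fun_P by blast
    qed
  next
    case 4
    show ?case
    proof (intro allI impI, goal_cases)
      case (1 R' U \<psi> \<psi>')
      note R' = 1(1,2) and U = 1(3,4) and br = 1(5) and br' = 1(6)
      obtain f :: "'m \<Rightarrow> real" and h :: "'m \<Rightarrow> complex"
        where fh: "coframe A (lam R, mu R)" "coframe A (lam R', mu R')" "smooth_fun A f"
            "smooth_fun A h"
        "\<And>x. x \<in> carrier A \<Longrightarrow> f x \<noteq> 0" "\<And>x. x \<in> carrier A \<Longrightarrow> h x \<noteq> 0"
        "\<And>x v. x \<in> carrier A \<Longrightarrow> lam R' x v = of_real (f x) * lam R x v"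
        "\<And>x v. x \<in> carrier A \<Longrightarrow> mu R' x v = h x * mu R x v"
        by (rule oriented_congruence_related[OF manifold congruence representative(1) R'(1)],
            rule that, assumption+)
      have change: "coframe_change A U R \<psi> R' f h"
      proof -
        interpret B: shear_bundle A U R \<psi> 0 by (rule SB[OF U br])
        show ?thesis
          by unfold_locales (use fh R'(2) U(2) B.smooth_in_of_smooth_fun in \<open>auto simp: subset_iff\<close>)
      qed
      \<comment> \<open>Neither k0 nor the factors f and h involve \<epsilon>, so the instance at 0
        serves for all its values.\<close>
      interpret C0: coframe_change A U R \<psi> 0 R' f h by (rule change)
      have sgn: "(\<forall>x\<in>U. 0 < f x) \<or> (\<forall>x\<in>U. f x < 0)" if "connected U"
        by (rule nonvanishing_sign[OF that C0.smooth_in_continuous_on[OF C0.f_smooth] C0.f_nz])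
      show ?case
      proof (unfold Let_def, intro conjI ballI impI, goal_cases)
        case (1 \<epsilon> \<epsilon>')
        interpret C: coframe_change A U R \<psi> \<epsilon> R' f h by (rule change)
        \<comment> \<open>For \<epsilon>'' the two forms \<omega> agree and so do the functions
          \<open>T0\<close>; the passage from \<epsilon>'' to \<epsilon>' accounts for the
          sign.\<close>
        obtain \<epsilon>'' :: nat where e: "\<forall>x\<in>U. cis (real \<epsilon>'' * pi) * sh_abs R' x * of_real (f x)
            = cis (real \<epsilon> * pi) * sh_abs R x"
          using C.matching_sign[OF sgn[OF 1(3)]] by blast
        have "T0 A R' \<psi>' \<epsilon>' x = cis (real \<epsilon>' * pi) * cis (real \<epsilon>'' * pi) * T0 A R \<psi> \<epsilon> x" if "x \<in> U"
            for x
          using T0_sign[of A R' \<psi>' \<epsilon>' x \<epsilon>''] C.gauge_invariants(1)[OF br' e[rule_format] that] by simp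
        moreover have "cis (real \<epsilon>' * pi) * cis (real \<epsilon>'' * pi) \<in> {1,-1}"
          using cis_nat_pi_cases[of \<epsilon>'] cis_nat_pi_cases[of \<epsilon>''] by auto
        ultimately show ?case by blast
      next
        case (2 \<epsilon> \<epsilon>')
        interpret C: coframe_change A U R \<psi> \<epsilon> R' f h by (rule change)
        show ?case by (intro ball_cong refl C.local_invariants(1)[OF br'])
      next
        case (3 \<epsilon> \<epsilon>')
        show ?case by (intro ball_cong refl C0.local_invariants(2)[OF br'])
      next
        case (4 \<epsilon> \<epsilon>' x)
        interpret C: coframe_change A U R \<psi> \<epsilon> R' f h by (rule change)
        show ?case using 4(3,4) C.gauge_invariants(1)[OF br'] unfolding C.form_omega_eq_iff by blast
      next
        case (5 \<epsilon> \<epsilon>')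
        interpret C: coframe_change A U R \<psi> \<epsilon> R' f h by (rule change)
        show ?case
          using 5(3) C.gauge_invariants(4)[OF br'] unfolding C.form_omega_eq_iff
          by (intro ball_cong refl) blast
      next
        case (6 \<epsilon> \<epsilon>')
        interpret C: coframe_change A U R \<psi> \<epsilon> R' f h by (rule change)
        interpret B: product_bundle A U by unfold_locales
        have rel: "\<And>x. x \<in> U \<Longrightarrow> cis (real \<epsilon>' * pi) * sh_abs R' x * of_real (f x)
            = cis (real \<epsilon> * pi) * sh_abs R x"
          using 6(3) unfolding C.form_omega_eq_iff by blast
        obtain F \<sigma> where F: "C.gauge_map \<psi>' \<epsilon>' F \<sigma>" using C.gauge_equivalence[OF br' rel] by blast
        note F = F[unfolded C.gauge_map_def Let_def]
        \<comment> \<open>Pointwise \<sigma> is 1 or -1; connectedness of U turns it into the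
          constant that the statement asks for.\<close>
        have "continuous_on U (\<lambda>x. Re (\<sigma> x))"
          using F by (intro continuous_intros C0.smooth_in_continuous_on) blast
        moreover have "Re (\<sigma> x) \<noteq> 0" if "x \<in> U" for x using F that by auto
        ultimately have "(\<forall>x\<in>U. 0 < Re (\<sigma> x)) \<or> (\<forall>x\<in>U. Re (\<sigma> x) < 0)"
          by (rule nonvanishing_sign[OF 6(4)])
        then have "\<exists>s\<in>{1,-1}. \<forall>x\<in>U. \<sigma> x = s" using F by force
        then obtain s where s: "s \<in> {1,-1}" "\<And>z. z \<in> carrier (P_atlas A U) \<Longrightarrow> \<sigma> (fst z) = s"
          using B.fst_carrier(2) by blast
        show ?case by (rule exI[of _ F], rule bexI[OF _ s(1)]) (use F s(2) in auto)
      next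
        case (7 \<epsilon>)
        interpret C: coframe_change A U R \<psi> \<epsilon> R' f h by (rule change)
        show ?case unfolding C.form_omega_eq_iff by (rule C.matching_sign[OF sgn[OF 7(1)]])
      qed
    qed
  qed
qed

end
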